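(* Let $p>3$, let $A$ be a complete discrete valuation ring of residue characteristic $p$, and let $E$ be an elliptic curve over $A$ given in Weierstrass form $y^2=x^3+a_4x+a_6$ ($a_4,a_6\in A$) with ordinary (good or bad) reduction. Let $\rho:R\to A$ be the specialization $\rho(A_4)=a_4$, $\rho(A_6)=a_6$; then $\rho(H)$ is a unit of $A$, so $\rho$ extends to $R_H$ and then (as $A$ is $p$-complete) to $\hat R$. Then the power series obtained from $\sigma_{\mathcal{E}/\hat{R}}(t)$ by applying $\rho$ to its coefficients equals the Mazur–Tate $p$-adic sigma function $\sigma_{E/A}(t)$.
   Context: $R=\mathbb{Z}[\tfrac16][A_4,A_6]$ with $A_4,A_6$ indeterminates, $H$ the coefficient of $x^{p-1}$ in $(x^3+A_4x+A_6)^{(p-1)/2}$, $R_H=R[1/H]$, $\hat{R}=\varprojlim_nR_H/p^nR_H$. Let $\mathcal{E}$ be the projective closure of $y^2=x^3+A_4x+A_6$ over $R$, $t=-x/y$, $\omega=dx/(2y)=W(t)dt$ with $W\in1+R[[t]]$, $D$ the derivation $Dh=(dh/dt)/W(t)$. $\sigma_{\mathcal{E}/\hat R}(t)$ denotes the unique odd power series in $\hat R[[t]]$ with lead term $t$ such that $D(D\sigma_{\mathcal{E}/\hat R}/\sigma_{\mathcal{E}/\hat R})+x(t)\in\hat{R}$. For $E/A$ as in the claim, with $t=-x/y$ on $E$, the Mazur–Tate $p$-adic sigma function $\sigma_{E/A}(t)$ (attached to $\omega=dx/2y$) is the unique power series in $A[[t]]$, odd under $t\mapsto -t$, with lead term $t$,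 such that for all points $u,v$ in the kernel of reduction of $E/A$ (with $u\ne\pm v$, $u,v\neq O$), $\sigma_{E/A}(u+v)\sigma_{E/A}(u-v)/(\sigma_{E/A}(u)^2\sigma_{E/A}(v)^2)=x(v)-x(u)$, where $\sigma_{E/A}(w)$ means $\sigma_{E/A}$ evaluated at $t(w)$. *)

theory Defs
  imports
    "HOL-Computational_Algebra.Computational_Algebra"
    "Berlekamp_Zassenhaus.Finite_Field"
begin

hide_const (open) up_ring.coeff up_ring.monom Module.smult

section \<open>The universal base ring\<close>

typedef zinv6 = "{q :: rat. \<exists>n. q * 6 ^ n \<in> \<int>}"
  by (rule exI[of _ 0]) auto

setup_lifting type_definition_zinv6

lemma zinv6_mult:
  assumes "\<exists>n. (a::rat) * 6 ^ n \<in> \<int>" "\<exists>n. b * 6 ^ n \<in> \<int>"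
  shows "\<exists>n. (a * b) * 6 ^ n \<in> \<int>"
proof -
  from assms obtain m n where "a * 6 ^ m \<in> \<int>" "b * 6 ^ n \<in> \<int>" by blast
  hence "(a * 6 ^ m) * (b * 6 ^ n) \<in> \<int>" by (rule Ints_mult)
  thus ?thesis by (intro exI[of _ "m + n"]) (simp add: power_add mult_ac)
qed

lemma zinv6_add:
  assumes "\<exists>n. (a::rat) * 6 ^ n \<in> \<int>" "\<exists>n. b * 6 ^ n \<in> \<int>"
  shows "\<exists>n. (a + b) * 6 ^ n \<in> \<int>"
proof -
  from assms obtain m n where mn: "a * 6 ^ m \<in> \<int>" "b * 6 ^ n \<in> \<int>" by blast
  have "(6::rat) ^ k \<in> \<int>" for k by (metis Ints_numeral Ints_power)
  hence "(a * 6 ^ m) * 6 ^ n + (b * 6 ^ n) * 6 ^ m \<in> \<int>"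
    using Ints_add Ints_mult mn by blast
  thus ?thesis by (intro exI[of _ "m + n"]) (simp add: power_add algebra_simps)
qed

lemma zinv6_minus:
  assumes "\<exists>n. (a::rat) * 6 ^ n \<in> \<int>"
  shows "\<exists>n. (- a) * 6 ^ n \<in> \<int>"
  using assms by (metis Ints_minus mult_minus_left)

instantiation zinv6 :: idom
begin
lift_definition zero_zinv6 :: zinv6 is 0 by auto
lift_definition one_zinv6 :: zinv6 is 1 by (rule exI[of _ 0]) auto
lift_definition plus_zinv6 :: "zinv6 \<Rightarrow> zinv6 \<Rightarrow> zinv6" is "(+)" by (rule zinv6_add)
lift_definition times_zinv6 :: "zinv6 \<Rightarrow> zinv6 \<Rightarrow> zinv6" is "(*)" by (rule zinv6_mult)
lift_definition uminus_zinv6 :: "zinv6 \<Rightarrow> zinv6" is uminus by (rule zinv6_minus)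
lift_definition minus_zinv6 :: "zinv6 \<Rightarrow> zinv6 \<Rightarrow> zinv6" is "(-)"
  using zinv6_add zinv6_minus by (metis diff_conv_add_uminus)
instance by standard (transfer; simp add: algebra_simps)+
end

text \<open>The ring \<open>\<int>[1/6][A\<^sub>4, A\<^sub>6]\<close> is encoded as \<open>(\<int>[1/6][A\<^sub>4])[A\<^sub>6]\<close>.\<close>

type_synonym univ_R = "zinv6 poly poly"

definition A4 :: univ_R where "A4 = [:[:0, 1:]:]"
definition A6 :: univ_R where "A6 = [:0, 1:]"

definition hasse :: "nat \<Rightarrow> univ_R" where
  "hasse p = coeff ([:A6, A4, 0, 1:] ^ ((p - 1) div 2)) (p - 1)"

text \<open>The prime \<open>p > 3\<close> enters through a type \<open>'p\<close> of cardinality \<open>p\<close>, so that \<open>R\<^sub>H\<close> and its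
  completion are types.\<close>

class prime_card_gt3 = prime_card + assumes card_gt3: "CARD('a) > 3"


lemma zinv6_eval_hom: "comm_ring_hom (\<lambda>r :: univ_R. poly (poly r [:2:]) (-3))"
  by unfold_locales (simp_all add: poly_hom.hom_add)

lemma int_nodal_hasse:
  "\<not> int CARD('p :: prime_card_gt3) dvd
     coeff ([:2, -3, 0, 1:] ^ ((CARD('p) - 1) div 2)) (CARD('p) - 1)"
proof -
  let ?p = "CARD('p)"
  define m where "m = (?p - 1) div 2"
  have p: "prime ?p" "?p > 3" using prime_card card_gt3 by auto
  hence "odd ?p" using prime_odd_nat by auto
  hence pm: "?p - 1 = 2 * m" "?p = Suc (2 * m)" unfolding m_def by (auto elim: oddE)
  define g :: "'p mod_ring poly" where "g = [:2, 1:] ^ m"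
  define S :: "'p mod_ring poly" where "S = (\<Sum>i<?p. monom 1 i)"
  define l :: "'p mod_ring poly" where "l = [:-1, 1:]"
  have charp: "CHAR('p mod_ring poly) = ?p" by simp
  have X: "[:0, 1:] ^ n = (monom 1 n :: 'p mod_ring poly)" for n
    by (simp add: monom_altdef)
  have lX: "l = [:0,1:] - 1" unfolding l_def by (simp add: one_pCons)
  have "l ^ ?p + 1 = [:0,1:] ^ ?p"
  proof -
    have "(l + 1) ^ CHAR('p mod_ring poly) = l ^ CHAR('p mod_ring poly) + 1 ^ CHAR('p mod_ring poly)"
      by (rule freshmans_dream) (use p charp in auto)
    thus ?thesis unfolding charp lX by simp
  qed
  hence "l ^ ?p = [:0,1:] ^ ?p - 1" by (simp add: algebra_simps)
  also have "\<dots> = l * S"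
    unfolding lX S_def X[symmetric] using power_diff_1_eq[of "[:0,1:] :: 'p mod_ring poly" ?p] by simp
  finally have "l * l ^ (?p - 1) = l * S" using pm(2) by (metis power_Suc diff_Suc_1)
  moreover have "l \<noteq> 0" unfolding l_def by simp
  ultimately have lS: "l ^ (?p - 1) = S" by (metis mult_cancel_left)
  have fac: "[:2, -3, 0, 1:] = l ^ 2 * [:2, 1:]"
    unfolding l_def by (simp add: power2_eq_square)
  have "[:2, -3, 0, 1:] ^ m = l ^ (?p - 1) * g"
    unfolding fac g_def power_mult_distrib pm(1) power_mult ..
  hence "coeff ([:2, -3, 0, 1:] ^ m) (?p - 1) = coeff (S * g) (?p - 1)"
    by (simp only: lS)
  also have "\<dots> = (\<Sum>i\<le>?p - 1. coeff S i * coeff g (?p - 1 - i))"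
    by (simp add: coeff_mult)
  also have "\<dots> = (\<Sum>i\<le>?p - 1. coeff g (?p - 1 - i))"
  proof (rule sum.cong[OF refl])
    fix i assume "i \<in> {..?p - 1}"
    hence "i < ?p" using p by auto
    have "coeff S i = (\<Sum>j<?p. if j = i then 1 else 0)"
      unfolding S_def coeff_sum by (intro sum.cong) (auto simp: coeff_monom)
    also have "\<dots> = 1" using \<open>i < ?p\<close> by simp
    finally show "coeff S i * coeff g (?p - 1 - i) = coeff g (?p - 1 - i)" by simp
  qed
  also have "\<dots> = (\<Sum>i\<le>?p - 1. coeff g i)"
    by (rule sum.reindex_bij_witness[of _ "\<lambda>i. ?p - 1 - i" "\<lambda>i. ?p - 1 - i"]) auto
  also have "\<dots> = poly g 1"
  proof -
    have "degree g \<le> ?p - 1" unfolding g_def pm(1) by (simp add: degree_power_eq)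
    hence "(\<Sum>i\<le>?p - 1. coeff g i) = (\<Sum>i\<le>degree g. coeff g i)"
      by (intro sum.mono_neutral_right) (auto simp: coeff_eq_0)
    thus ?thesis by (simp add: poly_altdef)
  qed
  also have "\<dots> = 3 ^ m" unfolding g_def by simp
  finally have 1: "coeff ([:2, -3, 0, 1:] ^ m) (?p - 1) = (3 :: 'p mod_ring) ^ m" .
  have "of_int (coeff ([:2, -3, 0, 1:] ^ m) (?p - 1))
      = coeff (map_poly of_int ([:2, -3, 0, 1:] ^ m)) (?p - 1)" by simp
  also have "\<dots> = (3 :: 'p mod_ring) ^ m" unfolding 1[symmetric] by (simp add: of_int_poly_hom.hom_power)
  finally have 2: "of_int (coeff ([:2, -3, 0, 1:] ^ m) (?p - 1)) = (3 :: 'p mod_ring) ^ m" .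
  have "(3 :: 'p mod_ring) \<noteq> 0"
    using p of_nat_eq_0_iff_char_dvd[of 3, where 'a = "'p mod_ring"] by (auto dest: dvd_imp_le)
  hence "of_int (coeff ([:2, -3, 0, 1:] ^ m) (?p - 1)) \<noteq> (0 :: 'p mod_ring)"
    using 2 by simp
  thus ?thesis unfolding m_def[symmetric] using of_int_eq_0_iff_char_dvd[where 'a = "'p mod_ring"] by auto
qed

lemma hasse_power_not_dvd:
  "\<not> of_nat CARD('p :: prime_card_gt3) dvd hasse CARD('p) ^ n"
proof
  let ?p = "CARD('p)" and ?m = "(CARD('p) - 1) div 2"
  let ?e = "\<lambda>r :: univ_R. poly (poly r [:2:]) (-3)"
  let ?h = "coeff ([:2, -3, 0, 1 :: int:] ^ ?m) (?p - 1)"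
  have p: "prime ?p" "?p > 3" using prime_card card_gt3 by auto
  interpret e: comm_ring_hom ?e by (rule zinv6_eval_hom)
  interpret E: map_poly_comm_ring_hom ?e ..
  have "?e (hasse ?p) = coeff (map_poly ?e ([:A6, A4, 0, 1:] ^ ?m)) (?p - 1)"
    unfolding hasse_def by simp
  also have "\<dots> = coeff (map_poly of_int ([:2, -3, 0, 1 :: int:] ^ ?m)) (?p - 1)"
    by (simp add: E.hom_power of_int_poly_hom.hom_power A4_def A6_def)
  also have "\<dots> = of_int ?h" by simp
  finally have eh: "?e (hasse ?p) = of_int ?h" .
  assume "of_nat ?p dvd hasse ?p ^ n"
  then obtain r where "hasse ?p ^ n = of_nat ?p * r" by (elim dvdE)
  hence "?e (hasse ?p ^ n) = ?e (of_nat ?p * r)" by simp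
  hence eq: "of_int ?h ^ n = of_nat ?p * ?e r"
    by (simp only: e.hom_power e.hom_mult e.hom_of_nat eh)
  obtain k where k: "Rep_zinv6 (?e r) * 6 ^ k \<in> \<int>" using Rep_zinv6[of "?e r"] by auto
  then obtain z where z: "Rep_zinv6 (?e r) * 6 ^ k = of_int z" by (auto elim: Ints_cases)
  have rep: "Rep_zinv6 1 = 1" "Rep_zinv6 0 = 0" "Rep_zinv6 (a * b) = Rep_zinv6 a * Rep_zinv6 b"
    "Rep_zinv6 (a + b) = Rep_zinv6 a + Rep_zinv6 b" for a b by (transfer; simp)+
  interpret r: comm_ring_hom Rep_zinv6 by unfold_locales (auto simp: rep)
  have "of_int ?h ^ n = of_nat ?p * Rep_zinv6 (?e r)"
    using arg_cong[OF eq, of Rep_zinv6] by (simp only: r.hom_power r.hom_mult r.hom_of_nat r.hom_of_int)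
  hence "(of_int (?h ^ n * 6 ^ k) :: rat) = of_int (int ?p * z)"
    using z by simp
  hence "?h ^ n * 6 ^ k = int ?p * z" by (simp only: of_int_eq_iff)
  hence "int ?p dvd ?h ^ n * 6 ^ k" by simp
  hence "int ?p dvd ?h \<or> int ?p dvd 6"
    using p(1) prime_dvd_power[of "int ?p"] by (auto simp: prime_dvd_mult_iff)
  moreover have "\<not> int ?p dvd 6"
  proof
    assume "int ?p dvd 6"
    hence "?p dvd 2 * 3" by presburger
    hence "?p dvd 2 \<or> ?p dvd 3" using p prime_dvd_mult_iff by blast
    thus False using p by (auto dest: dvd_imp_le)
  qed
  ultimately show False using int_nodal_hasse[where 'p = 'p] by blast
qed

lemma hasse_nonzero: "hasse CARD('p :: prime_card_gt3) \<noteq> 0"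
  using hasse_power_not_dvd[where 'p = 'p, of 1] by auto

typedef ('p :: prime_card_gt3) univ_RH =
  "{x :: univ_R fract. \<exists>r n. x = to_fract r / to_fract (hasse CARD('p)) ^ n}"
  by (rule exI[of _ 0]) (auto intro!: exI[of _ 0])

setup_lifting type_definition_univ_RH

lemma localization_mult:
  assumes "\<exists>r n. x = to_fract (r :: 'a :: idom) / to_fract h ^ n"
    and "\<exists>r n. y = to_fract r / to_fract h ^ n"
  shows "\<exists>r n. x * y = to_fract r / to_fract h ^ n"
proof -
  from assms obtain r m s n where "x = to_fract r / to_fract h ^ m" "y = to_fract s / to_fract h ^ n"
    by blast
  thus ?thesis
    by (intro exI[of _ "r * s"] exI[of _ "m + n"]) (simp add: power_add)
qed

lemma to_fract_power: "to_fract (a ^ n) = to_fract a ^ n"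
  by (induction n) auto

lemma localization_add:
  assumes "\<exists>r n. x = to_fract (r :: 'a :: idom) / to_fract h ^ n"
    and "\<exists>r n. y = to_fract r / to_fract h ^ n" and "h \<noteq> 0"
  shows "\<exists>r n. x + y = to_fract r / to_fract h ^ n"
proof -
  from assms obtain r m s n where xy: "x = to_fract r / to_fract h ^ m" "y = to_fract s / to_fract h ^ n"
    by blast
  have "x + y = to_fract (r * h ^ n + s * h ^ m) / to_fract h ^ (m + n)"
    unfolding xy using assms(3) by (simp add: power_add to_fract_power add_frac_eq)
  thus ?thesis by blast
qed

lemma localization_minus:
  assumes "\<exists>r n. x = to_fract (r :: 'a :: idom) / to_fract h ^ n"
  shows "\<exists>r n. - x = to_fract r / to_fract h ^ n"
  using assms by (metis minus_divide_left to_fract_uminus)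

instantiation univ_RH :: (prime_card_gt3) idom
begin
lift_definition zero_univ_RH :: "'a univ_RH" is 0
  by (auto intro!: exI[of _ 0])
lift_definition one_univ_RH :: "'a univ_RH" is 1
  by (rule exI[of _ 1], rule exI[of _ 0]) simp
lift_definition plus_univ_RH :: "'a univ_RH \<Rightarrow> 'a univ_RH \<Rightarrow> 'a univ_RH" is "(+)"
  by (rule localization_add[OF _ _ hasse_nonzero])
lift_definition times_univ_RH :: "'a univ_RH \<Rightarrow> 'a univ_RH \<Rightarrow> 'a univ_RH" is "(*)"
  by (rule localization_mult)
lift_definition uminus_univ_RH :: "'a univ_RH \<Rightarrow> 'a univ_RH" is uminus
  by (rule localization_minus)
lift_definition minus_univ_RH :: "'a univ_RH \<Rightarrow> 'a univ_RH \<Rightarrow> 'a univ_RH" is "(-)"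
  using localization_add[OF _ localization_minus hasse_nonzero] by (metis diff_conv_add_uminus)
instance by standard (transfer; simp add: algebra_simps)+
end

definition R_to_RH :: "univ_R \<Rightarrow> ('p :: prime_card_gt3) univ_RH" where
  "R_to_RH r = Abs_univ_RH (to_fract r)"

lemma Rep_univ_RH_of_nat: "Rep_univ_RH (of_nat n) = of_nat n"
  by (induction n) (simp_all add: zero_univ_RH.rep_eq plus_univ_RH.rep_eq one_univ_RH.rep_eq)

lemma not_p_dvd_one: "\<not> of_nat CARD('p) dvd (1 :: ('p :: prime_card_gt3) univ_RH)"
proof
  let ?H = "hasse CARD('p)"
  assume "of_nat CARD('p) dvd (1 :: 'p univ_RH)"
  then obtain x :: "'p univ_RH" where "1 = of_nat CARD('p) * x" by (elim dvdE)
  hence "Rep_univ_RH (1 :: 'p univ_RH) = Rep_univ_RH (of_nat CARD('p) * x)" by simp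
  hence 1: "1 = of_nat CARD('p) * Rep_univ_RH x"
    by (simp only: one_univ_RH.rep_eq times_univ_RH.rep_eq Rep_univ_RH_of_nat)
  obtain r n where "Rep_univ_RH x = to_fract r / to_fract ?H ^ n"
    using Rep_univ_RH[of x] by auto
  with 1 have "to_fract (?H ^ n) = of_nat CARD('p) * to_fract r"
    using hasse_nonzero[where 'p = 'p] by (simp add: to_fract_power field_simps)
  also have "of_nat k = to_fract (of_nat k :: univ_R)" for k by (induction k) auto
  finally have "?H ^ n = of_nat CARD('p) * r" by (simp flip: to_fract_mult)
  thus False using hasse_power_not_dvd[where 'p = 'p, of n] by simp
qed

text \<open>An element of the inverse limit of the rings \<open>R\<^sub>H / p\<^sup>n\<close> is given by representatives
  \<open>s n\<close> of its components, with \<open>s (n + 1) \<equiv> s n (mod p\<^sup>n)\<close>; two such families give the same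
  element iff they agree modulo \<open>p\<^sup>n\<close> for each \<open>n\<close>.\<close>

definition compatible_family :: "(nat \<Rightarrow> ('p :: prime_card_gt3) univ_RH) \<Rightarrow> bool" where
  "compatible_family s \<longleftrightarrow> (\<forall>n. of_nat CARD('p) ^ n dvd (s (Suc n) - s n))"

definition same_limit ::
  "(nat \<Rightarrow> ('p :: prime_card_gt3) univ_RH) \<Rightarrow> (nat \<Rightarrow> 'p univ_RH) \<Rightarrow> bool" where
  "same_limit s s' \<longleftrightarrow> compatible_family s \<and> compatible_family s' \<and>
     (\<forall>n. of_nat CARD('p) ^ n dvd (s n - s' n))"

lemma dvd_diff_mult:
  assumes "(d :: 'a :: comm_ring_1) dvd a - a'" "d dvd b - b'"
  shows "d dvd a * b - a' * b'"
proof -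
  have "a * b - a' * b' = (a - a') * b + a' * (b - b')" by (simp add: algebra_simps)
  thus ?thesis using assms by simp
qed

lemma dvd_diff_add:
  assumes "(d :: 'a :: comm_ring_1) dvd a - a'" "d dvd b - b'"
  shows "d dvd (a + b) - (a' + b')"
  using dvd_add[OF assms] by (simp add: algebra_simps)

lemma dvd_diff_uminus:
  assumes "(d :: 'a :: comm_ring_1) dvd a - a'"
  shows "d dvd (- a) - (- a')"
  using assms by (metis dvd_minus_iff minus_diff_eq minus_diff_minus)

lemma same_limit_const [simp]: "same_limit (\<lambda>_. x) (\<lambda>_. x)"
  by (simp add: same_limit_def compatible_family_def)

lemma same_limit_part_equivp:
  "part_equivp (same_limit :: (nat \<Rightarrow> ('p :: prime_card_gt3) univ_RH) \<Rightarrow> _)"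
proof (rule part_equivpI)
  show "\<exists>s :: nat \<Rightarrow> 'p univ_RH. same_limit s s" using same_limit_const by blast
  show "symp (same_limit :: (nat \<Rightarrow> 'p univ_RH) \<Rightarrow> _)"
    by (rule sympI) (metis dvd_minus_iff minus_diff_eq same_limit_def)
  show "transp (same_limit :: (nat \<Rightarrow> 'p univ_RH) \<Rightarrow> _)"
  proof (rule transpI)
    fix s t u :: "nat \<Rightarrow> 'p univ_RH" assume "same_limit s t" "same_limit t u"
    moreover have "s n - u n = (s n - t n) + (t n - u n)" for n by simp
    ultimately show "same_limit s u" unfolding same_limit_def by (metis dvd_add)
  qed
qed

quotient_type 'p univ_Rhat =
  "nat \<Rightarrow> ('p :: prime_card_gt3) univ_RH" / partial: same_limit
  by (rule same_limit_part_equivp)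

instantiation univ_Rhat :: (prime_card_gt3) comm_ring_1
begin
lift_definition zero_univ_Rhat :: "'a univ_Rhat" is "\<lambda>_. 0" by simp
lift_definition one_univ_Rhat :: "'a univ_Rhat" is "\<lambda>_. 1" by simp
lift_definition plus_univ_Rhat :: "'a univ_Rhat \<Rightarrow> 'a univ_Rhat \<Rightarrow> 'a univ_Rhat"
  is "\<lambda>s t n. s n + t n"
  by (auto simp: same_limit_def compatible_family_def intro!: dvd_diff_add)
lift_definition times_univ_Rhat :: "'a univ_Rhat \<Rightarrow> 'a univ_Rhat \<Rightarrow> 'a univ_Rhat"
  is "\<lambda>s t n. s n * t n"
  by (auto simp: same_limit_def compatible_family_def intro!: dvd_diff_mult)
lift_definition uminus_univ_Rhat :: "'a univ_Rhat \<Rightarrow> 'a univ_Rhat" is "\<lambda>s n. - s n"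
  unfolding same_limit_def compatible_family_def using dvd_diff_uminus by blast
definition minus_univ_Rhat :: "'a univ_Rhat \<Rightarrow> 'a univ_Rhat \<Rightarrow> 'a univ_Rhat"
  where "minus_univ_Rhat a b = a + - b"
instance
proof
  fix a b c :: "'a univ_Rhat"
  show "a * b * c = a * (b * c)"
    by transfer (auto simp: same_limit_def compatible_family_def mult.assoc intro!: dvd_diff_mult)
  show "a * b = b * a"
    by transfer (auto simp: same_limit_def compatible_family_def mult.commute intro!: dvd_diff_mult)
  show "1 * a = a"
    by transfer (auto simp: same_limit_def compatible_family_def)
  show "a + b + c = a + (b + c)"
    by transfer (auto simp: same_limit_def compatible_family_def add.assoc intro!: dvd_diff_add)
  show "a + b = b + a"
    by transfer (auto simp: same_limit_def compatible_family_def add.commute intro!: dvd_diff_add)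
  show "0 + a = a"
    by transfer (auto simp: same_limit_def compatible_family_def)
  show "- a + a = 0"
    by transfer (auto simp: same_limit_def compatible_family_def)
  show "a - b = a + - b" by (rule minus_univ_Rhat_def)
  show "(a + b) * c = a * c + b * c"
    by transfer (auto simp: same_limit_def compatible_family_def distrib_right
          intro!: dvd_diff_mult dvd_diff_add)
  show "(0 :: 'a univ_Rhat) \<noteq> 1"
  proof (transfer, rule notI)
    assume "same_limit (\<lambda>_. 0 :: 'a univ_RH) (\<lambda>_. 1)"
    hence "of_nat CARD('a) ^ 1 dvd (0 - 1 :: 'a univ_RH)" unfolding same_limit_def by blast
    thus False using not_p_dvd_one[where 'p = 'a] by simp
  qed
qed
end

definition RH_to_Rhat :: "('p :: prime_card_gt3) univ_RH \<Rightarrow> 'p univ_Rhat" where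
  "RH_to_Rhat x = abs_univ_Rhat (\<lambda>_. x)"

definition R_to_Rhat :: "univ_R \<Rightarrow> ('p :: prime_card_gt3) univ_Rhat" where
  "R_to_Rhat r = RH_to_Rhat (R_to_RH r)"


section \<open>Formal expansions at the origin of a Weierstrass curve\<close>

text \<open>Everything is expanded in \<open>t = -x/y\<close>. The function \<open>w = -1/y\<close> satisfies
  \<open>w = t\<^sup>3 + a\<^sub>4 t w\<^sup>2 + a\<^sub>6 w\<^sup>3\<close>, and \<open>x = t/w\<close>, \<open>y = -1/w\<close>.\<close>

definition weier_w :: "'a :: comm_ring_1 \<Rightarrow> 'a \<Rightarrow> 'a fps" where
  "weier_w a4 a6 = (THE w. fps_nth w 0 = 0 \<and>
     w = fps_X ^ 3 + fps_const a4 * fps_X * w ^ 2 + fps_const a6 * w ^ 3)"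

text \<open>The inverse of a Laurent series whose lowest nonzero coefficient is 1; the coefficient ring
  need not be a field.\<close>

definition fls_inv1 :: "'a :: comm_ring_1 fls \<Rightarrow> 'a fls" where
  "fls_inv1 f = fls_right_inverse f 1"

definition weier_x :: "'a :: comm_ring_1 \<Rightarrow> 'a \<Rightarrow> 'a fls" where
  "weier_x a4 a6 = fls_X * fls_inv1 (fps_to_fls (weier_w a4 a6))"

definition weier_y :: "'a :: comm_ring_1 \<Rightarrow> 'a \<Rightarrow> 'a fls" where
  "weier_y a4 a6 = - fls_inv1 (fps_to_fls (weier_w a4 a6))"

text \<open>\<open>W(t) dt = dx / (2y)\<close>\<close>

definition weier_W :: "'a :: comm_ring_1 \<Rightarrow> 'a \<Rightarrow> 'a fls" where
  "weier_W a4 a6 = (THE W. 2 * weier_y a4 a6 * W = fls_deriv (weier_x a4 a6))"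

definition weier_D :: "'a :: comm_ring_1 \<Rightarrow> 'a \<Rightarrow> 'a fls \<Rightarrow> 'a fls" where
  "weier_D a4 a6 h = fls_deriv h * fls_inv1 (weier_W a4 a6)"

definition odd_with_lead_t :: "'a :: comm_ring_1 fps \<Rightarrow> bool" where
  "odd_with_lead_t s \<longleftrightarrow> s oo (- fps_X) = - s \<and> fps_nth s 0 = 0 \<and> fps_nth s 1 = 1"

definition is_universal_sigma :: "('p :: prime_card_gt3) univ_Rhat fps \<Rightarrow> bool" where
  "is_universal_sigma s \<longleftrightarrow> odd_with_lead_t s \<and>
     (let D = weier_D (R_to_Rhat A4) (R_to_Rhat A6); S = fps_to_fls s in
      \<exists>c. D (D S * fls_inv1 S) + weier_x (R_to_Rhat A4) (R_to_Rhat A6) = fls_const c)"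


section \<open>The group law on a Weierstrass curve over a field\<close>

datatype 'k ec_point = Origin | Affine 'k 'k

fun on_curve :: "'k :: field \<Rightarrow> 'k \<Rightarrow> 'k ec_point \<Rightarrow> bool" where
  "on_curve a4 a6 Origin \<longleftrightarrow> True"
| "on_curve a4 a6 (Affine x y) \<longleftrightarrow> y ^ 2 = x ^ 3 + a4 * x + a6"

fun ec_neg :: "'k :: field ec_point \<Rightarrow> 'k ec_point" where
  "ec_neg Origin = Origin"
| "ec_neg (Affine x y) = Affine x (- y)"

fun ec_add :: "'k :: field \<Rightarrow> 'k ec_point \<Rightarrow> 'k ec_point \<Rightarrow> 'k ec_point" where
  "ec_add a4 Origin Q = Q"
| "ec_add a4 P Origin = P"
| "ec_add a4 (Affine x1 y1) (Affine x2 y2) =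
    (if x1 = x2 \<and> y1 = - y2 then Origin
     else let l = (if x1 = x2 then (3 * x1 ^ 2 + a4) / (2 * y1) else (y2 - y1) / (x2 - x1));
              x3 = l ^ 2 - x1 - x2
          in Affine x3 (- y1 - l * (x3 - x1)))"

fun ec_mult :: "'k :: field \<Rightarrow> nat \<Rightarrow> 'k ec_point \<Rightarrow> 'k ec_point" where
  "ec_mult a4 0 P = Origin"
| "ec_mult a4 (Suc n) P = ec_add a4 P (ec_mult a4 n P)"

fun ec_x :: "'k :: field ec_point \<Rightarrow> 'k" where
  "ec_x (Affine x y) = x"
| "ec_x Origin = undefined"

fun ec_t :: "'k :: field ec_point \<Rightarrow> 'k" where
  "ec_t (Affine x y) = - x / y"
| "ec_t Origin = 0"


section \<open>Complete discrete valuation rings\<close>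

definition max_ideal :: "'a :: idom set" where
  "max_ideal = {x. \<not> x dvd 1}"

text \<open>\<open>v 0\<close> stands for infinity, whatever the actual value of \<open>v\<close> at 0.\<close>

definition val_ge :: "('k :: field \<Rightarrow> int) \<Rightarrow> int \<Rightarrow> 'k \<Rightarrow> bool" where
  "val_ge v k x \<longleftrightarrow> x = 0 \<or> v x \<ge> k"

definition discrete_valuation :: "('k :: field \<Rightarrow> int) \<Rightarrow> bool" where
  "discrete_valuation v \<longleftrightarrow>
     v ` {x. x \<noteq> 0} = UNIV \<and>
     (\<forall>x y. x \<noteq> 0 \<longrightarrow> y \<noteq> 0 \<longrightarrow> v (x * y) = v x + v y) \<and>
     (\<forall>x y. x \<noteq> 0 \<longrightarrow> y \<noteq> 0 \<longrightarrow> x + y \<noteq> 0 \<longrightarrow> v (x + y) \<ge> min (v x) (v y))"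

definition val_tendsto :: "('k :: field \<Rightarrow> int) \<Rightarrow> (nat \<Rightarrow> 'k) \<Rightarrow> 'k \<Rightarrow> bool" where
  "val_tendsto v s l \<longleftrightarrow> (\<forall>k. \<exists>N. \<forall>n\<ge>N. val_ge v k (s n - l))"

definition val_Cauchy :: "('k :: field \<Rightarrow> int) \<Rightarrow> (nat \<Rightarrow> 'k) \<Rightarrow> bool" where
  "val_Cauchy v s \<longleftrightarrow> (\<forall>k. \<exists>N. \<forall>m\<ge>N. \<forall>n\<ge>N. val_ge v k (s m - s n))"

definition complete_dvr :: "('a :: idom fract \<Rightarrow> int) \<Rightarrow> bool" where
  "complete_dvr v \<longleftrightarrow>
     discrete_valuation v \<and>
     range (to_fract :: 'a \<Rightarrow> 'a fract) = {x. val_ge v 0 x} \<and>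
     (\<forall>s :: nat \<Rightarrow> 'a. val_Cauchy v (\<lambda>n. to_fract (s n)) \<longrightarrow>
        (\<exists>l. val_tendsto v (\<lambda>n. to_fract (s n)) (to_fract l)))"

definition fps_eval :: "('a :: idom fract \<Rightarrow> int) \<Rightarrow> 'a fps \<Rightarrow> 'a fract \<Rightarrow> 'a fract" where
  "fps_eval v f z = (THE l. val_tendsto v (\<lambda>n. \<Sum>i<n. to_fract (fps_nth f i) * z ^ i) l)"


section \<open>Reduction of a Weierstrass curve over a discrete valuation ring\<close>

definition ec_disc :: "'a :: comm_ring_1 \<Rightarrow> 'a \<Rightarrow> 'a" where
  "ec_disc a4 a6 = - 16 * (4 * a4 ^ 3 + 27 * a6 ^ 2)"

definition ec_c4 :: "'a :: comm_ring_1 \<Rightarrow> 'a" where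
  "ec_c4 a4 = - 48 * a4"

text \<open>The points with primitive homogeneous coordinates \<open>[X : Y : Z]\<close> reducing to \<open>[0 : 1 : 0]\<close>.\<close>

definition kernel_of_reduction :: "'a :: idom \<Rightarrow> 'a \<Rightarrow> 'a fract ec_point set" where
  "kernel_of_reduction a4 a6 = insert Origin
     {Affine (Fract X Z) (Fract Y Z) | X Y Z.
        Z \<noteq> 0 \<and> X \<in> max_ideal \<and> Y \<notin> max_ideal \<and> Z \<in> max_ideal \<and>
        on_curve (to_fract a4) (to_fract a6) (Affine (Fract X Z) (Fract Y Z))}"

text \<open>The series \<open>[n](t)\<close> of the formal group: the parameter of the \<open>n\<close>-th multiple of the generic
  formal point \<open>(x(t), y(t))\<close>, which is a point with coordinates in the Laurent series field over
  the fraction field. Its coefficients lie in the base ring.\<close>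

definition formal_mult :: "nat \<Rightarrow> 'a :: idom \<Rightarrow> 'a \<Rightarrow> 'a fract fls" where
  "formal_mult n a4 a6 =
     ec_t (ec_mult (fls_const (to_fract a4)) n
       (Affine (weier_x (to_fract a4) (to_fract a6)) (weier_y (to_fract a4) (to_fract a6))))"

text \<open>The formal group of the special fibre has height one: the reduction of \<open>[p](t)\<close> starts in
  degree \<open>p\<close>.\<close>

definition reduced_height_one :: "nat \<Rightarrow> 'a :: idom \<Rightarrow> 'a \<Rightarrow> bool" where
  "reduced_height_one p a4 a6 \<longleftrightarrow>
     (\<forall>n < int p. fls_nth (formal_mult p a4 a6) n \<in> to_fract ` max_ideal) \<and>
     fls_nth (formal_mult p a4 a6) (int p) \<in> to_fract ` (- max_ideal)"

definition good_ordinary_reduction :: "nat \<Rightarrow> 'a :: idom \<Rightarrow> 'a \<Rightarrow> bool" where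
  "good_ordinary_reduction p a4 a6 \<longleftrightarrow>
     ec_disc a4 a6 \<notin> max_ideal \<and> reduced_height_one p a4 a6"

text \<open>The special fibre is a nodal cubic.\<close>

definition multiplicative_reduction :: "'a :: idom \<Rightarrow> 'a \<Rightarrow> bool" where
  "multiplicative_reduction a4 a6 \<longleftrightarrow>
     ec_disc a4 a6 \<in> max_ideal \<and> ec_c4 a4 \<notin> max_ideal"

definition ordinary_reduction :: "nat \<Rightarrow> 'a :: idom \<Rightarrow> 'a \<Rightarrow> bool" where
  "ordinary_reduction p a4 a6 \<longleftrightarrow>
     good_ordinary_reduction p a4 a6 \<or> multiplicative_reduction a4 a6"


section \<open>The Mazur--Tate sigma function\<close>

definition is_mazur_tate_sigma ::
  "('a :: idom fract \<Rightarrow> int) \<Rightarrow> 'a \<Rightarrow> 'a \<Rightarrow> 'a fps \<Rightarrow> bool" where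
  "is_mazur_tate_sigma v a4 a6 s \<longleftrightarrow> odd_with_lead_t s \<and>
     (let S = (\<lambda>P. fps_eval v s (ec_t P)); add = ec_add (to_fract a4) in
      \<forall>P \<in> kernel_of_reduction a4 a6. \<forall>Q \<in> kernel_of_reduction a4 a6.
        P \<noteq> Origin \<longrightarrow> Q \<noteq> Origin \<longrightarrow> P \<noteq> Q \<longrightarrow> P \<noteq> ec_neg Q \<longrightarrow>
        S (add P Q) * S (add P (ec_neg Q)) / (S P ^ 2 * S Q ^ 2) = ec_x Q - ec_x P)"

definition mazur_tate_sigma :: "('a :: idom fract \<Rightarrow> int) \<Rightarrow> 'a \<Rightarrow> 'a \<Rightarrow> 'a fps" where
  "mazur_tate_sigma v a4 a6 = (THE s. is_mazur_tate_sigma v a4 a6 s)"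

definition fps_map_coeffs :: "('a \<Rightarrow> 'b) \<Rightarrow> 'a fps \<Rightarrow> 'b fps" where
  "fps_map_coeffs f s = Abs_fps (\<lambda>n. f (fps_nth s n))"

end

theory Submission
  imports Defs
begin

text \<open>
  Write \<open>x = t/w\<close>, \<open>y = -1/w\<close>. Chord and tangent addition in the \<open>(t, w)\<close>-plane is given by explicit formulas
  with unit denominators, so it makes sense for formal series, for points in the kernel of reduction, and is
  preserved by ring homomorphisms. Over a field of characteristic 0 the differential equation for \<open>\<sigma>\<close> and the
  invariance of \<open>\<omega>\<close> give the addition law \<open>\<zeta>(u + v) = \<zeta>(u) + \<zeta>(v) + (y\<^sub>1 - y\<^sub>2)/(x\<^sub>1 - x\<^sub>2)\<close> for \<open>\<zeta> = D\<sigma>/\<sigma>\<close>, hence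
  \<open>\<sigma>(u + v) \<sigma>(u - v) = \<sigma>(u)\<^sup>2 \<sigma>(v)\<^sup>2 (x(v) - x(u))\<close>. As \<open>A\<close> may have characteristic \<open>p\<close>, this is done over the domain
  \<open>Rhat[\<alpha>, \<beta>]\<close> for \<open>u = \<alpha>t\<close>, \<open>v = \<beta>t\<close> and then specialised: every pair of points in the kernel of reduction is
  obtained from some \<open>\<alpha>, \<beta> \<in> A\<close> by setting \<open>t\<close> to a uniformizer.

  For uniqueness, the quotient \<open>f\<close> of two solutions satisfies \<open>f(u + v) f(u - v) = f(u)\<^sup>2 f(v)\<^sup>2\<close>, hence
  \<open>f([p]t) = f(t)\<^bsup>p\<^sup>2\<^esup>\<close>; since \<open>[p](t)\<close> reduces to a series of order exactly \<open>p\<close>, this forces \<open>f = 1\<close>. The coefficient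
  of \<open>t\<^sup>p\<close> in \<open>[p](t)\<close> is congruent to the Hasse invariant modulo \<open>p\<close>, which also shows that the latter is a unit.
\<close>

section \<open>The curve in the (t, w)-plane\<close>

text \<open>Two-variable power series never occur. The substitutions \<open>u = \<alpha> t\<close>,
  \<open>v = \<beta> t\<close> keep everything in one variable, where in characteristic 0 a
  derivative determines a Laurent series up to a constant; the price is two more indeterminates in
  the coefficients. Both constants of integration then have to be found: in the addition law for
  \<open>\<zeta>\<close> it is 0 because every term is odd in \<open>t\<close>, and in the sigma
  identity it is 1 by comparing coefficients of \<open>t^8\<close>. Passing to fraction fields
  requires the completion to be a domain of characteristic 0. This rests on \<open>p\<close>
  remaining prime after \<open>H\<close> is inverted, hence on no power of \<open>H\<close> being
  divisible by \<open>p\<close>. Facts about \<open>[n](t)\<close>, such as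
  \<open>[n] + [m] = [n + m]\<close> and the congruences for \<open>[p]\<close>, are proved over
  \<open>Z[A4, A6]\<close>, where \<open>\<omega>\<close> can be integrated and \<open>p\<close>
  cancelled, and are then specialised to \<open>A\<close>, in which \<open>p\<close> may be 0. For
  nodal reduction the Hasse invariant is found from the explicit cubic
  \<open>(x - e)^2 (x + 2 e)\<close>.\<close>

lemma fps_map_coeffs_nth [simp]: "fps_nth (fps_map_coeffs h f) n = h (fps_nth f n)"
  by (simp add: fps_map_coeffs_def)

lemma comm_ring_hom_fps_map_coeffs:
  assumes "comm_ring_hom h" shows "comm_ring_hom (fps_map_coeffs h)"
proof -
  interpret comm_ring_hom h by fact
  show ?thesis
    by unfold_locales (auto simp: fps_eq_iff hom_add fps_mult_nth hom_sum hom_mult)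
qed

lemma fps_map_coeffs_X [simp]:
  assumes "comm_ring_hom h" shows "fps_map_coeffs h fps_X = fps_X"
proof -
  interpret comm_ring_hom h by fact
  show ?thesis by (auto simp: fps_eq_iff fps_X_def)
qed

lemma fps_map_coeffs_const [simp]:
  assumes "comm_ring_hom h" shows "fps_map_coeffs h (fps_const c) = fps_const (h c)"
proof -
  interpret comm_ring_hom h by fact
  show ?thesis by (auto simp: fps_eq_iff)
qed

lemma fps_map_coeffs_deriv:
  assumes "comm_ring_hom h" shows "fps_map_coeffs h (fps_deriv f) = fps_deriv (fps_map_coeffs h f)"
proof -
  interpret comm_ring_hom h by fact
  show ?thesis by (auto simp: fps_eq_iff hom_mult hom_add hom_of_nat)
qed

lemma fps_map_coeffs_compose:
  assumes "comm_ring_hom h"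
  shows "fps_map_coeffs h (f oo g) = fps_map_coeffs h f oo fps_map_coeffs h g"
proof -
  interpret comm_ring_hom h by fact
  interpret F: comm_ring_hom "fps_map_coeffs h" by (rule comm_ring_hom_fps_map_coeffs) fact
  have "h (fps_nth (g ^ i) n) = fps_nth (fps_map_coeffs h g ^ i) n" for i n
    by (simp flip: F.hom_power)
  thus ?thesis by (auto simp: fps_eq_iff fps_compose_nth hom_sum hom_mult)
qed

lemma comm_ring_hom_fps_compose:
  assumes "fps_nth (u :: 'a :: idom fps) 0 = 0" shows "comm_ring_hom (\<lambda>f. f oo u)"
  using assms by unfold_locales (auto simp: fps_compose_add_distrib fps_compose_mult_distrib)

lemma comm_ring_hom_to_fract: "comm_ring_hom (to_fract :: 'a :: idom \<Rightarrow> 'a fract)"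
  by unfold_locales auto

lemma fps_X_power_dvd_iff:
  "(fps_X :: 'a :: comm_ring_1 fps) ^ n dvd f \<longleftrightarrow> (\<forall>i<n. fps_nth f i = 0)"
proof
  assume "fps_X ^ n dvd f" thus "\<forall>i<n. fps_nth f i = 0"
    by (auto elim!: dvdE simp: fps_X_power_mult_nth)
next
  assume "\<forall>i<n. fps_nth f i = 0"
  hence "f = fps_X ^ n * fps_shift n f"
    by (auto simp: fps_eq_iff fps_X_power_mult_nth)
  thus "fps_X ^ n dvd f" by (metis dvd_triv_left)
qed

lemma fps_X_dvd_iff: "(fps_X :: 'a :: comm_ring_1 fps) dvd f \<longleftrightarrow> fps_nth f 0 = 0"
  using fps_X_power_dvd_iff[of 1 f] by simp

lemma fps_unit_inverse_exists:
  assumes "fps_nth (f :: 'a :: comm_ring_1 fps) 0 = 1"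
  obtains g where "f * g = 1" "fps_nth g 0 = 1"
proof
  show "f * fps_right_inverse f 1 = 1" using assms by (intro fps_right_inverse) simp
  show "fps_nth (fps_right_inverse f 1) 0 = 1" by simp
qed

definition weier_eqn :: "'a :: comm_ring_1 \<Rightarrow> 'a \<Rightarrow> 'a \<Rightarrow> 'a \<Rightarrow> bool" where
  "weier_eqn a4 a6 t w \<longleftrightarrow> w = t ^ 3 + a4 * t * w ^ 2 + a6 * w ^ 3"

lemma weier_eqn_hom:
  assumes "comm_ring_hom h" "weier_eqn a4 a6 t w"
  shows "weier_eqn (h a4) (h a6) (h t) (h w)"
proof -
  interpret comm_ring_hom h by fact
  show ?thesis using arg_cong[OF assms(2)[unfolded weier_eqn_def], of h]
    by (simp add: weier_eqn_def hom_add hom_mult hom_power)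
qed

text \<open>Subtract the two equations and factor. The cofactor of \<open>w - w'\<close> is 1 plus
  terms that are small in every application, so it can be cancelled: for \<open>t = t'\<close> this
  gives uniqueness of \<open>w\<close>, in general the slope of a chord without division by
  \<open>t - t'\<close>.\<close>

lemma weier_eqn_diff:
  fixes a4 a6 :: "'a :: idom"
  assumes "weier_eqn a4 a6 t w" "weier_eqn a4 a6 t' w'"
  shows "(w - w') * (1 - a4 * t' * (w + w') - a6 * (w ^ 2 + w * w' + w' ^ 2))
       = (t - t') * (t ^ 2 + t * t' + t' ^ 2 + a4 * w ^ 2)"
proof -
  have "(w - w') * (1 - a4 * t' * (w + w') - a6 * (w ^ 2 + w * w' + w' ^ 2))
      - (t - t') * (t ^ 2 + t * t' + t' ^ 2 + a4 * w ^ 2)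
      = (w - (t ^ 3 + a4 * t * w ^ 2 + a6 * w ^ 3)) - (w' - (t' ^ 3 + a4 * t' * w' ^ 2 + a6 * w' ^ 3))"
    by Groebner_Basis.algebra
  also have "\<dots> = 0" using assms by (simp add: weier_eqn_def)
  finally show ?thesis by simp
qed

lemma weier_eqn_uminus: "weier_eqn a4 a6 (- t) (- w) \<longleftrightarrow> weier_eqn a4 a6 t w"
proof -
  have "- (w :: 'a) = (- t) ^ 3 + a4 * (- t) * (- w) ^ 2 + a6 * (- w) ^ 3 \<longleftrightarrow>
    - w = - (t ^ 3 + a4 * t * w ^ 2 + a6 * w ^ 3)" by (simp add: power3_eq_cube)
  thus ?thesis unfolding weier_eqn_def by (simp only: neg_equal_iff_equal)
qed

abbreviation fps_weier_eqn :: "'a :: comm_ring_1 \<Rightarrow> 'a \<Rightarrow> 'a fps \<Rightarrow> 'a fps \<Rightarrow> bool" where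
  "fps_weier_eqn a4 a6 \<equiv> weier_eqn (fps_const a4) (fps_const a6)"

lemma fps_weier_eqn_unique:
  fixes t :: "'a :: idom fps"
  assumes "fps_weier_eqn a4 a6 t w" "fps_weier_eqn a4 a6 t w'"
    and "fps_nth w 0 = 0" "fps_nth w' 0 = 0"
  shows "w = w'"
proof -
  let ?u = "1 - fps_const a4 * t * (w + w') - fps_const a6 * (w ^ 2 + w * w' + w' ^ 2)"
  have "(w - w') * ?u = 0" using weier_eqn_diff[OF assms(1,2)] by simp
  moreover have "fps_nth ?u 0 = 1" using assms(3,4) by (simp add: power2_eq_square)
  hence "?u \<noteq> 0" by (metis fps_zero_nth zero_neq_one)
  ultimately show ?thesis by simp
qed

text \<open>On series without constant term the right-hand side of the equation is an
  \<open>fps_X\<close>-adic contraction: agreement to order \<open>k\<close> becomes agreement to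
  order \<open>k + 1\<close>. Iteration from 0 therefore converges over any commutative
  ring.\<close>

lemma fps_weier_eqn_exists:
  "\<exists>w :: 'a :: comm_ring_1 fps. fps_nth w 0 = 0 \<and> fps_weier_eqn a4 a6 fps_X w"
proof -
  define \<Phi> :: "'a fps \<Rightarrow> 'a fps" where
    "\<Phi> w = fps_X ^ 3 + fps_const a4 * fps_X * w ^ 2 + fps_const a6 * w ^ 3" for w
  define W where "W k = (\<Phi> ^^ k) 0" for k
  have W0: "fps_nth (W k) 0 = 0" for k
    by (induction k) (auto simp: W_def \<Phi>_def power3_eq_cube)
  have step: "fps_X ^ Suc k dvd \<Phi> f - \<Phi> g"
    if "fps_X ^ k dvd f - g" "fps_nth f 0 = 0" "fps_nth g 0 = 0" for k f g
  proof -
    have "fps_X dvd fps_const a4 * fps_X * (f + g) + fps_const a6 * (f ^ 2 + f * g + g ^ 2)"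
      unfolding fps_X_dvd_iff using that by (simp add: power2_eq_square)
    from mult_dvd_mono[OF that(1) this] show ?thesis
      by (simp add: \<Phi>_def algebra_simps power2_eq_square power3_eq_cube)
  qed
  have WW: "fps_X ^ Suc k dvd W (Suc k) - W k" for k
  proof (induction k)
    case 0 show ?case by (simp add: fps_X_dvd_iff W0)
  next
    case (Suc k) thus ?case using step[OF Suc W0 W0] by (simp add: W_def)
  qed
  have stab: "fps_nth (W (n + j)) n = fps_nth (W n) n" for n j
  proof (induction j)
    case (Suc j)
    have "fps_nth (W (Suc (n + j)) - W (n + j)) n = 0"
      using WW[of "n + j"] unfolding fps_X_power_dvd_iff by auto
    thus ?case using Suc by simp
  qed simp
  \<comment> \<open>Coefficient \<open>n\<close> is constant from iterate \<open>n\<close> on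
    (\<open>stab\<close>), so the limit is read off the diagonal.\<close>
  define w where "w = Abs_fps (\<lambda>n. fps_nth (W n) n)"
  have wW: "fps_X ^ Suc k dvd w - W k" for k
    unfolding fps_X_power_dvd_iff using stab by (auto simp: w_def less_Suc_eq_le le_iff_add)
  have w0: "fps_nth w 0 = 0" by (simp add: w_def W0)
  have "fps_X ^ Suc k dvd w - \<Phi> w" for k
  proof -
    have "fps_X ^ Suc k dvd w - W (Suc k)" using wW[of "Suc k"] power_le_dvd by fastforce
    moreover have "fps_X ^ Suc k dvd W (Suc k) - \<Phi> w"
      using power_le_dvd[OF step[OF wW[of k] w0 W0], of "Suc k"]
      by (simp add: W_def) (metis dvd_minus_iff minus_diff_eq)
    ultimately show ?thesis using dvd_add by fastforce
  qed
  hence "fps_nth (w - \<Phi> w) k = 0" for k unfolding fps_X_power_dvd_iff by blast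
  hence "w = \<Phi> w" by (simp add: fps_eq_iff)
  thus ?thesis using w0 unfolding \<Phi>_def weier_eqn_def by blast
qed

context
  fixes a4 a6 :: "'a :: idom"
begin

lemma weier_w_unique:
  assumes "fps_nth w 0 = 0" "fps_weier_eqn a4 a6 fps_X w"
  shows "weier_w a4 a6 = w"
  unfolding weier_w_def
  by (rule the_equality) (use assms fps_weier_eqn_unique[of a4 a6 fps_X] in \<open>auto simp: weier_eqn_def\<close>)

lemma weier_w_nth_0 [simp]: "fps_nth (weier_w a4 a6) 0 = 0"
  and weier_w_eqn: "fps_weier_eqn a4 a6 fps_X (weier_w a4 a6)"
  using fps_weier_eqn_exists[of a4 a6] weier_w_unique by blast+

lemma weier_w_compose_eqn:
  assumes "fps_nth u 0 = 0"
  shows "fps_weier_eqn a4 a6 u (weier_w a4 a6 oo u)"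
  using weier_eqn_hom[OF comm_ring_hom_fps_compose weier_w_eqn, OF assms] assms by simp

text \<open>Serves to identify the \<open>w\<close>-coordinate of a point that was constructed
  differently, such as a negative or a sum.\<close>

lemma weier_w_compose_unique:
  assumes "fps_nth u 0 = 0" "fps_nth w 0 = 0" "fps_weier_eqn a4 a6 u w"
  shows "w = weier_w a4 a6 oo u"
  using fps_weier_eqn_unique[OF assms(3) weier_w_compose_eqn[OF assms(1)]] assms by simp

lemma weier_w_compose_uminus:
  assumes "fps_nth u 0 = 0"
  shows "weier_w a4 a6 oo (- u) = - (weier_w a4 a6 oo u)"
  using weier_w_compose_unique[of "-u" "- (weier_w a4 a6 oo u)"] weier_w_compose_eqn[OF assms] assms
  by (simp add: weier_eqn_uminus)

lemma weier_w_factor: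
  obtains V where "weier_w a4 a6 = fps_X ^ 3 * V" "fps_nth V 0 = 1"
proof -
  let ?w = "weier_w a4 a6"
  have eq: "?w = fps_X ^ 3 + fps_const a4 * fps_X * ?w ^ 2 + fps_const a6 * ?w ^ 3"
    using weier_w_eqn by (simp add: weier_eqn_def)
  have "fps_X dvd ?w" by (simp add: fps_X_dvd_iff)
  then obtain q where q: "?w = fps_X * q" by (elim dvdE)
  have "?w = fps_X ^ 3 * (1 + fps_const a4 * q ^ 2 + fps_const a6 * q ^ 3)"
    by (subst eq) (simp add: q algebra_simps power2_eq_square power3_eq_cube)
  \<comment> \<open>\<open>w\<close> is divisible by \<open>fps_X ^ 3\<close>, so its linear
    coefficient, which is the constant term of \<open>q\<close>, vanishes; hence the cofactor has
    constant term 1.\<close>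
  moreover have "fps_nth q 0 = 0"
  proof -
    have "fps_nth ?w 1 = fps_nth (fps_X ^ 3 * (1 + fps_const a4 * q ^ 2 + fps_const a6 * q ^ 3)) 1"
      using calculation by simp
    thus ?thesis unfolding fps_X_power_mult_nth q by simp
  qed
  ultimately show ?thesis by (intro that) (auto simp: power2_eq_square power3_eq_cube)
qed

lemma weier_w_compose_nonzero:
  assumes "fps_nth u 0 = 0" "u \<noteq> 0"
  shows "weier_w a4 a6 oo u \<noteq> 0"
proof
  assume "weier_w a4 a6 oo u = 0"
  hence "u ^ 3 = 0" using weier_w_compose_eqn[OF assms(1)] by (simp add: weier_eqn_def)
  thus False using assms by simp
qed

end

lemma fps_map_coeffs_weier_w:
  fixes h :: "'a :: idom \<Rightarrow> 'b :: idom"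
  assumes "comm_ring_hom h"
  shows "fps_map_coeffs h (weier_w a4 a6) = weier_w (h a4) (h a6)"
proof -
  interpret comm_ring_hom h by fact
  show ?thesis
    using weier_eqn_hom[OF comm_ring_hom_fps_map_coeffs[OF assms] weier_w_eqn[of a4 a6]] assms
    by (intro weier_w_unique[symmetric]) auto
qed

text \<open>The line \<open>w = l * t + n\<close> through two points of the curve. The factor \<open>t1 - t2\<close> is cancelled in the formula
  for the slope \<open>l\<close>, so that for equal points the line is the tangent; \<open>t\<close> is the parameter of the sum.\<close>

definition add_rel :: "'a :: comm_ring_1 \<Rightarrow> 'a \<Rightarrow> 'a \<Rightarrow> 'a \<Rightarrow> 'a \<Rightarrow> 'a \<Rightarrow> 'a \<Rightarrow> 'a \<Rightarrow> bool" where
  "add_rel a4 a6 t1 w1 t2 w2 l t \<longleftrightarrow>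
     l * (1 - a4 * t2 * (w1 + w2) - a6 * (w1 ^ 2 + w1 * w2 + w2 ^ 2))
       = t1 ^ 2 + t1 * t2 + t2 ^ 2 + a4 * w1 ^ 2 \<and>
     t * (1 + a4 * l ^ 2 + a6 * l ^ 3)
       = (t1 + t2) * (1 + a4 * l ^ 2 + a6 * l ^ 3) + (w1 - l * t1) * (2 * a4 * l + 3 * a6 * l ^ 2)"

lemma add_rel_hom:
  assumes "comm_ring_hom h" "add_rel a4 a6 t1 w1 t2 w2 l t"
  shows "add_rel (h a4) (h a6) (h t1) (h w1) (h t2) (h w2) (h l) (h t)"
proof -
  interpret comm_ring_hom h by fact
  have "h 2 = 2" "h 3 = 3" using hom_of_nat[of 2] hom_of_nat[of 3] by simp_all
  thus ?thesis
    using assms(2)[unfolded add_rel_def, THEN conjunct1, THEN arg_cong[of _ _ h]]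
      assms(2)[unfolded add_rel_def, THEN conjunct2, THEN arg_cong[of _ _ h]]
    unfolding add_rel_def by (simp add: hom_add hom_mult hom_power hom_minus)
qed

lemma add_rel_uminus:
  assumes "add_rel a4 a6 t1 w1 t2 w2 l t"
  shows "add_rel a4 a6 (- t1) (- w1) (- t2) (- w2) l (- t)"
proof -
  have "- t * (1 + a4 * l ^ 2 + a6 * l ^ 3) = - (t * (1 + a4 * l ^ 2 + a6 * l ^ 3))" by simp
  also have "\<dots> = - ((t1 + t2) * (1 + a4 * l ^ 2 + a6 * l ^ 3) +
      (w1 - l * t1) * (2 * a4 * l + 3 * a6 * l ^ 2))"
    using assms unfolding add_rel_def by simp
  finally show ?thesis using assms unfolding add_rel_def
    by (simp add: algebra_simps)
qed

text \<open>The first equation of \<open>add_rel\<close> is \<open>weier_eqn_diff\<close> with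
  \<open>l\<close> in place of the difference quotient; only the denominator has to be
  cancelled.\<close>

lemma add_rel_line:
  fixes a4 a6 :: "'a :: idom"
  assumes "weier_eqn a4 a6 t1 w1" "weier_eqn a4 a6 t2 w2" "add_rel a4 a6 t1 w1 t2 w2 l t"
    and "1 - a4 * t2 * (w1 + w2) - a6 * (w1 ^ 2 + w1 * w2 + w2 ^ 2) \<noteq> 0"
  shows "w1 - w2 = l * (t1 - t2)"
proof -
  have "(w1 - w2) * (1 - a4 * t2 * (w1 + w2) - a6 * (w1 ^ 2 + w1 * w2 + w2 ^ 2))
      = (l * (t1 - t2)) * (1 - a4 * t2 * (w1 + w2) - a6 * (w1 ^ 2 + w1 * w2 + w2 ^ 2))"
    unfolding weier_eqn_diff[OF assms(1,2)] using assms(3) unfolding add_rel_def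
    by (simp add: mult_ac)
  thus ?thesis using assms(4) by simp
qed

text \<open>Vieta's formulas for the cubic obtained by substituting the line \<open>w = l * t + n\<close>, whose roots
  are \<open>t1\<close>, \<open>t2\<close> and \<open>- t\<close>.\<close>

lemma add_rel_vieta:
  fixes a4 a6 :: "'a :: idom"
  assumes "weier_eqn a4 a6 t1 w1" "add_rel a4 a6 t1 w1 t2 w2 l t" "w1 - w2 = l * (t1 - t2)"
  defines "n \<equiv> w1 - l * t1" and "M \<equiv> 1 + a4 * l ^ 2 + a6 * l ^ 3"
  shows "M * (t1 + t2 - t) = - n * (2 * a4 * l + 3 * a6 * l ^ 2)"
    and "M * (t1 * t2 - (t1 + t2) * t) = a4 * n ^ 2 + 3 * a6 * l * n ^ 2 - l"
    and "M * (- (t1 * t2 * t)) = n - a6 * n ^ 3"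
    and "w1 = l * t1 + n" "w2 = l * t2 + n"
proof -
  show w1: "w1 = l * t1 + n" by (simp add: n_def)
  show w2: "w2 = l * t2 + n" using assms(3) unfolding n_def by (simp add: algebra_simps)
  show e1: "M * (t1 + t2 - t) = - n * (2 * a4 * l + 3 * a6 * l ^ 2)"
    using assms(2) unfolding add_rel_def n_def M_def by Groebner_Basis.algebra
  have d: "l * (1 - a4 * t2 * (w1 + w2) - a6 * (w1 ^ 2 + w1 * w2 + w2 ^ 2))
       = t1 ^ 2 + t1 * t2 + t2 ^ 2 + a4 * w1 ^ 2" using assms(2) unfolding add_rel_def by blast
  show e2: "M * (t1 * t2 - (t1 + t2) * t) = a4 * n ^ 2 + 3 * a6 * l * n ^ 2 - l"
    using d e1 unfolding w1 w2 M_def by Groebner_Basis.algebra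
  have c: "w1 = t1 ^ 3 + a4 * t1 * w1 ^ 2 + a6 * w1 ^ 3" using assms(1) unfolding weier_eqn_def .
  show "M * (- (t1 * t2 * t)) = n - a6 * n ^ 3"
    using c e1 e2 unfolding w1 M_def by Groebner_Basis.algebra
qed

text \<open>The line meets the curve a third time at parameter \<open>- t\<close>, and negation
  turns that point into \<open>(t, l * t - n)\<close>. The defect in the curve equation is a
  combination of Vieta's three relations with coefficients \<open>t ^ 2\<close>, \<open>t\<close>
  and 1.\<close>

lemma add_rel_weier_eqn:
  fixes a4 a6 :: "'a :: idom"
  assumes "weier_eqn a4 a6 t1 w1" "add_rel a4 a6 t1 w1 t2 w2 l t" "w1 - w2 = l * (t1 - t2)"
  shows "weier_eqn a4 a6 t (l * t - (w1 - l * t1))"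
proof -
  define n where "n = w1 - l * t1"
  note vieta = add_rel_vieta[OF assms, folded n_def]
  define M where "M = 1 + a4 * l ^ 2 + a6 * l ^ 3"
  have "t ^ 3 + a4 * t * (l * t - n) ^ 2 + a6 * (l * t - n) ^ 3 - (l * t - n)
      = t ^ 2 * (- n * (2 * a4 * l + 3 * a6 * l ^ 2) - M * (t1 + t2 - t))
      + t * ((a4 * n ^ 2 + 3 * a6 * l * n ^ 2 - l) - M * (t1 * t2 - (t1 + t2) * t))
      + ((n - a6 * n ^ 3) - M * (- (t1 * t2 * t)))"
    unfolding M_def by Groebner_Basis.algebra
  also have "\<dots> = 0" using vieta(1,2,3) unfolding M_def by simp
  finally have "l * t - n = t ^ 3 + a4 * t * (l * t - n) ^ 2 + a6 * (l * t - n) ^ 3" by simp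
  thus ?thesis by (simp add: weier_eqn_def n_def)
qed

section \<open>Addition of points and derivations\<close>

text \<open>Dividing \<open>w = l * t + n\<close> by \<open>n * w\<close> gives
  \<open>y = (l / n) * x - 1 / n\<close>: the change from \<open>(t, w)\<close> to
  \<open>(x, y)\<close> maps lines to lines, so the cancelled formulas compute the classical sum.
  Hypothesis \<open>gen\<close> excludes opposite points, whose line passes through the origin and
  has \<open>n = 0\<close>.\<close>

lemma ec_add_of_add_rel:
  fixes a4 a6 :: "'k :: field"
  assumes e1: "weier_eqn a4 a6 t1 w1" and e2: "weier_eqn a4 a6 t2 w2"
    and ar: "add_rel a4 a6 t1 w1 t2 w2 l t"
    and D: "1 - a4 * t2 * (w1 + w2) - a6 * (w1 ^ 2 + w1 * w2 + w2 ^ 2) \<noteq> 0"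
    and M: "1 + a4 * l ^ 2 + a6 * l ^ 3 \<noteq> 0"
    and w: "w1 \<noteq> 0" "w2 \<noteq> 0"
    and gen: "t1 * w2 \<noteq> t2 * w1 \<or> t1 = t2 \<and> w1 = w2 \<and> (2 :: 'k) \<noteq> 0"
  defines "w3 \<equiv> l * t - (w1 - l * t1)"
  shows "w3 \<noteq> 0"
    and "ec_add a4 (Affine (t1 / w1) (- 1 / w1)) (Affine (t2 / w2) (- 1 / w2))
       = Affine (t / w3) (- 1 / w3)"
proof -
  define n where "n = w1 - l * t1"
  define M where "M = 1 + a4 * l ^ 2 + a6 * l ^ 3"
  note line = add_rel_line[OF e1 e2 ar D]
  note v = add_rel_vieta[OF e1 ar line, folded n_def M_def]
  have M0: "M \<noteq> 0" using M by (simp add: M_def)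
  have w3: "w3 = l * t - n" by (simp add: w3_def n_def)
  \<comment> \<open>Intercept and slope of the tangent at a double point, over a common denominator;
    the intercept formula also yields \<open>n \<noteq> 0\<close> there.\<close>
  have tang: "n * (1 - 2 * a4 * t1 * w1 - 3 * a6 * w1 ^ 2) = - 2 * w1"
    "l * (1 - 2 * a4 * t1 * w1 - 3 * a6 * w1 ^ 2) = 3 * t1 ^ 2 + a4 * w1 ^ 2"
    if "t1 = t2" "w1 = w2"
  proof -
    show l: "l * (1 - 2 * a4 * t1 * w1 - 3 * a6 * w1 ^ 2) = 3 * t1 ^ 2 + a4 * w1 ^ 2"
      using ar that unfolding add_rel_def by (simp add: algebra_simps power2_eq_square)
    have "n * (1 - 2 * a4 * t1 * w1 - 3 * a6 * w1 ^ 2) + 2 * w1 =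
       t1 * ((3 * t1 ^ 2 + a4 * w1 ^ 2) - l * (1 - 2 * a4 * t1 * w1 - 3 * a6 * w1 ^ 2))
       + 3 * (w1 - (t1 ^ 3 + a4 * t1 * w1 ^ 2 + a6 * w1 ^ 3))"
      unfolding n_def by Groebner_Basis.algebra
    also have "\<dots> = 0" using l e1 by (simp add: weier_eqn_def)
    finally show "n * (1 - 2 * a4 * t1 * w1 - 3 * a6 * w1 ^ 2) = - 2 * w1"
      by (simp add: eq_neg_iff_add_eq_0)
  qed
  have n0: "n \<noteq> 0"
  proof
    assume "n = 0"
    show False
    proof (cases "t1 * w2 = t2 * w1")
      case True
      hence "t1 = t2" "w1 = w2" "(2 :: 'k) \<noteq> 0" using gen by auto
      thus False using tang(1) \<open>n = 0\<close> w by simp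
    next
      case False
      have "t1 * w2 - t2 * w1 = n * (t1 - t2)" using v(4,5) by Groebner_Basis.algebra
      thus False using False \<open>n = 0\<close> by simp
    qed
  qed
  show w30: "w3 \<noteq> 0"
  proof
    assume "w3 = 0"
    hence "weier_eqn a4 a6 t 0" using add_rel_weier_eqn[OF e1 ar line] by (simp add: w3_def)
    hence "t = 0" by (simp add: weier_eqn_def)
    thus False using w3 \<open>w3 = 0\<close> n0 by simp
  qed
  define L where "L = l / n"
  have yL: "- 1 / a = L * (b / a) - 1 / n" if "a = l * b + n" "a \<noteq> 0" for a b
  proof -
    have "L * (b / a) - 1 / n = (l * b - a) / (n * a)"
      using n0 that(2) by (simp add: L_def divide_simps mult_ac)
    also have "l * b - a = - n" using that(1) by simp
    finally show ?thesis using n0 by simp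
  qed
  have y: "- 1 / w1 = L * (t1 / w1) - 1 / n" "- 1 / w2 = L * (t2 / w2) - 1 / n"
    using yL v(4,5) w by blast+
  \<comment> \<open>Symmetric functions of the three intersection points; their quotient says that
    the three \<open>x\<close>-coordinates sum to \<open>L ^ 2\<close>.\<close>
  have p3: "M * (w1 * w2 * w3) = - (n ^ 3)"
    using v(1-3) unfolding v(4,5) w3 M_def by Groebner_Basis.algebra
  have s3: "M * (t1 * w2 * w3 + t2 * w1 * w3 + t * w1 * w2) = - (l ^ 2 * n)"
    using v(1-3) unfolding v(4,5) w3 M_def by Groebner_Basis.algebra
  have "M * (n ^ 2 * (t1 * w2 * w3 + t2 * w1 * w3 + t * w1 * w2)) = M * (l ^ 2 * (w1 * w2 * w3))"
    using p3 s3 by Groebner_Basis.algebra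
  hence "n ^ 2 * (t1 * w2 * w3 + t2 * w1 * w3 + t * w1 * w2) = l ^ 2 * (w1 * w2 * w3)"
    using M0 by simp
  hence x3: "L ^ 2 - t1 / w1 - t2 / w2 = t / w3"
    using n0 w w30 unfolding L_def by (simp add: field_simps)
  have y3: "- (- 1 / w1) - L * (t / w3 - t1 / w1) = - 1 / w3"
  proof -
    have "- w3 = l * - t + n" by (simp add: w3)
    from yL[OF this] w30 have "1 / w3 = L * (t / w3) - 1 / n" by simp
    thus ?thesis unfolding y(1) by (simp add: algebra_simps)
  qed
  show "ec_add a4 (Affine (t1 / w1) (- 1 / w1)) (Affine (t2 / w2) (- 1 / w2))
       = Affine (t / w3) (- 1 / w3)"
  proof (cases "t1 * w2 = t2 * w1")
    case True
    hence eq: "t1 = t2" "w1 = w2" "(2 :: 'k) \<noteq> 0" using gen by auto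
    have J0: "1 - 2 * a4 * t1 * w1 - 3 * a6 * w1 ^ 2 \<noteq> 0"
      using tang(1)[OF eq(1,2)] w eq by auto
    have "l * (- 2 * w1) = n * (3 * t1 ^ 2 + a4 * w1 ^ 2)"
      using tang[OF eq(1,2)] J0 by Groebner_Basis.algebra
    hence "l / n = (3 * t1 ^ 2 + a4 * w1 ^ 2) / (- 2 * w1)"
      using eq(3) n0 w by (subst frac_eq_eq) (auto simp: mult_ac)
    moreover have "(3 * (t1 / w1) ^ 2 + a4) / (2 * (- 1 / w1)) = (3 * t1 ^ 2 + a4 * w1 ^ 2) / (- 2 * w1)"
      using eq(3) w by (simp add: field_simps power2_eq_square)
    ultimately have "(3 * (t1 / w1) ^ 2 + a4) / (2 * (- 1 / w1)) = L" by (simp only: L_def)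
    moreover have "- 1 / w1 \<noteq> - (- 1 / w1)" using eq(3) w by (simp add: field_simps)
    ultimately show ?thesis using x3 y3 eq by (simp add: Let_def)
  next
    case False
    hence x: "t1 / w1 \<noteq> t2 / w2" using w by (simp add: field_simps)
    have "(- 1 / w2 - - 1 / w1) = L * (t2 / w2 - t1 / w1)"
      unfolding y by (simp add: algebra_simps)
    hence "(- 1 / w2 - - 1 / w1) / (t2 / w2 - t1 / w1) = L" using x by simp
    thus ?thesis by (simp only: ec_add.simps x simp_thms if_False Let_def x3 y3)
  qed
qed

section \<open>Derivations and the invariant differential\<close>

locale field_derivation =
  fixes d :: "'k :: field \<Rightarrow> 'k"
  assumes d_add: "d (a + b) = d a + d b" and d_mult: "d (a * b) = a * d b + d a * b"
begin

lemma d_zero [simp]: "d 0 = 0"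
proof -
  have "d 0 + 0 = d 0 + d 0" using d_add[of 0 0] by simp
  thus ?thesis by (simp only: add_left_cancel)
qed
lemma d_one [simp]: "d 1 = 0"
proof -
  have "d 1 + 0 = d 1 + d 1" using d_mult[of 1 1] by simp
  thus ?thesis by (simp only: add_left_cancel)
qed
lemma d_uminus: "d (- a) = - d a" using d_add[of a "-a"] by (simp add: eq_neg_iff_add_eq_0 add.commute)
lemma d_diff: "d (a - b) = d a - d b" using d_add[of a "-b"] d_uminus[of b] by simp
lemma d_power2: "d (a ^ 2) = 2 * a * d a" by (simp add: power2_eq_square d_mult)
lemma d_power3: "d (a ^ 3) = 3 * a ^ 2 * d a"
  by (simp add: power3_eq_cube power2_eq_square d_mult algebra_simps)
lemma d_divide: assumes "b \<noteq> 0" shows "d (a / b) = (d a * b - a * d b) / b ^ 2"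
proof -
  have "d a = d ((a / b) * b)" using assms by simp
  also have "\<dots> = (a / b) * d b + d (a / b) * b" by (rule d_mult)
  finally show ?thesis using assms by (simp add: field_simps power2_eq_square)
qed

text \<open>This is \<open>dx / (2 y)\<close> in the coordinates \<open>t\<close>, \<open>w\<close>.
  The denominator is the derivative of \<open>w - t ^ 3 - a4 * t * w ^ 2 - a6 * w ^ 3\<close> with
  respect to \<open>w\<close>, and is 1 at the origin.\<close>

definition invariant_diff :: "'k \<Rightarrow> 'k \<Rightarrow> 'k \<Rightarrow> 'k \<Rightarrow> 'k" where
  "invariant_diff a4 a6 t w = d t / (1 - 2 * a4 * t * w - 3 * a6 * w ^ 2)"

text \<open>Implicit differentiation of the curve equation gives \<open>d w\<close>, and the
  quotient rule does the rest; these are the classical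
  \<open>\<omega> = dx / (2 y) = dy / (3 x^2 + a4)\<close>.\<close>

lemma d_weier:
  assumes "weier_eqn a4 a6 t w" "w \<noteq> 0" "1 - 2 * a4 * t * w - 3 * a6 * w ^ 2 \<noteq> 0"
    and "d a4 = 0" "d a6 = 0"
  shows "d (t / w) = 2 * (- 1 / w) * invariant_diff a4 a6 t w"
    and "d (- 1 / w) = (3 * (t / w) ^ 2 + a4) * invariant_diff a4 a6 t w"
proof -
  define J where "J = 1 - 2 * a4 * t * w - 3 * a6 * w ^ 2"
  define g where "g = invariant_diff a4 a6 t w"
  have J: "J \<noteq> 0" and g: "d t = g * J" using assms(3) by (simp_all add: J_def g_def invariant_diff_def)
  have e: "w = t ^ 3 + a4 * t * w ^ 2 + a6 * w ^ 3" using assms(1) by (simp add: weier_eqn_def)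
  have "d w = d (t ^ 3 + a4 * t * w ^ 2 + a6 * w ^ 3)" using e by simp
  also have "\<dots> = 3 * t ^ 2 * d t + (a4 * t * (2 * w * d w) + a4 * d t * w ^ 2) + a6 * (3 * w ^ 2 * d w)"
    by (simp add: d_add d_mult d_power2 d_power3 assms)
  finally have "d w * J = (3 * t ^ 2 + a4 * w ^ 2) * d t" unfolding J_def by (simp add: algebra_simps)
  hence "J * d w = J * ((3 * t ^ 2 + a4 * w ^ 2) * g)" unfolding g by (simp add: mult_ac)
  hence dw: "d w = (3 * t ^ 2 + a4 * w ^ 2) * g" using J by simp
  have "d (- 1 / w) = d w / w ^ 2" using d_divide[OF assms(2), of "-1"] by (simp add: d_uminus)
  thus "d (- 1 / w) = (3 * (t / w) ^ 2 + a4) * g"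
    unfolding dw using assms(2) by (simp add: field_simps power2_eq_square)
  have "d t * w - t * d w = g * (- 2 * w)"
  proof -
    have "d t * w - t * d w - g * (- 2 * w) = 3 * g * (w - (t ^ 3 + a4 * t * w ^ 2 + a6 * w ^ 3))"
      unfolding dw g J_def by Groebner_Basis.algebra
    also have "\<dots> = 0" using e by simp
    finally show ?thesis by (simp only: right_minus_eq)
  qed
  thus "d (t / w) = 2 * (- 1 / w) * g"
    unfolding d_divide[OF assms(2)] by (simp add: power2_eq_square)
qed

text \<open>Translation invariance of \<open>\<omega>\<close>: the differentials of the summands
  add. The derivative of the slope is recorded as well because the slope is the correction term in
  the addition law for \<open>\<zeta>\<close>.\<close>

lemma d_chord:
  assumes c1: "y1 ^ 2 = x1 ^ 3 + a4 * x1 + a6" and c2: "y2 ^ 2 = x2 ^ 3 + a4 * x2 + a6"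
    and x: "x1 \<noteq> x2"
    and d1: "d x1 = 2 * y1 * g1" "d y1 = (3 * x1 ^ 2 + a4) * g1"
    and d2: "d x2 = 2 * y2 * g2" "d y2 = (3 * x2 ^ 2 + a4) * g2"
    and L: "L = (y2 - y1) / (x2 - x1)" and x3: "x3 = L ^ 2 - x1 - x2"
    and y3: "y3 = - y1 - L * (x3 - x1)"
  shows "d L = g1 * (x1 - x3) + g2 * (x2 - x3)" "d x3 = 2 * y3 * (g1 + g2)"
proof -
  define D where "D = x1 - x2"
  have D0: "D \<noteq> 0" using x by (simp add: D_def)
  have LD: "L * D = y1 - y2" unfolding L D_def using x by (simp add: field_simps)
  \<comment> \<open>The conjugate form of the slope, from the difference of the two curve equations;
    it relates the chord to the tangent directions in \<open>k1\<close> and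
    \<open>k2\<close>.\<close>
  have "D * (L * (y1 + y2)) = y1 ^ 2 - y2 ^ 2" using LD by Groebner_Basis.algebra
  also have "\<dots> = D * (x1 ^ 2 + x1 * x2 + x2 ^ 2 + a4)"
    unfolding c1 c2 D_def by Groebner_Basis.algebra
  finally have S: "L * (y1 + y2) = x1 ^ 2 + x1 * x2 + x2 ^ 2 + a4" using D0 by simp
  have k1: "3 * x1 ^ 2 + a4 - 2 * L * y1 = D * (x1 - x3)"
    using S LD unfolding x3 D_def by Groebner_Basis.algebra
  have k2: "2 * L * y2 - (3 * x2 ^ 2 + a4) = D * (x2 - x3)"
    using S LD unfolding x3 D_def by Groebner_Basis.algebra
  have "d (L * D) = d (y1 - y2)" by (simp only: LD)
  hence "D * d L + L * (2 * y1 * g1 - 2 * y2 * g2) = (3 * x1 ^ 2 + a4) * g1 - (3 * x2 ^ 2 + a4) * g2"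
    by (simp add: d_mult d_diff D_def d1 d2 algebra_simps)
  hence "D * d L = D * (g1 * (x1 - x3) + g2 * (x2 - x3))"
    using k1 k2 by Groebner_Basis.algebra
  thus dL: "d L = g1 * (x1 - x3) + g2 * (x2 - x3)" using D0 by simp
  have "d x3 = 2 * L * d L - 2 * y1 * g1 - 2 * y2 * g2"
    unfolding x3 by (simp add: d_diff d_power2 d1 d2)
  thus "d x3 = 2 * y3 * (g1 + g2)"
    unfolding dL y3 using LD unfolding D_def by Groebner_Basis.algebra
qed

lemma d_tangent:
  assumes y: "2 * y1 \<noteq> 0"
    and d1: "d x1 = 2 * y1 * g1" "d y1 = (3 * x1 ^ 2 + a4) * g1" "d a4 = 0"
    and L: "L = (3 * x1 ^ 2 + a4) / (2 * y1)" and x3: "x3 = L ^ 2 - x1 - x1"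
    and y3: "y3 = - y1 - L * (x3 - x1)"
  shows "d x3 = 2 * y3 * (g1 + g1)"
proof -
  have LD: "L * (2 * y1) = 3 * x1 ^ 2 + a4" unfolding L using y by simp
  have two: "d 2 = 0" "d 3 = 0" using d_add[of 1 1] d_add[of 1 2] by simp_all
  have "d (L * (2 * y1)) = d (3 * x1 ^ 2 + a4)" by (simp only: LD)
  hence "2 * y1 * d L + L * (2 * ((3 * x1 ^ 2 + a4) * g1)) = 3 * (2 * x1 * (2 * y1 * g1))"
    by (simp add: d_mult d_add d_power2 two d1 algebra_simps)
  hence "2 * y1 * d L = 2 * y1 * (2 * g1 * (x1 - x3))"
    using LD unfolding x3 by Groebner_Basis.algebra
  hence dL: "d L = 2 * g1 * (x1 - x3)" using y mult_left_cancel by blast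
  have "d x3 = 2 * L * d L - 2 * y1 * g1 - 2 * y1 * g1"
    unfolding x3 by (simp only: d_diff d_power2 d1)
  thus ?thesis unfolding dL y3 by Groebner_Basis.algebra
qed

end

instance fract :: ("{idom,ring_char_0}") field_char_0
proof
  have "of_nat n = to_fract (of_nat n :: 'a)" for n by (induction n) auto
  thus "inj (of_nat :: nat \<Rightarrow> 'a fract)" by (auto intro!: injI)
qed

lemma weier_same_x:
  fixes a4 a6 :: "'a :: idom"
  assumes "weier_eqn a4 a6 t1 w1" "weier_eqn a4 a6 t2 w2" "w1 \<noteq> 0" "w2 \<noteq> 0" "t1 * w2 = t2 * w1"
  shows "t1 = t2 \<and> w1 = w2 \<or> t1 = - t2 \<and> w1 = - w2"
proof -
  have e: "w1 = t1 ^ 3 + a4 * t1 * w1 ^ 2 + a6 * w1 ^ 3" "w2 = t2 ^ 3 + a4 * t2 * w2 ^ 2 + a6 * w2 ^ 3"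
    using assms(1,2) by (simp_all add: weier_eqn_def)
  \<comment> \<open>Up to the factor \<open>w1 ^ 3 * w2 ^ 3\<close> this is
    \<open>y1 ^ 2 - y2 ^ 2\<close>, so equal \<open>x\<close> forces equal or opposite
    \<open>y\<close>.\<close>
  have "w1 * w2 ^ 3 - w2 * w1 ^ 3 =
    w2 ^ 3 * (w1 - (t1 ^ 3 + a4 * t1 * w1 ^ 2 + a6 * w1 ^ 3))
    - w1 ^ 3 * (w2 - (t2 ^ 3 + a4 * t2 * w2 ^ 2 + a6 * w2 ^ 3))
    + (t1 * w2 - t2 * w1) * ((t1 * w2) ^ 2 + (t1 * w2) * (t2 * w1) + (t2 * w1) ^ 2 + a4 * w1 ^ 2 * w2 ^ 2)"
    by Groebner_Basis.algebra
  also have "\<dots> = 0" using e assms(5) by simp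
  finally have "w1 * w2 * ((w2 - w1) * (w2 + w1)) = 0" by Groebner_Basis.algebra
  hence "w1 = w2 \<or> w1 = - w2" using assms(3,4) by (auto simp: eq_neg_iff_add_eq_0 add.commute)
  thus ?thesis
  proof
    assume "w1 = w2" thus ?thesis using assms by simp
  next
    assume "w1 = - w2"
    hence "(t1 + t2) * w2 = 0" using assms(5) by (simp add: algebra_simps)
    thus ?thesis using assms(4) \<open>w1 = - w2\<close> by (auto simp: eq_neg_iff_add_eq_0)
  qed
qed

definition weier_J :: "'a :: comm_ring_1 \<Rightarrow> 'a \<Rightarrow> 'a fps" where
  "weier_J a4 a6 = 1 - 2 * fps_const a4 * fps_X * weier_w a4 a6 - 3 * fps_const a6 * weier_w a4 a6 ^ 2"

text \<open>The series \<open>W\<close> with \<open>dx / (2 y) = W dt\<close>. A right inverse is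
  used because the coefficients need not form a field; agreement with \<open>weier_W\<close> is
  shown in \<open>weier_W_eq\<close>.\<close>

definition weier_omega :: "'a :: comm_ring_1 \<Rightarrow> 'a \<Rightarrow> 'a fps" where
  "weier_omega a4 a6 = fps_right_inverse (weier_J a4 a6) 1"

lemma weier_J_nth_0 [simp]: "fps_nth (weier_J a4 (a6 :: 'a :: idom)) 0 = 1"
  by (simp add: weier_J_def mult.assoc power2_eq_square)

lemma weier_J_omega: "weier_J a4 (a6 :: 'a :: idom) * weier_omega a4 a6 = 1"
  unfolding weier_omega_def by (rule fps_right_inverse) simp

lemma weier_omega_nth_0 [simp]: "fps_nth (weier_omega a4 a6) 0 = 1"
  by (simp add: weier_omega_def)

lemma weier_J_compose:
  fixes u :: "'a :: idom fps"
  assumes "fps_nth u 0 = 0"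
  shows "weier_J a4 a6 oo u = 1 - 2 * fps_const a4 * u * (weier_w a4 a6 oo u)
    - 3 * fps_const a6 * (weier_w a4 a6 oo u) ^ 2"
proof -
  interpret comm_ring_hom "\<lambda>f. f oo u" by (rule comm_ring_hom_fps_compose[OF assms])
  have "2 oo u = 2" "3 oo u = 3" using hom_of_nat[of 2] hom_of_nat[of 3] by simp_all
  thus ?thesis unfolding weier_J_def using assms by (simp add: hom_minus hom_mult hom_power)
qed

lemma weier_J_omega_compose:
  fixes u :: "'a :: idom fps"
  assumes "fps_nth u 0 = 0"
  shows "(weier_J a4 a6 oo u) * (weier_omega a4 a6 oo u) = 1"
  using assms by (simp add: weier_J_omega flip: fps_compose_mult_distrib)

lemma weier_J_compose_uminus:
  fixes u :: "'a :: idom fps"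
  assumes "fps_nth u 0 = 0"
  shows "weier_J a4 a6 oo (- u) = weier_J a4 a6 oo u"
  using assms by (simp add: weier_J_compose weier_w_compose_uminus)

lemma weier_omega_compose_uminus:
  fixes u :: "'a :: idom fps"
  assumes "fps_nth u 0 = 0"
  shows "weier_omega a4 a6 oo (- u) = weier_omega a4 a6 oo u"
proof -
  let ?J = "weier_J a4 a6 oo u"
  have "?J * (weier_omega a4 a6 oo (- u)) = ?J * (weier_omega a4 a6 oo u)"
    using weier_J_omega_compose[of u a4 a6] weier_J_omega_compose[of "-u" a4 a6] assms
    by (simp add: weier_J_compose_uminus)
  moreover have "?J \<noteq> 0" using weier_J_omega_compose[OF assms, of a4 a6] by auto
  ultimately show ?thesis by simp
qed

lemma fps_map_coeffs_weier_J:
  fixes h :: "'a :: idom \<Rightarrow> 'b :: idom"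
  assumes "comm_ring_hom h"
  shows "fps_map_coeffs h (weier_J a4 a6) = weier_J (h a4) (h a6)"
proof -
  interpret F: comm_ring_hom "fps_map_coeffs h" by (rule comm_ring_hom_fps_map_coeffs[OF assms])
  have "fps_map_coeffs h 2 = 2" "fps_map_coeffs h 3 = 3"
    using F.hom_of_nat[of 2] F.hom_of_nat[of 3] by simp_all
  thus ?thesis unfolding weier_J_def using assms
    by (simp add: F.hom_minus F.hom_mult F.hom_power fps_map_coeffs_weier_w)
qed

lemma fps_map_coeffs_weier_omega:
  fixes h :: "'a :: idom \<Rightarrow> 'b :: idom"
  assumes "comm_ring_hom h"
  shows "fps_map_coeffs h (weier_omega a4 a6) = weier_omega (h a4) (h a6)"
proof -
  interpret F: comm_ring_hom "fps_map_coeffs h" by (rule comm_ring_hom_fps_map_coeffs[OF assms])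
  let ?J = "weier_J (h a4) (h a6)"
  have "?J * fps_map_coeffs h (weier_omega a4 a6) = ?J * weier_omega (h a4) (h a6)"
    by (simp add: weier_J_omega flip: fps_map_coeffs_weier_J[OF assms] F.hom_mult)
       (simp add: weier_J_omega fps_map_coeffs_weier_J[OF assms])
  moreover have "?J \<noteq> 0" using weier_J_omega[of "h a4" "h a6"] by auto
  ultimately show ?thesis by simp
qed

section \<open>The formal group law on series in one variable\<close>

abbreviation fps_add_rel ::
  "'a :: comm_ring_1 \<Rightarrow> 'a \<Rightarrow> 'a fps \<Rightarrow> 'a fps \<Rightarrow> 'a fps \<Rightarrow> 'a fps \<Rightarrow> bool" where
  "fps_add_rel a4 a6 u v l t \<equiv> add_rel (fps_const a4) (fps_const a6)
     u (weier_w a4 a6 oo u) v (weier_w a4 a6 oo v) l t"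

text \<open>The formal group law applied to a pair of series. Choosing a solution of the
  division-free \<open>add_rel\<close> avoids inverses; over a domain and for series without
  constant term the solution is unique.\<close>

definition formal_sum :: "'a :: comm_ring_1 \<Rightarrow> 'a \<Rightarrow> 'a fps \<Rightarrow> 'a fps \<Rightarrow> 'a fps" where
  "formal_sum a4 a6 u v =
     (SOME t. fps_nth t 0 = 0 \<and> (\<exists>l. fps_nth l 0 = 0 \<and> fps_add_rel a4 a6 u v l t))"

context
  fixes a4 a6 :: "'a :: idom" and u v :: "'a fps"
  assumes u0: "fps_nth u 0 = 0" and v0: "fps_nth v 0 = 0"
begin

lemma fps_add_denom_nth_0:
  "fps_nth (1 - fps_const a4 * v * ((weier_w a4 a6 oo u) + (weier_w a4 a6 oo v)) - fps_const a6 *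
    ((weier_w a4 a6 oo u) ^ 2 + (weier_w a4 a6 oo u) * (weier_w a4 a6 oo v) + (weier_w a4 a6 oo v) ^ 2)) 0 = 1"
  by (simp add: power2_eq_square u0 v0)

lemma fps_add_denom_nonzero:
  "1 - fps_const a4 * v * ((weier_w a4 a6 oo u) + (weier_w a4 a6 oo v)) - fps_const a6 *
    ((weier_w a4 a6 oo u) ^ 2 + (weier_w a4 a6 oo u) * (weier_w a4 a6 oo v) + (weier_w a4 a6 oo v) ^ 2) \<noteq> 0"
  using fps_add_denom_nth_0 by (metis fps_zero_nth zero_neq_one)

lemma fps_line_denom_nonzero:
  assumes "fps_nth l 0 = 0"
  shows "1 + fps_const a4 * l ^ 2 + fps_const a6 * l ^ 3 \<noteq> 0"
proof
  assume "1 + fps_const a4 * l ^ 2 + fps_const a6 * l ^ 3 = 0"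
  from arg_cong[OF this, of "\<lambda>f. fps_nth f 0"] show False
    using assms by (simp add: power2_eq_square power3_eq_cube)
qed

lemma formal_sum_exists: "\<exists>t. fps_nth t 0 = 0 \<and> (\<exists>l. fps_nth l 0 = 0 \<and> fps_add_rel a4 a6 u v l t)"
proof -
  obtain i where i: "(1 - fps_const a4 * v * ((weier_w a4 a6 oo u) + (weier_w a4 a6 oo v)) - fps_const a6 *
    ((weier_w a4 a6 oo u) ^ 2 + (weier_w a4 a6 oo u) * (weier_w a4 a6 oo v) + (weier_w a4 a6 oo v) ^ 2)) * i = 1"
    using fps_unit_inverse_exists[OF fps_add_denom_nth_0] by blast
  define l where "l = i * (u ^ 2 + u * v + v ^ 2 + fps_const a4 * (weier_w a4 a6 oo u) ^ 2)"
  have l0: "fps_nth l 0 = 0" by (simp add: l_def u0 v0 power2_eq_square)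
  hence "fps_nth (1 + fps_const a4 * l ^ 2 + fps_const a6 * l ^ 3) 0 = 1"
    by (simp add: power2_eq_square power3_eq_cube)
  then obtain j where j: "(1 + fps_const a4 * l ^ 2 + fps_const a6 * l ^ 3) * j = 1"
    using fps_unit_inverse_exists by blast
  define t where "t = u + v + j * ((weier_w a4 a6 oo u) - l * u) * (2 * fps_const a4 * l + 3 * fps_const a6 * l ^ 2)"
  have "fps_nth t 0 = 0" by (simp add: t_def u0 v0 l0)
  moreover have "fps_add_rel a4 a6 u v l t"
    unfolding add_rel_def
  proof
    show "l * (1 - fps_const a4 * v * ((weier_w a4 a6 oo u) + (weier_w a4 a6 oo v)) - fps_const a6 *
      ((weier_w a4 a6 oo u) ^ 2 + (weier_w a4 a6 oo u) * (weier_w a4 a6 oo v) + (weier_w a4 a6 oo v) ^ 2))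
      = u ^ 2 + u * v + v ^ 2 + fps_const a4 * (weier_w a4 a6 oo u) ^ 2"
      using i unfolding l_def by Groebner_Basis.algebra
    show "t * (1 + fps_const a4 * l ^ 2 + fps_const a6 * l ^ 3) =
      (u + v) * (1 + fps_const a4 * l ^ 2 + fps_const a6 * l ^ 3) +
      ((weier_w a4 a6 oo u) - l * u) * (2 * fps_const a4 * l + 3 * fps_const a6 * l ^ 2)"
      using j unfolding t_def by Groebner_Basis.algebra
  qed
  ultimately show ?thesis using l0 by blast
qed

lemma formal_sum_nth_0: "fps_nth (formal_sum a4 a6 u v) 0 = 0"
  and formal_sum_add_rel: "\<exists>l. fps_nth l 0 = 0 \<and> fps_add_rel a4 a6 u v l (formal_sum a4 a6 u v)"
  using someI_ex[OF formal_sum_exists, folded formal_sum_def] by auto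

text \<open>The two denominators in \<open>add_rel\<close> are nonzero, so first \<open>l\<close>
  and then \<open>t\<close> is determined. Compatibility with negation, substitution and coefficient
  maps is derived from this.\<close>

lemma formal_sum_unique:
  assumes "fps_add_rel a4 a6 u v l t"
  shows "t = formal_sum a4 a6 u v"
proof -
  let ?s = "formal_sum a4 a6 u v"
  obtain l' where l': "fps_nth l' 0 = 0" "fps_add_rel a4 a6 u v l' ?s"
    using formal_sum_add_rel by blast
  have "l = l'"
    using conjunct1[OF assms[unfolded add_rel_def]] conjunct1[OF l'(2)[unfolded add_rel_def]]
      fps_add_denom_nonzero mult_right_cancel by metis
  hence "t * (1 + fps_const a4 * l ^ 2 + fps_const a6 * l ^ 3)
    = ?s * (1 + fps_const a4 * l ^ 2 + fps_const a6 * l ^ 3)"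
    using conjunct2[OF assms[unfolded add_rel_def]] conjunct2[OF l'(2)[unfolded add_rel_def]]
    by simp
  thus ?thesis using fps_line_denom_nonzero[of l] l' \<open>l = l'\<close> by simp
qed

lemma formal_sum_weier_w:
  assumes "fps_nth l 0 = 0" "fps_add_rel a4 a6 u v l (formal_sum a4 a6 u v)"
  shows "weier_w a4 a6 oo formal_sum a4 a6 u v =
    l * formal_sum a4 a6 u v - ((weier_w a4 a6 oo u) - l * u)"
proof (rule weier_w_compose_unique[symmetric])
  note e = weier_w_compose_eqn[OF u0, of a4 a6] weier_w_compose_eqn[OF v0, of a4 a6]
  show "fps_weier_eqn a4 a6 (formal_sum a4 a6 u v)
    (l * formal_sum a4 a6 u v - ((weier_w a4 a6 oo u) - l * u))"
    by (rule add_rel_weier_eqn[OF e(1) assms(2) add_rel_line[OF e assms(2) fps_add_denom_nonzero]])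
qed (use assms formal_sum_nth_0 u0 in auto)

text \<open>The slope and the \<open>w\<close>-coordinate are divisible by \<open>fps_X\<close>, so
  the correction to \<open>u + v\<close> is divisible by \<open>fps_X ^ 2\<close>.\<close>

lemma formal_sum_nth_1: "fps_nth (formal_sum a4 a6 u v) 1 = fps_nth u 1 + fps_nth v 1"
proof -
  let ?s = "formal_sum a4 a6 u v"
  obtain l where l: "fps_nth l 0 = 0" "fps_add_rel a4 a6 u v l ?s"
    using formal_sum_add_rel by blast
  obtain l' where l': "l = fps_X * l'" using l(1) fps_X_dvd_iff by (metis dvdE)
  have "fps_X dvd weier_w a4 a6 oo u" "fps_X dvd u" by (auto simp: fps_X_dvd_iff u0)
  then obtain u' w' where w': "(weier_w a4 a6 oo u) = fps_X * w'" and u': "u = fps_X * u'" by (auto elim!: dvdE)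
  define q where "q = (w' - l * u') * (2 * fps_const a4 * l' + 3 * fps_const a6 * l * l')"
  have "?s = u + v - (?s - u - v) * (fps_X ^ 2 * (fps_const a4 * l' ^ 2 + fps_const a6 * l * l' ^ 2))
      + fps_X ^ 2 * q"
    using conjunct2[OF l(2)[unfolded add_rel_def]]
    unfolding q_def w' unfolding l' u' by Groebner_Basis.algebra
  also have "\<dots> = u + v + fps_X ^ 2 * (q - (?s - u - v) * (fps_const a4 * l' ^ 2 + fps_const a6 * l * l' ^ 2))"
    by Groebner_Basis.algebra
  finally have "fps_nth ?s 1 = fps_nth (u + v + fps_X ^ 2 * (q - (?s - u - v) * (fps_const a4 * l' ^ 2 + fps_const a6 * l * l' ^ 2))) 1"
    by (rule arg_cong)
  thus ?thesis by (simp only: fps_add_nth fps_X_power_mult_nth) simp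
qed

end

lemma formal_sum_uminus:
  fixes a4 a6 :: "'a :: idom"
  assumes "fps_nth u 0 = 0" "fps_nth v 0 = 0"
  shows "formal_sum a4 a6 (- u) (- v) = - formal_sum a4 a6 u v"
proof -
  obtain l where l: "fps_add_rel a4 a6 u v l (formal_sum a4 a6 u v)"
    using formal_sum_add_rel[OF assms] by blast
  have "fps_add_rel a4 a6 (- u) (- v) l (- formal_sum a4 a6 u v)"
    using add_rel_uminus[OF l] by (simp add: weier_w_compose_uminus assms)
  from formal_sum_unique[OF _ _ this] show ?thesis using assms by simp
qed

lemma fps_map_coeffs_formal_sum:
  fixes h :: "'a :: idom \<Rightarrow> 'b :: idom"
  assumes "comm_ring_hom h" "fps_nth u 0 = 0" "fps_nth v 0 = 0"
  shows "fps_map_coeffs h (formal_sum a4 a6 u v) =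
    formal_sum (h a4) (h a6) (fps_map_coeffs h u) (fps_map_coeffs h v)"
proof -
  interpret comm_ring_hom h by fact
  obtain l where l: "fps_add_rel a4 a6 u v l (formal_sum a4 a6 u v)"
    using formal_sum_add_rel[OF assms(2,3)] by blast
  have "fps_add_rel (h a4) (h a6) (fps_map_coeffs h u) (fps_map_coeffs h v) (fps_map_coeffs h l)
    (fps_map_coeffs h (formal_sum a4 a6 u v))"
    using add_rel_hom[OF comm_ring_hom_fps_map_coeffs[OF assms(1)] l] assms
    by (simp add: fps_map_coeffs_compose fps_map_coeffs_weier_w)
  from formal_sum_unique[OF _ _ this] show ?thesis using assms by simp
qed

text \<open>The line through a point and its negative passes through the origin. Its intercept is
  seen to be 0 after cancelling 2, and then the correction to \<open>u + (- u)\<close>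
  disappears.\<close>

lemma formal_sum_opposite:
  fixes a4 a6 :: "'a :: idom"
  assumes "fps_nth u 0 = 0" "u \<noteq> 0" "(2 :: 'a) \<noteq> 0"
  shows "formal_sum a4 a6 u (- u) = 0"
proof -
  let ?s = "formal_sum a4 a6 u (- u)" and ?w = "weier_w a4 a6 oo u"
  have u0: "fps_nth (- u) 0 = 0" using assms by simp
  obtain l where l: "fps_nth l 0 = 0" "fps_add_rel a4 a6 u (- u) l ?s"
    using formal_sum_add_rel[OF assms(1) u0] by blast
  have "?w - (weier_w a4 a6 oo (- u)) = l * (u - (- u))"
    by (rule add_rel_line[OF weier_w_compose_eqn weier_w_compose_eqn l(2)
          fps_add_denom_nonzero[OF assms(1) u0]]) (use assms in auto)
  hence "2 * (?w - l * u) = 0" by (simp add: weier_w_compose_uminus assms algebra_simps)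
  moreover have "(2 :: 'a fps) \<noteq> 0"
    using assms(3) by (metis fps_numeral_nth_0 fps_zero_nth)
  ultimately have "?w - l * u = 0" by simp
  hence "?s * (1 + fps_const a4 * l ^ 2 + fps_const a6 * l ^ 3) = 0"
    using conjunct2[OF l(2)[unfolded add_rel_def]] by simp
  thus ?thesis using fps_line_denom_nonzero[OF assms(1) u0 l(1)] by simp
qed

lemma comm_ring_hom_fps_to_fls: "comm_ring_hom (fps_to_fls :: 'a :: comm_ring_1 fps \<Rightarrow> 'a fls)"
  by unfold_locales (auto simp: fls_times_fps_to_fls)

interpretation fls_deriv: field_derivation "fls_deriv :: 'k :: field fls \<Rightarrow> 'k fls"
  by unfold_locales auto

abbreviation weier_point :: "'k :: field \<Rightarrow> 'k \<Rightarrow> 'k fps \<Rightarrow> 'k fls ec_point" where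
  "weier_point a4 a6 u \<equiv> Affine (fps_to_fls u / fps_to_fls (weier_w a4 a6 oo u))
     (- 1 / fps_to_fls (weier_w a4 a6 oo u))"

context
  fixes a4 a6 :: "'k :: field"
begin

lemma fls_weier_eqn:
  assumes "fps_nth u 0 = 0"
  shows "weier_eqn (fls_const a4) (fls_const a6) (fps_to_fls u) (fps_to_fls (weier_w a4 a6 oo u))"
  using weier_eqn_hom[OF comm_ring_hom_fps_to_fls weier_w_compose_eqn[OF assms]] by simp

lemma fls_weier_J:
  assumes "fps_nth u 0 = 0"
  shows "1 - 2 * fls_const a4 * fps_to_fls u * fps_to_fls (weier_w a4 a6 oo u)
    - 3 * fls_const a6 * fps_to_fls (weier_w a4 a6 oo u) ^ 2 = fps_to_fls (weier_J a4 a6 oo u)"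
  by (simp add: weier_J_compose assms fls_times_fps_to_fls fps_to_fls_power)

lemma fls_invariant_diff:
  assumes "fps_nth u 0 = 0"
  shows "fls_deriv.invariant_diff (fls_const a4) (fls_const a6) (fps_to_fls u)
      (fps_to_fls (weier_w a4 a6 oo u)) = fps_to_fls ((weier_omega a4 a6 oo u) * fps_deriv u)"
proof -
  let ?J = "weier_J a4 a6 oo u"
  have "fps_to_fls ?J * fps_to_fls (weier_omega a4 a6 oo u) = 1"
    by (simp add: weier_J_omega_compose[OF assms] flip: fls_times_fps_to_fls)
  moreover from this have "fps_to_fls ?J \<noteq> 0" by auto
  ultimately have "inverse (fps_to_fls ?J) = fps_to_fls (weier_omega a4 a6 oo u)"
    by (metis inverse_unique)
  thus ?thesis
    unfolding fls_deriv.invariant_diff_def fls_weier_J[OF assms]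
    by (simp add: divide_inverse fls_deriv_fps_to_fls fls_times_fps_to_fls mult.commute)
qed

lemma fls_weier_deriv:
  assumes "fps_nth u 0 = 0" "u \<noteq> 0"
  shows "fls_deriv (fps_to_fls u / fps_to_fls (weier_w a4 a6 oo u)) =
      2 * (- 1 / fps_to_fls (weier_w a4 a6 oo u)) * fps_to_fls ((weier_omega a4 a6 oo u) * fps_deriv u)"
    and "fls_deriv (- 1 / fps_to_fls (weier_w a4 a6 oo u)) =
      (3 * (fps_to_fls u / fps_to_fls (weier_w a4 a6 oo u)) ^ 2 + fls_const a4)
      * fps_to_fls ((weier_omega a4 a6 oo u) * fps_deriv u)"
proof -
  have J: "1 - 2 * fls_const a4 * fps_to_fls u * fps_to_fls (weier_w a4 a6 oo u)
    - 3 * fls_const a6 * fps_to_fls (weier_w a4 a6 oo u) ^ 2 \<noteq> 0"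
    unfolding fls_weier_J[OF assms(1)] using weier_J_omega_compose[OF assms(1), of a4 a6] by auto
  have w: "fps_to_fls (weier_w a4 a6 oo u) \<noteq> 0" using weier_w_compose_nonzero[OF assms] by simp
  note fls_deriv.d_weier[OF fls_weier_eqn[OF assms(1)] w J fls_deriv_const fls_deriv_const,
    unfolded fls_invariant_diff[OF assms(1)]]
  thus "fls_deriv (fps_to_fls u / fps_to_fls (weier_w a4 a6 oo u)) =
      2 * (- 1 / fps_to_fls (weier_w a4 a6 oo u)) * fps_to_fls ((weier_omega a4 a6 oo u) * fps_deriv u)"
    and "fls_deriv (- 1 / fps_to_fls (weier_w a4 a6 oo u)) =
      (3 * (fps_to_fls u / fps_to_fls (weier_w a4 a6 oo u)) ^ 2 + fls_const a4)
      * fps_to_fls ((weier_omega a4 a6 oo u) * fps_deriv u)" by blast+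
qed

lemma weier_x_neq:
  assumes "fps_nth u 0 = 0" "fps_nth v 0 = 0" "u \<noteq> 0" "v \<noteq> 0" "u \<noteq> v" "u \<noteq> - v"
  shows "u * (weier_w a4 a6 oo v) \<noteq> v * (weier_w a4 a6 oo u)"
  using weier_same_x[OF weier_w_compose_eqn weier_w_compose_eqn, of u v a4 a6]
    weier_w_compose_nonzero[of u a4 a6] weier_w_compose_nonzero[of v a4 a6] assms by blast

text \<open>Links the formal sum with the group law over the Laurent series field. The case
  \<open>u = v\<close> is included through the tangent; \<open>u = - v\<close> is not, since the sum
  is then \<open>Origin\<close>.\<close>

lemma ec_add_weier_point:
  assumes "fps_nth u 0 = 0" "fps_nth v 0 = 0" "u \<noteq> 0" "v \<noteq> 0" "u \<noteq> - v" "(2 :: 'k) \<noteq> 0"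
  shows "ec_add (fls_const a4) (weier_point a4 a6 u) (weier_point a4 a6 v)
       = weier_point a4 a6 (formal_sum a4 a6 u v)"
    and "weier_w a4 a6 oo formal_sum a4 a6 u v \<noteq> 0"
proof -
  let ?h = "fps_to_fls :: 'k fps \<Rightarrow> 'k fls" and ?s = "formal_sum a4 a6 u v"
  let ?w1 = "weier_w a4 a6 oo u" and ?w2 = "weier_w a4 a6 oo v"
  interpret h: comm_ring_hom ?h by (rule comm_ring_hom_fps_to_fls)
  obtain l where l: "fps_nth l 0 = 0" "fps_add_rel a4 a6 u v l ?s"
    using formal_sum_add_rel[OF assms(1,2)] by blast
  have ar: "add_rel (fls_const a4) (fls_const a6) (?h u) (?h ?w1) (?h v) (?h ?w2) (?h l) (?h ?s)"
    using add_rel_hom[OF comm_ring_hom_fps_to_fls l(2)] by simp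
  have ws: "?h (weier_w a4 a6 oo ?s) = ?h l * ?h ?s - (?h ?w1 - ?h l * ?h u)"
    unfolding formal_sum_weier_w[OF assms(1,2) l] by (simp add: fls_times_fps_to_fls)
  have D: "1 - fls_const a4 * ?h v * (?h ?w1 + ?h ?w2)
    - fls_const a6 * (?h ?w1 ^ 2 + ?h ?w1 * ?h ?w2 + ?h ?w2 ^ 2) \<noteq> 0"
    using fps_to_fls_nonzeroI[OF fps_add_denom_nonzero[OF assms(1,2), of a4 a6]]
    by (simp add: fls_times_fps_to_fls fps_to_fls_power)
  have M: "1 + fls_const a4 * ?h l ^ 2 + fls_const a6 * ?h l ^ 3 \<noteq> 0"
    using fps_to_fls_nonzeroI[OF fps_line_denom_nonzero[OF assms(1,2) l(1), of a4 a6]]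
    by (simp add: fls_times_fps_to_fls fps_to_fls_power)
  have w: "?h ?w1 \<noteq> 0" "?h ?w2 \<noteq> 0"
    using weier_w_compose_nonzero assms by auto
  have two: "(2 :: 'k fls) \<noteq> 0"
    using assms(6) by (metis fls_const_numeral fls_const_nonzero)
  have gen: "?h u * ?h ?w2 \<noteq> ?h v * ?h ?w1 \<or> ?h u = ?h v \<and> ?h ?w1 = ?h ?w2 \<and> (2 :: 'k fls) \<noteq> 0"
    using weier_x_neq[OF assms(1-4)] assms(5) two by (cases "u = v") (auto simp flip: fls_times_fps_to_fls)
  note * = ec_add_of_add_rel[OF fls_weier_eqn[OF assms(1)] fls_weier_eqn[OF assms(2)] ar D M w gen, folded ws]
  show "weier_w a4 a6 oo ?s \<noteq> 0" using *(1) by simp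
  show "ec_add (fls_const a4) (weier_point a4 a6 u) (weier_point a4 a6 v) = weier_point a4 a6 ?s"
    by (rule *(2))
qed

lemma formal_sum_nonzero:
  assumes "fps_nth u 0 = 0" "fps_nth v 0 = 0" "u \<noteq> 0" "v \<noteq> 0" "u \<noteq> - v" "(2 :: 'k) \<noteq> 0"
  shows "formal_sum a4 a6 u v \<noteq> 0"
  using ec_add_weier_point(2)[OF assms] by (auto simp del: fps_compose_0_right) (simp)

lemma weier_point_on_curve:
  assumes "fps_nth u 0 = 0" "u \<noteq> 0"
  shows "(- 1 / fps_to_fls (weier_w a4 a6 oo u)) ^ 2 =
    (fps_to_fls u / fps_to_fls (weier_w a4 a6 oo u)) ^ 3
      + fls_const a4 * (fps_to_fls u / fps_to_fls (weier_w a4 a6 oo u)) + fls_const a6"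
proof -
  define t w where "t = fps_to_fls u" and "w = fps_to_fls (weier_w a4 a6 oo u)"
  have "w \<noteq> 0" using weier_w_compose_nonzero[OF assms] by (simp add: w_def)
  have "w = t ^ 3 + fls_const a4 * t * w ^ 2 + fls_const a6 * w ^ 3"
    using fls_weier_eqn[OF assms(1)] by (simp add: weier_eqn_def t_def w_def)
  hence "w / w ^ 3 = (t ^ 3 + fls_const a4 * t * w ^ 2 + fls_const a6 * w ^ 3) / w ^ 3" by simp
  also have "\<dots> = (t / w) ^ 3 + fls_const a4 * (t / w) + fls_const a6"
    using \<open>w \<noteq> 0\<close> by (simp add: add_divide_distrib power_divide power2_eq_square power3_eq_cube)
  also have "w / w ^ 3 = (- 1 / w) ^ 2"
    using \<open>w \<noteq> 0\<close> by (simp add: power2_eq_square power3_eq_cube)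
  finally show ?thesis by (simp add: t_def w_def)
qed

end

section \<open>The sigma identity in characteristic 0\<close>

lemma formal_sum_compose:
  fixes a4 a6 :: "'a :: idom"
  assumes "fps_nth u 0 = 0" "fps_nth v 0 = 0" "fps_nth g 0 = 0"
  shows "formal_sum a4 a6 u v oo g = formal_sum a4 a6 (u oo g) (v oo g)"
proof -
  obtain l where l: "fps_add_rel a4 a6 u v l (formal_sum a4 a6 u v)"
    using formal_sum_add_rel[OF assms(1,2)] by blast
  have "fps_add_rel a4 a6 (u oo g) (v oo g) (l oo g) (formal_sum a4 a6 u v oo g)"
    using add_rel_hom[OF comm_ring_hom_fps_compose[OF assms(3)] l] assms by (simp add: fps_compose_assoc)
  from formal_sum_unique[OF _ _ this] show ?thesis using assms by simp
qed

context
  fixes a4 a6 :: "'k :: field_char_0" and u v :: "'k fps"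
  assumes uv: "fps_nth u 0 = 0" "fps_nth v 0 = 0" "u \<noteq> 0" "v \<noteq> 0" "u \<noteq> - v"
begin

private abbreviation "ps \<equiv> formal_sum a4 a6 u v"
private abbreviation "px f \<equiv> fps_to_fls f / fps_to_fls (weier_w a4 a6 oo f)"
private abbreviation "py f \<equiv> - 1 / fps_to_fls (weier_w a4 a6 oo f)"
private abbreviation "pg f \<equiv> fps_to_fls ((weier_omega a4 a6 oo f) * fps_deriv f)"

lemma formal_sum_nonzero_char_0: "ps \<noteq> 0"
  using formal_sum_nonzero[OF uv, of a4 a6] by simp

lemma formal_sum_chord:
  assumes "u \<noteq> v"
  defines "L \<equiv> (py v - py u) / (px v - px u)"
  shows "px v - px u \<noteq> 0" "px ps = L ^ 2 - px u - px v" "py ps = - py u - L * (px ps - px u)"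
    "fls_deriv L = pg u * (px u - px ps) + pg v * (px v - px ps)"
    "fls_deriv (px ps) = 2 * py ps * (pg u + pg v)"
proof -
  have "u * (weier_w a4 a6 oo v) \<noteq> v * (weier_w a4 a6 oo u)"
    using weier_x_neq[OF uv(1-4) assms(1) uv(5)] .
  hence xx: "px u \<noteq> px v"
    using weier_w_compose_nonzero[OF uv(1,3), of a4 a6] weier_w_compose_nonzero[OF uv(2,4), of a4 a6]
    by (subst frac_eq_eq) (auto simp flip: fls_times_fps_to_fls)
  thus "px v - px u \<noteq> 0" by simp
  have "ec_add (fls_const a4) (weier_point a4 a6 u) (weier_point a4 a6 v) = weier_point a4 a6 ps"
    by (rule ec_add_weier_point(1)[OF uv]) simp
  hence "Affine (L ^ 2 - px u - px v) (- py u - L * (L ^ 2 - px u - px v - px u)) = weier_point a4 a6 ps"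
    by (simp only: ec_add.simps xx simp_thms if_False Let_def L_def)
  thus e: "px ps = L ^ 2 - px u - px v" "py ps = - py u - L * (px ps - px u)" by (auto simp only: ec_point.inject)
  show "fls_deriv L = pg u * (px u - px ps) + pg v * (px v - px ps)"
    "fls_deriv (px ps) = 2 * py ps * (pg u + pg v)"
    by (rule fls_deriv.d_chord[OF weier_point_on_curve[OF uv(1,3)] weier_point_on_curve[OF uv(2,4)] xx
      fls_weier_deriv[OF uv(1,3)] fls_weier_deriv[OF uv(2,4)] L_def[THEN meta_eq_to_obj_eq] e])+
qed

text \<open>The derivative of the \<open>x\<close>-coordinate of the sum is computed twice, by the
  chord or tangent formulas and by \<open>dx = 2 y \<omega>\<close> on the curve; then
  \<open>2 y\<close> is cancelled.\<close>

lemma formal_sum_invariant_diff: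
  "(weier_omega a4 a6 oo ps) * fps_deriv ps
    = (weier_omega a4 a6 oo u) * fps_deriv u + (weier_omega a4 a6 oo v) * fps_deriv v"
proof -
  have s0: "fps_nth ps 0 = 0" by (rule formal_sum_nth_0[OF uv(1,2)])
  have ws: "fps_to_fls (weier_w a4 a6 oo ps) \<noteq> 0"
    using weier_w_compose_nonzero[OF s0 formal_sum_nonzero_char_0] by simp
  have "fls_deriv (px ps) = 2 * py ps * (pg u + pg v)"
  proof (cases "u = v")
    case False thus ?thesis by (rule formal_sum_chord(5))
  next
    case True
    let ?L = "(3 * px u ^ 2 + fls_const a4) / (2 * py u)"
    have wu: "fps_to_fls (weier_w a4 a6 oo u) \<noteq> 0" using weier_w_compose_nonzero[OF uv(1,3)] by simp
    hence yu: "2 * py u \<noteq> 0" by simp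
    hence yu': "py u \<noteq> - py u" by (metis add.right_inverse mult_2)
    have "ec_add (fls_const a4) (weier_point a4 a6 u) (weier_point a4 a6 u) = weier_point a4 a6 ps"
      using ec_add_weier_point(1)[OF uv] True by simp
    hence "Affine (?L ^ 2 - px u - px u) (- py u - ?L * (?L ^ 2 - px u - px u - px u)) = weier_point a4 a6 ps"
      by (simp only: ec_add.simps yu' simp_thms if_False if_True Let_def)
    hence e: "px ps = ?L ^ 2 - px u - px u" "py ps = - py u - ?L * (px ps - px u)" by (auto simp only: ec_point.inject)
    show ?thesis
      using fls_deriv.d_tangent[OF yu fls_weier_deriv[OF uv(1,3)] fls_deriv_const refl e] True by simp
  qed
  moreover have "fls_deriv (px ps) = 2 * py ps * pg ps" by (rule fls_weier_deriv(1)[OF s0 formal_sum_nonzero_char_0])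
  ultimately have "2 * py ps * pg ps = 2 * py ps * (pg u + pg v)" by simp
  hence "pg ps = pg u + pg v" using ws by (subst (asm) mult_left_cancel) auto
  thus ?thesis by (simp only: fps_to_fls_plus[symmetric] fps_to_fls_eq_iff)
qed

end

text \<open>\<open>c\<close> may be 0: the order is only bounded below and one coefficient is
  recorded, so the notion is stable under differences.\<close>

definition fps_lead :: "nat \<Rightarrow> 'a :: comm_ring_1 \<Rightarrow> 'a fps \<Rightarrow> bool" where
  "fps_lead n c f \<longleftrightarrow> (\<exists>F. f = fps_X ^ n * F \<and> fps_nth F 0 = c)"

lemma fps_lead_mult: "fps_lead m c f \<Longrightarrow> fps_lead n d g \<Longrightarrow> fps_lead (m + n) (c * d) (f * g)"
proof (unfold fps_lead_def, elim exE conjE)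
  fix F G assume "f = fps_X ^ m * F" "fps_nth F 0 = c" "g = fps_X ^ n * G" "fps_nth G 0 = d"
  thus "\<exists>H. f * g = fps_X ^ (m + n) * H \<and> fps_nth H 0 = c * d"
    by (intro exI[of _ "F * G"]) (simp add: power_add mult_ac)
qed

lemma fps_lead_diff: "fps_lead n c f \<Longrightarrow> fps_lead n d g \<Longrightarrow> fps_lead n (c - d) (f - g)"
proof (unfold fps_lead_def, elim exE conjE)
  fix F G assume "f = fps_X ^ n * F" "fps_nth F 0 = c" "g = fps_X ^ n * G" "fps_nth G 0 = d"
  thus "\<exists>H. f - g = fps_X ^ n * H \<and> fps_nth H 0 = c - d"
    by (intro exI[of _ "F - G"]) (simp add: algebra_simps)
qed

lemma fps_lead_power2: "fps_lead m c f \<Longrightarrow> fps_lead (m + m) (c ^ 2) (f ^ 2)"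
  using fps_lead_mult[of m c f m c f] by (simp add: power2_eq_square)

lemma fps_lead_nth: "fps_lead n c f \<Longrightarrow> fps_nth f n = c"
  by (auto simp: fps_lead_def fps_X_power_mult_nth)

lemma fps_lead_1I: "fps_nth f 0 = 0 \<Longrightarrow> fps_nth f 1 = c \<Longrightarrow> fps_lead 1 c f"
  using fps_X_dvd_iff[of f] unfolding fps_lead_def dvd_def by auto

lemma fps_lead_compose_1:
  assumes "fps_nth s 0 = 0" "fps_nth (s :: 'a :: idom fps) 1 = 1" "fps_nth u 0 = 0" "fps_lead 1 c u"
  shows "fps_lead 1 c (s oo u)"
proof -
  obtain S where S: "s = fps_X * S" "fps_nth S 0 = 1"
    using fps_lead_1I[OF assms(1,2)] unfolding fps_lead_def by auto
  have "s oo u = u * (S oo u)" unfolding S(1) using assms(3) by (simp add: fps_compose_mult_distrib)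
  moreover have "fps_lead 0 1 (S oo u)" using S(2) by (simp add: fps_lead_def)
  ultimately show ?thesis using fps_lead_mult[OF assms(4), of 0 1 "S oo u"] by simp
qed

lemma fps_lead_weier_w:
  assumes "fps_nth u 0 = 0" "fps_lead 1 (c :: 'a :: idom) u"
  shows "fps_lead 3 (c ^ 3) (weier_w a4 a6 oo u)"
proof -
  obtain V where V: "weier_w a4 a6 = fps_X ^ 3 * V" "fps_nth V 0 = 1" using weier_w_factor by blast
  have "weier_w a4 a6 oo u = u * u * u * (V oo u)"
    unfolding V(1) using assms(1)
    by (simp add: fps_compose_mult_distrib flip: fps_compose_power) (simp add: power3_eq_cube mult_ac)
  moreover have "fps_lead (1 + 1 + 1 + 0) (c * c * c * 1) (u * u * u * (V oo u))"
    using assms(2) V(2) by (intro fps_lead_mult) (auto simp: fps_lead_def)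
  ultimately show ?thesis by (simp add: power3_eq_cube numeral_3_eq_3 mult.assoc)
qed

text \<open>\<open>q\<close> is \<open>D \<sigma>\<close>, and \<open>ode\<close> is the equation
  \<open>D (q / \<sigma>) + x = c\<close> multiplied by \<open>w * \<sigma> ^ 2\<close>.\<close>

context
  fixes a4 a6 c :: "'k :: field_char_0" and \<sigma> q :: "'k fps"
  assumes odd: "\<sigma> oo (- fps_X) = - \<sigma>" and sg0: "fps_nth \<sigma> 0 = 0" and sg1: "fps_nth \<sigma> 1 = 1"
    and q: "q = weier_J a4 a6 * fps_deriv \<sigma>"
    and ode: "weier_J a4 a6 * weier_w a4 a6 * (fps_deriv q * \<sigma> - q * fps_deriv \<sigma>)
      = (fps_const c * weier_w a4 a6 - fps_X) * \<sigma> ^ 2"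
begin

private abbreviation "x f \<equiv> fps_to_fls f / fps_to_fls (weier_w a4 a6 oo f)"
private abbreviation "y f \<equiv> - 1 / fps_to_fls (weier_w a4 a6 oo f)"
private abbreviation "g f \<equiv> fps_to_fls ((weier_omega a4 a6 oo f) * fps_deriv f)"
private abbreviation "S f \<equiv> fps_to_fls (\<sigma> oo f)"
private abbreviation "\<zeta> f \<equiv> fps_to_fls (q oo f) / S f"

lemma sigma_compose_nonzero: assumes "fps_nth u 0 = 0" "u \<noteq> 0" shows "\<sigma> oo u \<noteq> 0"
  using assms sg1 by (subst fps_compose_eq_0_iff) auto

text \<open>The logarithmic derivative of \<open>\<sigma>\<close> along \<open>u\<close> is
  \<open>\<zeta> \<omega>\<close>, since the factor \<open>J\<close> in \<open>q\<close> cancels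
  against \<open>\<omega>\<close>.\<close>

lemma sigma_deriv:
  assumes "fps_nth u 0 = 0" "u \<noteq> 0"
  shows "fls_deriv (S u) = S u * (g u * \<zeta> u)"
proof -
  have "(weier_omega a4 a6 oo u) * (q oo u) = (fps_deriv \<sigma> oo u)"
  proof -
    have "(weier_omega a4 a6 oo u) * (q oo u)
      = ((weier_J a4 a6 oo u) * (weier_omega a4 a6 oo u)) * (fps_deriv \<sigma> oo u)"
      unfolding q using assms(1) by (simp add: fps_compose_mult_distrib mult_ac)
    thus ?thesis using weier_J_omega_compose[OF assms(1)] by simp
  qed
  hence "fps_deriv (\<sigma> oo u) = (weier_omega a4 a6 oo u) * fps_deriv u * (q oo u)"
    using fps_compose_deriv[OF assms(1), of \<sigma>] by (simp add: mult_ac)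
  thus ?thesis using sigma_compose_nonzero[OF assms]
    by (simp add: fls_deriv_fps_to_fls fls_times_fps_to_fls)
qed

lemma zeta_deriv:
  assumes "fps_nth u 0 = 0" "u \<noteq> 0"
  shows "fls_deriv (\<zeta> u) = g u * (fls_const c - x u)"
proof -
  let ?w = "weier_w a4 a6 oo u" and ?J = "weier_J a4 a6 oo u" and ?o = "weier_omega a4 a6 oo u"
  let ?E = "(fps_deriv q oo u) * (\<sigma> oo u) - (q oo u) * (fps_deriv \<sigma> oo u)"
  interpret h: comm_ring_hom "\<lambda>f. f oo u" by (rule comm_ring_hom_fps_compose[OF assms(1)])
  have "?J * ?w * ?E = (fps_const c * ?w - u) * (\<sigma> oo u) ^ 2"
    using arg_cong[OF ode, of "\<lambda>f. f oo u"] assms(1) by (simp add: h.hom_mult h.hom_minus h.hom_power)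
  hence "?o * (?J * ?w * ?E) = ?o * ((fps_const c * ?w - u) * (\<sigma> oo u) ^ 2)" by simp
  hence "(?J * ?o) * (?w * ?E) = ?o * ((fps_const c * ?w - u) * (\<sigma> oo u) ^ 2)" by (simp only: mult_ac)
  hence "?w * ?E = ?o * ((fps_const c * ?w - u) * (\<sigma> oo u) ^ 2)"
    by (simp add: weier_J_omega_compose[OF assms(1)])
  hence E: "fps_to_fls ?w * fps_to_fls ?E = fps_to_fls ?o * ((fls_const c * fps_to_fls ?w - fps_to_fls u) * S u ^ 2)"
    by (simp flip: fls_times_fps_to_fls fps_to_fls_power fps_const_to_fls fps_to_fls_minus)
  have w: "fps_to_fls ?w \<noteq> 0" and Su: "S u \<noteq> 0"
    using weier_w_compose_nonzero[OF assms] sigma_compose_nonzero[OF assms] by simp_all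
  have E': "fps_to_fls ?E = fps_to_fls ?o * (fls_const c - x u) * S u ^ 2"
  proof -
    have "fps_to_fls ?w * fps_to_fls ?E = fps_to_fls ?w * (fps_to_fls ?o * (fls_const c - x u) * S u ^ 2)"
      unfolding E using w by (simp add: field_simps)
    thus ?thesis using w mult_left_cancel by blast
  qed
  have "fls_deriv (\<zeta> u) = (fls_deriv (fps_to_fls (q oo u)) * S u - fps_to_fls (q oo u) * fls_deriv (S u)) / S u ^ 2"
    by (rule fls_deriv.d_divide[OF Su])
  also have "fls_deriv (fps_to_fls (q oo u)) * S u - fps_to_fls (q oo u) * fls_deriv (S u)
    = fps_to_fls ?E * fps_to_fls (fps_deriv u)"
    unfolding fls_deriv_fps_to_fls fps_compose_deriv[OF assms(1)]
    by (simp add: fls_times_fps_to_fls algebra_simps)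
  also have "\<dots> / S u ^ 2 = g u * (fls_const c - x u)"
    unfolding E' using Su by (simp add: fls_times_fps_to_fls mult_ac)
  finally show ?thesis .
qed

lemma fps_uminus_X_compose: "fps_nth f 0 = 0 \<Longrightarrow> (- fps_X) oo f = - (f :: 'k fps)"
  by (simp add: fps_compose_uminus)

lemma sigma_compose_uminus: assumes "fps_nth u 0 = 0" shows "\<sigma> oo (- u) = - (\<sigma> oo u)"
proof -
  have "\<sigma> oo (- u) = \<sigma> oo ((- fps_X) oo u)" using assms by (simp add: fps_uminus_X_compose)
  also have "\<dots> = (\<sigma> oo (- fps_X)) oo u" using assms by (intro fps_compose_assoc) auto
  finally show ?thesis by (simp add: odd fps_compose_uminus)
qed

lemma q_compose_uminus: assumes "fps_nth u 0 = 0" shows "q oo (- u) = q oo u"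
proof -
  have "fps_deriv (\<sigma> oo (- fps_X)) = (fps_deriv \<sigma> oo (- fps_X)) * fps_deriv (- fps_X)"
    by (rule fps_compose_deriv) simp
  hence d: "fps_deriv \<sigma> oo (- fps_X) = fps_deriv \<sigma>" unfolding odd by simp
  have "fps_deriv \<sigma> oo (- u) = fps_deriv \<sigma> oo ((- fps_X) oo u)" using assms by (simp add: fps_uminus_X_compose)
  also have "\<dots> = (fps_deriv \<sigma> oo (- fps_X)) oo u" using assms by (intro fps_compose_assoc) auto
  finally show ?thesis unfolding q using assms
    by (simp add: fps_compose_mult_distrib d weier_J_compose_uminus)
qed

lemma zeta_uminus: "fps_nth u 0 = 0 \<Longrightarrow> \<zeta> (- u) = - \<zeta> u"
  by (simp add: sigma_compose_uminus q_compose_uminus)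

text \<open>The difference \<open>Z\<close> of the two sides has derivative 0: by additivity of
  \<open>\<omega>\<close> the terms in \<open>c\<close> cancel and those in \<open>x\<close> make up
  the derivative of the slope. The remaining constant is 0 because \<open>Z\<close> changes sign
  under \<open>t\<close> to \<open>- t\<close>; this is where \<open>u\<close> and \<open>v\<close>
  have to be odd.\<close>

lemma zeta_add:
  assumes uv: "fps_nth u 0 = 0" "fps_nth v 0 = 0" "u \<noteq> 0" "v \<noteq> 0" "u \<noteq> - v" "u \<noteq> v"
    and odd_uv: "u oo (- fps_X) = - u" "v oo (- fps_X) = - v"
  shows "\<zeta> (formal_sum a4 a6 u v) = \<zeta> u + \<zeta> v + (y v - y u) / (x v - x u)"
proof -
  let ?s = "formal_sum a4 a6 u v" and ?L = "(y v - y u) / (x v - x u)"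
  let ?Z = "\<zeta> ?s - \<zeta> u - \<zeta> v - ?L"
  \<comment> \<open>Substitution of \<open>- fps_X\<close>; at odd arguments it negates
    \<open>\<zeta>\<close> and \<open>y\<close> and fixes \<open>x\<close>.\<close>
  let ?r = "\<lambda>f :: 'k fls. fls_compose_fps f (- fps_X)"
  have s0: "fps_nth ?s 0 = 0" by (rule formal_sum_nth_0[OF uv(1,2)])
  have s: "?s \<noteq> 0" by (rule formal_sum_nonzero_char_0[OF uv(1-5)])
  have gs: "g ?s = g u + g v" unfolding formal_sum_invariant_diff[OF uv(1-5)] by simp
  have dZ: "fls_deriv ?Z = g ?s * (fls_const c - x ?s) - g u * (fls_const c - x u)
      - g v * (fls_const c - x v) - (g u * (x u - x ?s) + g v * (x v - x ?s))"
    by (simp only: fls_deriv_sub zeta_deriv[OF s0 s] zeta_deriv[OF uv(1,3)] zeta_deriv[OF uv(2,4)]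
        formal_sum_chord(4)[OF uv])
  also have "\<dots> = 0" unfolding gs by (simp only: ring_distribs) (simp add: algebra_simps)
  finally have "fls_deriv ?Z = 0" .
  then obtain k where k: "?Z = fls_const k" using fls_deriv_eq_0_iff by blast
  have r_fps: "?r (fps_to_fls f) = fps_to_fls (f oo (- fps_X))" for f by simp
  have odd_s: "?s oo (- fps_X) = - ?s"
    using uv odd_uv by (simp add: formal_sum_compose formal_sum_uminus)
  have r_comp: "?r (fps_to_fls (f oo z)) = fps_to_fls (f oo (- z))"
    if "fps_nth z 0 = 0" "z oo (- fps_X) = - z" for f z
    using that fps_compose_assoc[of "- fps_X" z f] by simp
  have r_div: "?r (f / h) = ?r f / ?r h" for f h by (rule fls_compose_fps_divide) auto
  have r_diff: "?r (f - h) = ?r f - ?r h" for f h by (rule fls_compose_fps_diff) auto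
  have r_zeta: "?r (\<zeta> z) = - \<zeta> z" if "fps_nth z 0 = 0" "z oo (- fps_X) = - z" for z
    by (simp only: r_div r_comp[OF that] zeta_uminus[OF that(1)])
  have r_x: "?r (x z) = x z" if "fps_nth z 0 = 0" "z oo (- fps_X) = - z" for z
    by (simp only: r_div r_comp[OF that] r_fps[of z] that(2) weier_w_compose_uminus[OF that(1)] fps_to_fls_uminus
          minus_divide_divide)
  have r_y: "?r (y z) = - y z" if "fps_nth z 0 = 0" "z oo (- fps_X) = - z" for z
    by (simp add: r_div r_comp[OF that] weier_w_compose_uminus[OF that(1)])
  have r_L: "?r ?L = - ?L"
  proof -
    have "?r ?L = (?r (y v) - ?r (y u)) / (?r (x v) - ?r (x u))"
      by (simp only: r_div[of "y v - y u" "x v - x u"] r_diff)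
    also have "\<dots> = (- y v - - y u) / (x v - x u)"
      by (simp only: r_x[OF uv(1) odd_uv(1)] r_x[OF uv(2) odd_uv(2)] r_y[OF uv(1) odd_uv(1)] r_y[OF uv(2) odd_uv(2)])
    also have "(- a - - b) / e = - ((a - b) / e)" for a b e :: "'k fls"
      by (simp only: minus_diff_minus minus_divide_left)
    finally show ?thesis .
  qed
  have "?r ?Z = ?r (\<zeta> ?s) - ?r (\<zeta> u) - ?r (\<zeta> v) - ?r ?L"
    by (simp only: r_diff)
  also have "\<dots> = - ?Z"
    by (simp only: r_zeta[OF s0 odd_s] r_zeta[OF uv(1) odd_uv(1)] r_zeta[OF uv(2) odd_uv(2)] r_L) simp
  finally have "fls_const k = - fls_const k" unfolding k by simp
  from arg_cong[OF this, of "\<lambda>f. fls_nth f 0"] have "k = 0" by simp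
  hence "?Z = 0" unfolding k by simp
  thus ?thesis by (simp only: diff_diff_eq right_minus_eq)
qed

text \<open>After division by the two values of \<open>w\<close>, both sides have the same
  logarithmic derivative: the slopes contributed by \<open>u + v\<close> and \<open>u - v\<close>
  combine to that of \<open>x(v) - x(u)\<close>. So the quotient is constant, and leading
  coefficients show that it is 1.\<close>

lemma sigma_identity_field:
  assumes ab: "\<alpha> \<noteq> 0" "\<beta> \<noteq> 0" "\<alpha> \<noteq> \<beta>" "\<alpha> \<noteq> - \<beta>"
  defines "u \<equiv> fps_const \<alpha> * fps_X" and "v \<equiv> fps_const \<beta> * fps_X"
  shows "(\<sigma> oo formal_sum a4 a6 u v) * (\<sigma> oo formal_sum a4 a6 u (- v)) * ((weier_w a4 a6 oo u) * (weier_w a4 a6 oo v))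
    = (\<sigma> oo u) ^ 2 * (\<sigma> oo v) ^ 2 * (v * (weier_w a4 a6 oo u) - u * (weier_w a4 a6 oo v))"
proof -
  let ?s = "formal_sum a4 a6 u v" and ?d = "formal_sum a4 a6 u (- v)"
  have u1: "fps_nth u 1 = \<alpha>" and v1: "fps_nth v 1 = \<beta>" by (simp_all add: u_def v_def)
  have u0: "fps_nth u 0 = 0" and v0: "fps_nth v 0 = 0" by (simp_all add: u_def v_def)
  have uv: "u \<noteq> 0" "v \<noteq> 0" "u \<noteq> - v" "u \<noteq> v" using u1 v1 ab by auto
  have odd_uv: "u oo (- fps_X) = - u" "v oo (- fps_X) = - v" "(- v) oo (- fps_X) = - (- v)"
    by (simp_all add: u_def v_def fps_compose_mult_distrib fps_compose_uminus)
  have vm: "fps_nth (- v) 0 = 0" "- v \<noteq> 0" "u \<noteq> - (- v)" "u \<noteq> - v" using v0 uv by auto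
  have xm: "x (- v) = x v" and ym: "y (- v) = - y v" and gm: "g (- v) = - g v"
    by (simp_all add: weier_w_compose_uminus[OF v0] weier_omega_compose_uminus[OF v0])
  define \<delta> where "\<delta> = x v - x u"
  have \<delta>: "\<delta> \<noteq> 0" unfolding \<delta>_def by (rule formal_sum_chord(1)[OF u0 v0 uv(1,2,3,4)])
  have zs: "\<zeta> ?s = \<zeta> u + \<zeta> v + (y v - y u) / \<delta>"
    unfolding \<delta>_def by (rule zeta_add[OF u0 v0 uv odd_uv(1,2)])
  have zd: "\<zeta> ?d = \<zeta> u - \<zeta> v + (- y v - y u) / \<delta>"
    using zeta_add[OF u0 vm(1) uv(1) vm(2,3,4) odd_uv(1,3)] unfolding \<delta>_def xm ym zeta_uminus[OF v0] by simp
  have s0: "fps_nth ?s 0 = 0" "?s \<noteq> 0"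
    using formal_sum_nth_0[OF u0 v0] formal_sum_nonzero_char_0[OF u0 v0 uv(1,2,3)] by auto
  have d0: "fps_nth ?d 0 = 0" "?d \<noteq> 0"
    using formal_sum_nth_0[OF u0 vm(1)] formal_sum_nonzero_char_0[OF u0 vm(1) uv(1) vm(2,3)] by auto
  have gs: "g ?s = g u + g v" unfolding formal_sum_invariant_diff[OF u0 v0 uv(1,2,3)] by simp
  have gd: "g ?d = g u - g v"
    unfolding formal_sum_invariant_diff[OF u0 vm(1) uv(1) vm(2,3)] using gm by simp
  define A where "A = S ?s * S ?d"
  define B where "B = S u ^ 2 * S v ^ 2 * \<delta>"
  have B0: "B \<noteq> 0" unfolding B_def using \<delta> sigma_compose_nonzero u0 v0 uv by simp
  have dA: "fls_deriv A = A * (g ?s * \<zeta> ?s + g ?d * \<zeta> ?d)"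
    unfolding A_def by (simp only: fls_deriv_mult sigma_deriv[OF s0] sigma_deriv[OF d0]) (simp only: ring_distribs mult_ac add_ac)
  have d\<delta>: "fls_deriv \<delta> = 2 * y v * g v - 2 * y u * g u"
    unfolding \<delta>_def by (simp only: fls_deriv_sub fls_weier_deriv(1)[OF u0 uv(1)] fls_weier_deriv(1)[OF v0 uv(2)])
  have dB: "\<delta> * fls_deriv B = B * (\<delta> * (2 * g u * \<zeta> u + 2 * g v * \<zeta> v) + (2 * y v * g v - 2 * y u * g u))"
    unfolding B_def fls_deriv_mult fls_deriv.d_power2 sigma_deriv[OF u0 uv(1)] sigma_deriv[OF v0 uv(2)] d\<delta>
    by (simp only: ring_distribs power2_eq_square mult_ac add_ac)
  have dA': "\<delta> * fls_deriv A = A * (\<delta> * (2 * g u * \<zeta> u + 2 * g v * \<zeta> v) + (2 * y v * g v - 2 * y u * g u))"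
  proof -
    have "\<delta> * (g ?s * \<zeta> ?s + g ?d * \<zeta> ?d)
      = \<delta> * (2 * g u * \<zeta> u + 2 * g v * \<zeta> v) + (2 * y v * g v - 2 * y u * g u)"
    proof -
      \<comment> \<open>\<open>D\<close>, \<open>e\<close>, \<open>f\<close> stand for
        \<open>x v - x u\<close>, \<open>y u\<close>, \<open>y v\<close>; the last bracket on the
        right becomes the derivative of \<open>D\<close>.\<close>
      have gen: "D * ((a + b) * (m + n + (f - e) / D) + (a - b) * (m - n + (- f - e) / D))
        = D * (2 * a * m + 2 * b * n) + (2 * f * b - 2 * e * a)" if "D \<noteq> 0" for D a b m n e f :: "'k fls"
        using that by (simp add: divide_simps) (simp add: algebra_simps)
      show ?thesis unfolding gs gd zs zd by (rule gen[OF \<delta>])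
    qed
    thus ?thesis unfolding dA by (simp only: mult.left_commute)
  qed
  have "fls_deriv (A / B) = (fls_deriv A * B - A * fls_deriv B) / B ^ 2" by (rule fls_deriv.d_divide[OF B0])
  also have "fls_deriv A * B - A * fls_deriv B = 0"
  proof -
    have "\<delta> * (fls_deriv A * B - A * fls_deriv B) = (\<delta> * fls_deriv A) * B - A * (\<delta> * fls_deriv B)"
      by (simp add: algebra_simps)
    also have "\<dots> = 0" unfolding dA' dB by (simp add: mult_ac)
    finally show ?thesis using \<delta> by simp
  qed
  finally have "fls_deriv (A / B) = 0" by simp
  then obtain k where "A / B = fls_const k" using fls_deriv_eq_0_iff by blast
  hence AB: "A = fls_const k * B" using B0 by (simp add: field_simps)
  let ?wu = "weier_w a4 a6 oo u" and ?wv = "weier_w a4 a6 oo v"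
  have "fps_to_fls ?wu \<noteq> 0" "fps_to_fls ?wv \<noteq> 0"
    using weier_w_compose_nonzero u0 v0 uv by auto
  hence "\<delta> * (fps_to_fls ?wu * fps_to_fls ?wv) = fps_to_fls v * fps_to_fls ?wu - fps_to_fls u * fps_to_fls ?wv"
    unfolding \<delta>_def by (simp add: field_simps)
  hence "A * (fps_to_fls ?wu * fps_to_fls ?wv) = fls_const k *
    (S u ^ 2 * S v ^ 2 * (fps_to_fls v * fps_to_fls ?wu - fps_to_fls u * fps_to_fls ?wv))"
    unfolding AB B_def by (simp only: mult.assoc)
  hence eq: "(\<sigma> oo ?s) * (\<sigma> oo ?d) * (?wu * ?wv) = fps_const k * ((\<sigma> oo u) ^ 2 * (\<sigma> oo v) ^ 2 * (v * ?wu - u * ?wv))"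
    unfolding A_def
    by (simp flip: fls_times_fps_to_fls fps_to_fls_power fps_const_to_fls fps_to_fls_minus)
  have lu: "fps_lead 1 \<alpha> u" and lv: "fps_lead 1 \<beta> v" by (rule fps_lead_1I[OF u0 u1], rule fps_lead_1I[OF v0 v1])
  have ls: "fps_lead 1 (\<alpha> + \<beta>) ?s" and ld: "fps_lead 1 (\<alpha> - \<beta>) ?d"
    using fps_lead_1I[OF s0(1) formal_sum_nth_1[OF u0 v0]] fps_lead_1I[OF d0(1) formal_sum_nth_1[OF u0 vm(1)]]
    unfolding fps_neg_nth u1 v1 by simp_all
  note lc = fps_lead_compose_1[OF sg0 sg1]
  \<comment> \<open>\<open>\<sigma>\<close> has order 1 and \<open>w\<close> has order 3, so both
    sides start in degree 8; the hypotheses on \<open>\<alpha>\<close> and \<open>\<beta>\<close>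
    make the common coefficient nonzero.\<close>
  have "fps_lead (1 + 1 + (3 + 3)) ((\<alpha> + \<beta>) * (\<alpha> - \<beta>) * (\<alpha> ^ 3 * \<beta> ^ 3)) ((\<sigma> oo ?s) * (\<sigma> oo ?d) * (?wu * ?wv))"
    by (intro fps_lead_mult lc fps_lead_weier_w ls ld lu lv s0 d0 u0 v0)
  from fps_lead_nth[OF this]
  have c1: "fps_nth ((\<sigma> oo ?s) * (\<sigma> oo ?d) * (?wu * ?wv)) 8 = (\<alpha> + \<beta>) * (\<alpha> - \<beta>) * (\<alpha> ^ 3 * \<beta> ^ 3)" by simp
  have "fps_lead ((1 + 1) + (1 + 1) + (1 + 3)) (\<alpha> ^ 2 * \<beta> ^ 2 * (\<beta> * \<alpha> ^ 3 - \<alpha> * \<beta> ^ 3))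
    ((\<sigma> oo u) ^ 2 * (\<sigma> oo v) ^ 2 * (v * ?wu - u * ?wv))"
    by (intro fps_lead_mult fps_lead_diff fps_lead_power2 lc fps_lead_weier_w lu lv u0 v0)
  from fps_lead_nth[OF this]
  have c2: "fps_nth ((\<sigma> oo u) ^ 2 * (\<sigma> oo v) ^ 2 * (v * ?wu - u * ?wv)) 8 = \<alpha> ^ 2 * \<beta> ^ 2 * (\<beta> * \<alpha> ^ 3 - \<alpha> * \<beta> ^ 3)" by simp
  define C where "C = (\<alpha> + \<beta>) * (\<alpha> - \<beta>) * (\<alpha> ^ 3 * \<beta> ^ 3)"
  have "C \<noteq> 0" using ab by (simp add: C_def eq_neg_iff_add_eq_0)
  moreover have "C = k * C"
  proof -
    have "\<alpha> ^ 2 * \<beta> ^ 2 * (\<beta> * \<alpha> ^ 3 - \<alpha> * \<beta> ^ 3) = C" unfolding C_def by Groebner_Basis.algebra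
    thus ?thesis using arg_cong[OF eq, of "\<lambda>f. fps_nth f 8"] c1 c2 by (simp add: C_def)
  qed
  ultimately have "k = 1" by simp
  thus ?thesis using eq by simp
qed

end

theorem sigma_identity:
  fixes a4 a6 c :: "'a :: {idom, ring_char_0}" and \<sigma> q :: "'a fps"
  assumes odd: "odd_with_lead_t \<sigma>"
    and q: "q = weier_J a4 a6 * fps_deriv \<sigma>"
    and ode: "weier_J a4 a6 * weier_w a4 a6 * (fps_deriv q * \<sigma> - q * fps_deriv \<sigma>)
      = (fps_const c * weier_w a4 a6 - fps_X) * \<sigma> ^ 2"
    and ab: "\<alpha> \<noteq> 0" "\<beta> \<noteq> 0" "\<alpha> \<noteq> \<beta>" "\<alpha> \<noteq> - \<beta>"
  defines "u \<equiv> fps_const \<alpha> * fps_X" and "v \<equiv> fps_const \<beta> * fps_X"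
  shows "(\<sigma> oo formal_sum a4 a6 u v) * (\<sigma> oo formal_sum a4 a6 u (- v)) * ((weier_w a4 a6 oo u) * (weier_w a4 a6 oo v))
    = (\<sigma> oo u) ^ 2 * (\<sigma> oo v) ^ 2 * (v * (weier_w a4 a6 oo u) - u * (weier_w a4 a6 oo v))"
proof -
  let ?f = "to_fract :: 'a \<Rightarrow> 'a fract" let ?h = "fps_map_coeffs ?f"
  note hf = comm_ring_hom_to_fract[where 'a = 'a]
  interpret f: comm_ring_hom ?f by (rule hf)
  interpret h: comm_ring_hom ?h by (rule comm_ring_hom_fps_map_coeffs[OF hf])
  have inj: "?h f = ?h g \<Longrightarrow> f = g" for f g by (simp add: fps_eq_iff)
  note maps = h.hom_mult h.hom_minus h.hom_power h.hom_uminus fps_map_coeffs_compose[OF hf] fps_map_coeffs_weier_w[OF hf]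
    fps_map_coeffs_weier_J[OF hf] fps_map_coeffs_deriv[OF hf] fps_map_coeffs_X[OF hf] fps_map_coeffs_const[OF hf]
  have u0: "fps_nth u 0 = 0" "fps_nth v 0 = 0" "fps_nth (- v) 0 = 0" by (simp_all add: u_def v_def)
  have su: "?h u = fps_const (?f \<alpha>) * fps_X" "?h v = fps_const (?f \<beta>) * fps_X"
    by (simp_all add: u_def v_def maps)
  have "(?h \<sigma> oo formal_sum (?f a4) (?f a6) (?h u) (?h v)) * (?h \<sigma> oo formal_sum (?f a4) (?f a6) (?h u) (- ?h v))
      * ((weier_w (?f a4) (?f a6) oo ?h u) * (weier_w (?f a4) (?f a6) oo ?h v))
    = (?h \<sigma> oo ?h u) ^ 2 * (?h \<sigma> oo ?h v) ^ 2
      * (?h v * (weier_w (?f a4) (?f a6) oo ?h u) - ?h u * (weier_w (?f a4) (?f a6) oo ?h v))"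
    unfolding su
  proof (rule sigma_identity_field)
    show "?h \<sigma> oo - fps_X = - ?h \<sigma>"
      using arg_cong[of _ _ ?h, OF conjunct1[OF odd[unfolded odd_with_lead_t_def]]] by (simp add: maps)
    show "fps_nth (?h \<sigma>) 0 = 0" "fps_nth (?h \<sigma>) 1 = 1" using odd by (simp_all add: odd_with_lead_t_def)
    show "?h q = weier_J (?f a4) (?f a6) * fps_deriv (?h \<sigma>)" by (simp add: q maps)
    show "weier_J (?f a4) (?f a6) * weier_w (?f a4) (?f a6) * (fps_deriv (?h q) * ?h \<sigma> - ?h q * fps_deriv (?h \<sigma>))
      = (fps_const (?f c) * weier_w (?f a4) (?f a6) - fps_X) * ?h \<sigma> ^ 2"
      using arg_cong[OF ode, of ?h] by (simp only: maps)
    show "?f \<alpha> \<noteq> 0" "?f \<beta> \<noteq> 0" "?f \<alpha> \<noteq> ?f \<beta>" using ab by simp_all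
    show "?f \<alpha> \<noteq> - ?f \<beta>" using ab by (simp flip: to_fract_uminus)
  qed
  thus ?thesis
    by (intro inj) (simp only: maps fps_map_coeffs_formal_sum[OF hf u0(1,2)] fps_map_coeffs_formal_sum[OF hf u0(1,3)])
qed

section \<open>Evaluation of power series over a complete discrete valuation ring\<close>

locale cdvr =
  fixes v :: "'a :: idom fract \<Rightarrow> int"
  assumes cdvr: "complete_dvr v"
begin

definition V :: "'a \<Rightarrow> int" where "V x = v (to_fract x)"

lemma v_mult: "x \<noteq> 0 \<Longrightarrow> y \<noteq> 0 \<Longrightarrow> v (x * y) = v x + v y"
  using cdvr unfolding complete_dvr_def discrete_valuation_def by blast

lemma v_add: "x \<noteq> 0 \<Longrightarrow> y \<noteq> 0 \<Longrightarrow> x + y \<noteq> 0 \<Longrightarrow> v (x + y) \<ge> min (v x) (v y)"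
  using cdvr unfolding complete_dvr_def discrete_valuation_def by blast

lemma range_to_fract: "range (to_fract :: 'a \<Rightarrow> 'a fract) = {x. val_ge v 0 x}"
  using cdvr unfolding complete_dvr_def by blast

lemma v_one: "v 1 = 0" using v_mult[of 1 1] by simp

lemma v_uminus: "x \<noteq> 0 \<Longrightarrow> v (- x) = v x"
  using v_mult[of "-1" "-1"] v_mult[of "-1" x] v_one by simp

lemma val_ge_add: "val_ge v k x \<Longrightarrow> val_ge v k y \<Longrightarrow> val_ge v k (x + y)"
  unfolding val_ge_def using v_add[of x y] by (cases "x = 0 \<or> y = 0 \<or> x + y = 0") auto

lemma val_ge_diff:
  assumes "val_ge v k x" "val_ge v k y" shows "val_ge v k (x - y)"
proof -
  have "val_ge v k (- y)" using assms(2) v_uminus[of y] by (cases "y = 0") (auto simp: val_ge_def)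
  from val_ge_add[OF assms(1) this] show ?thesis by simp
qed

lemma V_mult: "x \<noteq> 0 \<Longrightarrow> y \<noteq> 0 \<Longrightarrow> V (x * y) = V x + V y"
  by (simp add: V_def v_mult)

lemma V_nonneg: "x \<noteq> 0 \<Longrightarrow> V x \<ge> 0"
  using range_to_fract by (auto simp: V_def val_ge_def set_eq_iff) (metis rangeI to_fract_eq_0_iff)

lemma V_one: "V 1 = 0" by (simp add: V_def v_one)

lemma V_power: "x \<noteq> 0 \<Longrightarrow> V (x ^ n) = int n * V x"
  by (induction n) (auto simp: V_one V_mult algebra_simps)

lemma dvd_iff_val_ge:
  assumes "d \<noteq> 0" shows "d dvd x \<longleftrightarrow> val_ge v (V d) (to_fract x)"
proof
  assume "d dvd x"
  then obtain y where "x = d * y" by (elim dvdE)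
  thus "val_ge v (V d) (to_fract x)"
    using assms V_mult[of d y] V_nonneg[of y] by (cases "y = 0") (auto simp: val_ge_def V_def)
next
  assume ge: "val_ge v (V d) (to_fract x)"
  show "d dvd x"
  proof (cases "x = 0")
    case False
    let ?q = "to_fract x / to_fract d"
    have "v (?q * to_fract d) = v ?q + v (to_fract d)" using assms False by (intro v_mult) auto
    hence "v ?q \<ge> 0" using ge False assms by (auto simp: val_ge_def V_def)
    hence "?q \<in> range to_fract" unfolding range_to_fract by (simp add: val_ge_def)
    then obtain y where "to_fract y = ?q" by auto
    hence "to_fract x = to_fract (d * y)" using assms by (simp add: field_simps)
    thus ?thesis unfolding to_fract_eq_iff by simp
  qed simp
qed

lemma dvd_iff_V: "d \<noteq> 0 \<Longrightarrow> x \<noteq> 0 \<Longrightarrow> d dvd x \<longleftrightarrow> V d \<le> V x"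
  by (simp add: dvd_iff_val_ge val_ge_def V_def)

lemma max_ideal_iff: "x \<in> max_ideal \<longleftrightarrow> x = 0 \<or> V x \<ge> 1"
  using dvd_iff_V[of x 1] V_one V_nonneg[of x] by (cases "x = 0") (auto simp: max_ideal_def)

lemma uniformizer_exists: "\<exists>\<pi>. \<pi> \<noteq> 0 \<and> V \<pi> = 1"
proof -
  have "1 \<in> v ` {x. x \<noteq> 0}" using cdvr unfolding complete_dvr_def discrete_valuation_def by auto
  then obtain x where x: "x \<noteq> 0" "v x = 1" by auto
  hence "x \<in> range to_fract" unfolding range_to_fract by (simp add: val_ge_def)
  thus ?thesis using x by (auto simp: V_def)
qed

definition \<pi> :: 'a where "\<pi> = (SOME \<pi>. \<pi> \<noteq> 0 \<and> V \<pi> = 1)"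

lemma pi_nonzero: "\<pi> \<noteq> 0" and V_pi: "V \<pi> = 1"
  using someI_ex[OF uniformizer_exists, folded \<pi>_def] by auto

lemma max_ideal_iff_pi: "x \<in> max_ideal \<longleftrightarrow> \<pi> dvd x"
  using dvd_iff_V[OF pi_nonzero, of x] V_pi by (cases "x = 0") (auto simp: max_ideal_iff)

lemma pi_in_max_ideal: "\<pi> \<in> max_ideal" by (simp add: max_ideal_iff_pi)

lemma
  fixes x y :: 'a
  shows max_ideal_add: "x \<in> max_ideal \<Longrightarrow> y \<in> max_ideal \<Longrightarrow> x + y \<in> max_ideal"
  and max_ideal_diff: "x \<in> max_ideal \<Longrightarrow> y \<in> max_ideal \<Longrightarrow> x - y \<in> max_ideal"
  and max_ideal_uminus: "x \<in> max_ideal \<Longrightarrow> - x \<in> max_ideal"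
  and max_ideal_mult: "x \<in> max_ideal \<Longrightarrow> x * y \<in> max_ideal"
  and max_ideal_mult': "x \<in> max_ideal \<Longrightarrow> y * x \<in> max_ideal"
  by (auto simp: max_ideal_iff_pi)

lemma zero_in_max_ideal: "0 \<in> (max_ideal :: 'a set)" by (simp add: max_ideal_iff)

lemma one_notin_max_ideal: "(1 :: 'a) \<notin> max_ideal" by (simp add: max_ideal_def)

lemma max_ideal_prime:
  assumes "x * y \<in> max_ideal" shows "x \<in> max_ideal \<or> (y :: 'a) \<in> max_ideal"
  using assms by (auto simp: max_ideal_def is_unit_mult_iff)

lemma one_minus_max_ideal_nonzero: "x \<in> max_ideal \<Longrightarrow> 1 - x \<noteq> (0 :: 'a)"
  using one_notin_max_ideal by auto

lemma max_ideal_separated: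
  fixes z :: 'a
  assumes "z \<in> max_ideal" "\<And>n. z ^ n dvd x" shows "x = 0"
proof (rule ccontr)
  assume x: "x \<noteq> 0"
  hence z: "z \<noteq> 0" using assms(2)[of 1] by auto
  hence V: "V z \<ge> 1" using assms(1) by (simp add: max_ideal_iff)
  define n where "n = Suc (nat (V x))"
  have "V (z ^ n) \<le> V x" using assms(2)[of n] dvd_iff_V x z by simp
  moreover have "int n * 1 \<le> int n * V z" using V by (intro mult_left_mono) auto
  ultimately have "int n \<le> V x" using V_power[OF z, of n] by linarith
  thus False using V_nonneg[OF x] by (simp add: n_def)
qed

text \<open>Completeness expressed by divisibility, so that it serves both for values of power
  series and for the extension of \<open>\<rho>\<close> to the completion.\<close>

lemma adic_limit:
  fixes s :: "nat \<Rightarrow> 'a" and z :: 'a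
  assumes z: "z \<in> max_ideal" and s: "\<And>n. z ^ n dvd s (Suc n) - s n"
  shows "\<exists>l. \<forall>n. z ^ n dvd l - s n"
proof -
  have mono: "z ^ n dvd s (n + k) - s n" for n k
  proof (induction k)
    case (Suc k)
    have "z ^ n dvd s (Suc (n + k)) - s (n + k)"
      using s[of "n + k"] le_imp_power_dvd[of n "n + k" z] dvd_trans by auto
    from dvd_add[OF this Suc] show ?case by simp
  qed simp
  show ?thesis
  proof (cases "z = 0")
    \<comment> \<open>This occurs, for instance, when \<open>z\<close> is the image of
      \<open>p\<close> and the ring has characteristic \<open>p\<close>. The sequence is then
      constant from index 1 on, and \<open>z ^ 0 = 1\<close> imposes nothing at index 0.\<close>
    case True
    have "z ^ n dvd s 1 - s n" for n
    proof (cases n)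
      case (Suc m)
      hence "s n - s 1 = 0" using mono[of 1 m] True by simp
      thus ?thesis by simp
    qed simp
    thus ?thesis by blast
  next
    case False
    have V: "V z \<ge> 1" using z False by (simp add: max_ideal_iff)
    have Vn: "V (z ^ n) \<ge> int n" for n
      using V mult_left_mono[of 1 "V z" "int n"] by (simp add: V_power[OF False])
    have ge: "val_ge v (int n) (to_fract (s m) - to_fract (s n))" if "m \<ge> n" for m n
      using mono[of n "m - n"] that Vn[of n] dvd_iff_val_ge[of "z ^ n"] False
      by (auto simp: val_ge_def)
    have "val_Cauchy v (\<lambda>n. to_fract (s n))"
      unfolding val_Cauchy_def
    proof (intro allI exI impI)
      fix k m n assume mn: "m \<ge> nat k" "n \<ge> nat k"
      have "val_ge v (int (nat k)) ((to_fract (s m) - to_fract (s (nat k))) - (to_fract (s n) - to_fract (s (nat k))))"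
        by (intro val_ge_diff ge mn)
      thus "val_ge v k (to_fract (s m) - to_fract (s n))" by (auto simp: val_ge_def split: if_splits)
    qed
    then obtain l where l: "val_tendsto v (\<lambda>n. to_fract (s n)) (to_fract l)"
      using cdvr unfolding complete_dvr_def by blast
    have "z ^ n dvd l - s n" for n
    proof -
      obtain N where N: "\<And>m. m \<ge> N \<Longrightarrow> val_ge v (V (z ^ n)) (to_fract (s m) - to_fract l)"
        using l unfolding val_tendsto_def by blast
      have "z ^ n dvd s (n + N) - l"
        using N[of "n + N"] dvd_iff_val_ge[of "z ^ n"] False by simp
      hence "z ^ n dvd (s (n + N) - s n) - (s (n + N) - l)" using mono dvd_diff by blast
      thus ?thesis by simp
    qed
    thus ?thesis by blast
  qed
qed

text \<open>The value of \<open>f\<close> at \<open>z\<close> is the remainder of \<open>f\<close> modulo \<open>X - z\<close>, which makes multiplicativity and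
  compatibility with composition immediate.\<close>

definition fev :: "'a \<Rightarrow> 'a fps \<Rightarrow> 'a" where
  "fev z f = (THE c. (fps_X - fps_const z) dvd f - fps_const c)"

lemma partial_sums_limit:
  fixes z :: 'a
  assumes "z \<in> max_ideal"
  shows "\<exists>l. \<forall>n. z ^ n dvd l - (\<Sum>i<n. fps_nth f i * z ^ i)"
  by (rule adic_limit[OF assms]) simp

text \<open>Synthetic division: if \<open>E k\<close> is the value at \<open>z\<close> of
  \<open>f\<close> shifted by \<open>k\<close>, then \<open>E k = f_k + z * E (k + 1)\<close>, so
  the quotient of \<open>f - E 0\<close> by \<open>X - z\<close> has the coefficients
  \<open>E (k + 1)\<close>.\<close>

lemma fev_dvd_exists:
  fixes z :: 'a
  assumes z: "z \<in> max_ideal" and E0: "\<And>n. z ^ n dvd c - (\<Sum>i<n. fps_nth f i * z ^ i)"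
  shows "(fps_X - fps_const z) dvd f - fps_const c"
proof -
  have "\<exists>l. \<forall>n. z ^ n dvd l - (\<Sum>i<n. fps_nth (fps_shift k f) i * z ^ i)" for k
    by (rule partial_sums_limit[OF z])
  then obtain E where E: "\<And>k n. z ^ n dvd E k - (\<Sum>i<n. fps_nth f (i + k) * z ^ i)" by (auto simp: fps_shift_def) metis
  have rec: "E k = fps_nth f k + z * E (Suc k)" for k
  proof -
    have "z ^ n dvd E k - (fps_nth f k + z * E (Suc k))" for n
    proof -
      have "z ^ n dvd E k - (\<Sum>i<Suc n. fps_nth f (i + k) * z ^ i)"
        using E[where k = k and n = "Suc n"] by (metis dvd_trans le_SucI le_imp_power_dvd order_refl)
      moreover have "z ^ n dvd z * (E (Suc k) - (\<Sum>i<n. fps_nth f (i + Suc k) * z ^ i))"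
        using E[where k = "Suc k" and n = n] by (rule dvd_mult)
      ultimately have "z ^ n dvd (E k - (\<Sum>i<Suc n. fps_nth f (i + k) * z ^ i)) -
        z * (E (Suc k) - (\<Sum>i<n. fps_nth f (i + Suc k) * z ^ i))" by (rule dvd_diff)
      also have "\<dots> = E k - (fps_nth f k + z * E (Suc k))"
        by (subst sum.lessThan_Suc_shift) (simp add: sum_distrib_left algebra_simps)
      finally show ?thesis .
    qed
    from max_ideal_separated[OF z this] show ?thesis by simp
  qed
  have cE: "c = E 0"
  proof -
    have "z ^ n dvd c - E 0" for n
      using dvd_diff[OF E0[of n] E[where k = 0 and n = n]] by simp
    from max_ideal_separated[OF z this] show ?thesis by simp
  qed
  have "f - fps_const c = (fps_X - fps_const z) * Abs_fps (\<lambda>k. E (Suc k))"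
  proof (rule fps_ext)
    fix n
    show "fps_nth (f - fps_const c) n = fps_nth ((fps_X - fps_const z) * Abs_fps (\<lambda>k. E (Suc k))) n"
      using rec[of n] cE by (cases n) (simp_all add: algebra_simps)
  qed
  thus ?thesis by simp
qed

text \<open>If \<open>X - z\<close> divides the constant \<open>c - d\<close>, each coefficient of
  the quotient is \<open>z\<close> times the next one, so \<open>c - d\<close> is divisible by every
  power of \<open>z\<close>.\<close>

lemma fev_dvd_unique:
  fixes z :: 'a
  assumes z: "z \<in> max_ideal" and "(fps_X - fps_const z) dvd f - fps_const c" "(fps_X - fps_const z) dvd f - fps_const d"
  shows "c = d"
proof -
  have "(fps_X - fps_const z) dvd (f - fps_const d) - (f - fps_const c)" by (rule dvd_diff[OF assms(3,2)])
  hence "(fps_X - fps_const z) dvd fps_const (c - d)" by (simp flip: fps_const_sub)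
  then obtain q where q: "fps_const (c - d) = (fps_X - fps_const z) * q" by (elim dvdE)
  have q0: "c - d = - z * fps_nth q 0" using arg_cong[OF q, of "\<lambda>f. fps_nth f 0"] by (simp add: algebra_simps)
  have qs: "fps_nth q n = z * fps_nth q (Suc n)" for n
    using arg_cong[OF q, of "\<lambda>f. fps_nth f (Suc n)"] by (simp add: algebra_simps)
  have "fps_nth q 0 = z ^ n * fps_nth q n" for n
    by (induction n) (simp, subst (asm) qs, simp add: mult_ac)
  hence "z ^ n dvd c - d" for n unfolding q0 by (metis dvd_mult dvd_triv_left)
  from max_ideal_separated[OF z this] show ?thesis by simp
qed

lemma fev_dvd: assumes "z \<in> max_ideal" shows "(fps_X - fps_const z) dvd f - fps_const (fev z f)"
proof -
  obtain c where c: "(fps_X - fps_const z) dvd f - fps_const c"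
    using partial_sums_limit[OF assms] fev_dvd_exists[OF assms] by blast
  show ?thesis unfolding fev_def by (rule theI[where a = c], rule c) (rule fev_dvd_unique[OF assms _ c])
qed

lemma fev_eqI: "z \<in> max_ideal \<Longrightarrow> (fps_X - fps_const z) dvd f - fps_const c \<Longrightarrow> fev z f = c"
  using fev_dvd_unique fev_dvd by blast

lemma fev_const [simp]: "z \<in> max_ideal \<Longrightarrow> fev z (fps_const c) = c"
  by (rule fev_eqI) auto

lemma fev_X [simp]: "z \<in> max_ideal \<Longrightarrow> fev z fps_X = z"
  by (rule fev_eqI) auto

lemma comm_ring_hom_fev: assumes z: "z \<in> max_ideal" shows "comm_ring_hom (fev z)"
proof
  fix f g
  show "fev z (f + g) = fev z f + fev z g"
    using dvd_add[OF fev_dvd[OF z, of f] fev_dvd[OF z, of g]]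
    by (intro fev_eqI z) (simp add: algebra_simps flip: fps_const_add)
  show "fev z (f * g) = fev z f * fev z g"
    by (intro fev_eqI z) (use dvd_diff_mult[OF fev_dvd[OF z, of f] fev_dvd[OF z, of g]] in simp)
  show "fev z 1 = 1" "fev z 0 = 0" using fev_const[OF z, of 1] fev_const[OF z, of 0] by simp_all
qed

lemma fev_max_ideal:
  assumes z: "z \<in> max_ideal" and "fps_nth f 0 = 0" shows "fev z f \<in> max_ideal"
proof -
  interpret h: comm_ring_hom "fev z" by (rule comm_ring_hom_fev[OF z])
  obtain g where "f = fps_X * g" using assms(2) fps_X_dvd_iff by (metis dvdE)
  thus ?thesis using z by (simp add: h.hom_mult max_ideal_mult)
qed

lemma fev_compose:
  assumes z: "z \<in> max_ideal" and g: "fps_nth g 0 = 0"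
  shows "fev z (f oo g) = fev (fev z g) f"
proof (rule fev_eqI[OF z])
  interpret c: comm_ring_hom "\<lambda>f. f oo g" by (rule comm_ring_hom_fps_compose[OF g])
  obtain q where q: "f - fps_const (fev (fev z g) f) = (fps_X - fps_const (fev z g)) * q"
    using fev_dvd[OF fev_max_ideal[OF z g], of f] by (elim dvdE)
  have "(f oo g) - fps_const (fev (fev z g) f) = (g - fps_const (fev z g)) * (q oo g)"
    using arg_cong[OF q, of "\<lambda>f. f oo g"] g by (simp add: c.hom_minus c.hom_mult)
  thus "(fps_X - fps_const z) dvd (f oo g) - fps_const (fev (fev z g) f)"
    using fev_dvd[OF z, of g] by simp
qed

lemma fev_nth_0:
  assumes "z \<in> max_ideal" shows "\<exists>r. fev z f = fps_nth f 0 + z * r"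
proof -
  interpret h: comm_ring_hom "fev z" by (rule comm_ring_hom_fev[OF assms])
  have "fps_nth (f - fps_const (fps_nth f 0)) 0 = 0" by simp
  then obtain g where "f - fps_const (fps_nth f 0) = fps_X * g" using fps_X_dvd_iff by (metis dvdE)
  hence "f = fps_const (fps_nth f 0) + fps_X * g" by (simp add: algebra_simps)
  hence "fev z f = fev z (fps_const (fps_nth f 0) + fps_X * g)" by simp
  thus ?thesis using assms by (auto simp: h.hom_add h.hom_mult)
qed

text \<open>Write \<open>f = X ^ k * F\<close> with nonzero constant term of \<open>F\<close>. At a
  point \<open>z\<close> of larger valuation than that constant term, \<open>F\<close> cannot
  vanish.\<close>

lemma fev_identity_principle:
  assumes "\<And>z. z \<in> max_ideal \<Longrightarrow> z \<noteq> 0 \<Longrightarrow> fev z f = 0"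
  shows "f = 0"
proof (rule ccontr)
  assume "f \<noteq> 0"
  define k where "k = subdegree f"
  define F where "F = fps_shift k f"
  have f: "f = fps_X ^ k * F"
    using subdegree_decompose[of f] by (simp add: F_def k_def mult.commute)
  have F0: "fps_nth F 0 \<noteq> 0" using \<open>f \<noteq> 0\<close> by (simp add: F_def k_def)
  define z where "z = \<pi> ^ Suc (nat (V (fps_nth F 0)))"
  have z: "z \<in> max_ideal" "z \<noteq> 0" unfolding z_def using pi_in_max_ideal pi_nonzero by (auto simp: max_ideal_mult)
  interpret h: comm_ring_hom "fev z" by (rule comm_ring_hom_fev[OF z(1)])
  have "z ^ k * fev z F = 0" using assms[OF z] z(1) by (simp add: f h.hom_mult h.hom_power)
  hence "fev z F = 0" using z by simp
  then obtain r where "fps_nth F 0 = - (z * r)" using fev_nth_0[OF z(1), of F] by (auto simp: eq_neg_iff_add_eq_0)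
  hence "z dvd fps_nth F 0" by simp
  hence "V z \<le> V (fps_nth F 0)" using dvd_iff_V z F0 by simp
  moreover have "V z = int (Suc (nat (V (fps_nth F 0))))" unfolding z_def by (simp only: V_power[OF pi_nonzero] V_pi mult_1_right)
  ultimately show False using V_nonneg[OF F0] by simp
qed

lemma fps_eval_eq_fev:
  assumes z: "z \<in> max_ideal" shows "fps_eval v f (to_fract z) = to_fract (fev z f)"
proof -
  interpret tf: comm_ring_hom "to_fract :: 'a \<Rightarrow> 'a fract" by (rule comm_ring_hom_to_fract)
  obtain c where c: "\<And>n. z ^ n dvd c - (\<Sum>i<n. fps_nth f i * z ^ i)" using partial_sums_limit[OF z] by blast
  have cf: "c = fev z f" using fev_eqI[OF z fev_dvd_exists[OF z c]] by simp
  have sums: "(\<Sum>i<n. to_fract (fps_nth f i) * to_fract z ^ i) = to_fract (\<Sum>i<n. fps_nth f i * z ^ i)" for n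
    by (simp add: tf.hom_sum tf.hom_power)
  have lim: "val_tendsto v (\<lambda>n. \<Sum>i<n. to_fract (fps_nth f i) * to_fract z ^ i) (to_fract c)"
    unfolding val_tendsto_def sums
  proof (intro allI exI impI)
    fix k n assume n: "n \<ge> nat (max k 1)"
    have d: "z ^ n dvd (\<Sum>i<n. fps_nth f i * z ^ i) - c" using c[of n] by (metis dvd_minus_iff minus_diff_eq)
    show "val_ge v k (to_fract (\<Sum>i<n. fps_nth f i * z ^ i) - to_fract c)"
    proof (cases "z = 0")
      case True thus ?thesis using d n by (cases n) (auto simp: val_ge_def)
    next
      case False
      hence "V z \<ge> 1" using z by (simp add: max_ideal_iff)
      hence "V (z ^ n) \<ge> int n" using mult_left_mono[of 1 "V z" "int n"] by (simp add: V_power[OF False])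
      thus ?thesis using d n dvd_iff_val_ge[of "z ^ n"] False by (auto simp: val_ge_def)
    qed
  qed
  have "l = to_fract c" if l: "val_tendsto v (\<lambda>n. \<Sum>i<n. to_fract (fps_nth f i) * to_fract z ^ i) l" for l
  proof (rule ccontr)
    assume ne: "l \<noteq> to_fract c"
    define k where "k = v (to_fract c - l) + 1"
    obtain N where N: "\<And>n. n \<ge> N \<Longrightarrow> val_ge v k ((\<Sum>i<n. to_fract (fps_nth f i) * to_fract z ^ i) - l)"
      using l unfolding val_tendsto_def by blast
    obtain M where M: "\<And>n. n \<ge> M \<Longrightarrow> val_ge v k ((\<Sum>i<n. to_fract (fps_nth f i) * to_fract z ^ i) - to_fract c)"
      using lim unfolding val_tendsto_def by blast
    have "val_ge v k (to_fract c - l)"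
      using val_ge_diff[OF N[of "N + M"] M[of "N + M"]] by simp
    thus False using ne by (auto simp: val_ge_def k_def)
  qed
  thus ?thesis unfolding fps_eval_def cf[symmetric] using lim by (rule the_equality[rotated])
qed

end

section \<open>Points in the kernel of reduction\<close>

context cdvr
begin

definition wv :: "'a \<Rightarrow> 'a \<Rightarrow> 'a \<Rightarrow> 'a" where "wv a4 a6 z = fev z (weier_w a4 a6)"

definition pt :: "'a \<Rightarrow> 'a \<Rightarrow> 'a \<Rightarrow> 'a fract ec_point" where
  "pt a4 a6 z = Affine (to_fract z / to_fract (wv a4 a6 z)) (- 1 / to_fract (wv a4 a6 z))"

context
  fixes a4 a6 :: 'a
begin

lemma wv_max_ideal: "z \<in> max_ideal \<Longrightarrow> wv a4 a6 z \<in> max_ideal"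
  unfolding wv_def by (rule fev_max_ideal) auto

lemma wv_eqn:
  assumes "z \<in> max_ideal" shows "weier_eqn a4 a6 z (wv a4 a6 z)"
  using weier_eqn_hom[OF comm_ring_hom_fev weier_w_eqn, OF assms] assms by (simp add: wv_def)

lemma add_denom_nonzero:
  assumes "z2 \<in> max_ideal" "w1 \<in> max_ideal" "w2 \<in> max_ideal"
  shows "1 - a4 * z2 * (w1 + w2) - a6 * (w1 ^ 2 + w1 * w2 + w2 ^ 2) \<noteq> 0"
proof -
  have "a4 * z2 * (w1 + w2) + a6 * (w1 ^ 2 + w1 * w2 + w2 ^ 2) \<in> max_ideal"
    unfolding power2_eq_square
    by (intro max_ideal_add max_ideal_mult' assms)
  from one_minus_max_ideal_nonzero[OF this] show ?thesis by (simp add: algebra_simps)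
qed

text \<open>The cofactor of the difference in \<open>weier_eqn_diff\<close> is 1 modulo the maximal
  ideal. This identifies \<open>w\<close>-coordinates of actual points with values of the
  series.\<close>

lemma wv_unique:
  assumes "z \<in> max_ideal" "w \<in> max_ideal" "weier_eqn a4 a6 z w" shows "w = wv a4 a6 z"
  using weier_eqn_diff[OF assms(3) wv_eqn[OF assms(1)]] add_denom_nonzero[OF assms(1,2) wv_max_ideal[OF assms(1)]]
  by simp

lemma wv_nonzero: assumes "z \<in> max_ideal" "z \<noteq> 0" shows "wv a4 a6 z \<noteq> 0"
  using wv_eqn[OF assms(1)] assms(2) by (auto simp: weier_eqn_def)

lemma wv_uminus: assumes "z \<in> max_ideal" shows "wv a4 a6 (- z) = - wv a4 a6 z"
  using wv_unique[of "-z" "- wv a4 a6 z"] wv_eqn[OF assms] wv_max_ideal[OF assms] assms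
  by (simp add: weier_eqn_uminus max_ideal_uminus)

lemma ec_t_pt: assumes "z \<in> max_ideal" "z \<noteq> 0" shows "ec_t (pt a4 a6 z) = to_fract z"
  using wv_nonzero[OF assms] by (simp add: pt_def)

lemma ec_neg_pt: "z \<in> max_ideal \<Longrightarrow> ec_neg (pt a4 a6 z) = pt a4 a6 (- z)"
  by (simp add: pt_def wv_uminus)

text \<open>As \<open>Y\<close> is a unit, \<open>z = - X / Y\<close> and \<open>w = - Z / Y\<close>
  lie in the maximal ideal and satisfy the equation, so \<open>w\<close> is determined by
  \<open>z\<close>. Conversely \<open>z\<close> gives the primitive coordinates
  \<open>[z : - 1 : w]\<close>.\<close>

lemma kernel_of_reduction_eq:
  "kernel_of_reduction a4 a6 = insert Origin {pt a4 a6 z | z. z \<in> max_ideal \<and> z \<noteq> 0}"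
proof -
  have "\<exists>z. Affine (Fract X Z) (Fract Y Z) = pt a4 a6 z \<and> z \<in> max_ideal \<and> z \<noteq> 0"
    if *: "Z \<noteq> 0" "X \<in> max_ideal" "Y \<notin> max_ideal" "Z \<in> max_ideal"
      "on_curve (to_fract a4) (to_fract a6) (Affine (Fract X Z) (Fract Y Z))" for X Y Z
  proof -
    obtain Y' where Y': "Y * Y' = 1" using *(3) unfolding max_ideal_def by (auto elim!: dvdE)
    have F: "Fract A Z = to_fract A / to_fract Z" for A using *(1) by (simp add: to_fract_def)
    define z w where "z = - X * Y'" and "w = - Z * Y'"
    have zw: "z \<in> max_ideal" "w \<in> max_ideal"
      unfolding z_def w_def using * by (auto intro: max_ideal_mult max_ideal_uminus)
    have Y'0: "Y' \<noteq> 0" using Y' by auto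
    have w0: "w \<noteq> 0" using *(1) Y'0 by (simp add: w_def)
    have "to_fract (Y ^ 2 * Z) = to_fract (X ^ 3 + a4 * X * Z ^ 2 + a6 * Z ^ 3)"
    proof -
      have "(to_fract Y / to_fract Z) ^ 2 * to_fract Z ^ 3 = ((to_fract X / to_fract Z) ^ 3
        + to_fract a4 * (to_fract X / to_fract Z) + to_fract a6) * to_fract Z ^ 3"
        using *(5) by (simp add: F)
      also have "(to_fract Y / to_fract Z) ^ 2 * to_fract Z ^ 3 = to_fract Y ^ 2 * to_fract Z"
        using *(1) by (simp add: power2_eq_square power3_eq_cube)
      also have "((to_fract X / to_fract Z) ^ 3
        + to_fract a4 * (to_fract X / to_fract Z) + to_fract a6) * to_fract Z ^ 3 =
        to_fract X ^ 3 + to_fract a4 * to_fract X * to_fract Z ^ 2 + to_fract a6 * to_fract Z ^ 3"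
        using *(1) by (simp add: power2_eq_square power3_eq_cube field_simps)
      finally show ?thesis by (simp add: to_fract_power)
    qed
    hence c: "Y ^ 2 * Z = X ^ 3 + a4 * X * Z ^ 2 + a6 * Z ^ 3" by (simp only: to_fract_eq_iff)
    have "(- (Y' ^ 3)) * (Y ^ 2 * Z) = (- (Y' ^ 3)) * (X ^ 3 + a4 * X * Z ^ 2 + a6 * Z ^ 3)" by (simp only: c)
    also have "(- (Y' ^ 3)) * (Y ^ 2 * Z) = (Y * Y') ^ 2 * w" unfolding w_def by Groebner_Basis.algebra
    also have "(Y * Y') ^ 2 * w = w" by (simp add: Y')
    also have "(- (Y' ^ 3)) * (X ^ 3 + a4 * X * Z ^ 2 + a6 * Z ^ 3) = z ^ 3 + a4 * z * w ^ 2 + a6 * w ^ 3"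
      unfolding z_def w_def by Groebner_Basis.algebra
    finally have "w = z ^ 3 + a4 * z * w ^ 2 + a6 * w ^ 3" .
    hence e: "weier_eqn a4 a6 z w" by (simp add: weier_eqn_def)
    hence w: "w = wv a4 a6 z" by (rule wv_unique[OF zw])
    have "z \<noteq> 0"
    proof
      assume "z = 0"
      hence "w * (1 - a6 * w * w) = 0" using e by (simp add: weier_eqn_def power3_eq_cube algebra_simps)
      thus False using w0 one_minus_max_ideal_nonzero[OF max_ideal_mult'[OF zw(2), of "a6 * w"]] by simp
    qed
    moreover have "to_fract z / to_fract w = Fract X Z"
      unfolding F z_def w_def using Y'0 *(1) by simp
    moreover have "- 1 / to_fract w = Fract Y Z"
    proof -
      have "to_fract Y * to_fract Y' = 1" using Y' by (metis to_fract_1 to_fract_mult)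
      thus ?thesis unfolding F w_def using Y'0 *(1) by (simp add: field_simps)
    qed
    ultimately show ?thesis using zw unfolding pt_def w by metis
  qed
  moreover have "\<exists>X Y Z. pt a4 a6 z = Affine (Fract X Z) (Fract Y Z) \<and>
        Z \<noteq> 0 \<and> X \<in> max_ideal \<and> Y \<notin> max_ideal \<and> Z \<in> max_ideal \<and>
        on_curve (to_fract a4) (to_fract a6) (Affine (Fract X Z) (Fract Y Z))"
    if z: "z \<in> max_ideal" "z \<noteq> 0" for z
  proof (intro exI conjI)
    let ?w = "wv a4 a6 z" let ?tw = "to_fract ?w"
    have w: "?w \<noteq> 0" by (rule wv_nonzero[OF z])
    have F: "Fract A ?w = to_fract A / to_fract ?w" for A using w by (simp add: to_fract_def)
    show "pt a4 a6 z = Affine (Fract z ?w) (Fract (- 1) ?w)" by (simp add: pt_def F)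
    show "?w \<noteq> 0" "z \<in> max_ideal" "?w \<in> max_ideal" by (fact w, fact z(1), rule wv_max_ideal[OF z(1)])
    show "(- 1 :: 'a) \<notin> max_ideal" by (simp add: max_ideal_def)
    have e: "?tw = to_fract z ^ 3 + to_fract a4 * to_fract z * ?tw ^ 2 + to_fract a6 * ?tw ^ 3"
      using weier_eqn_hom[OF comm_ring_hom_to_fract wv_eqn[OF z(1)]] by (simp add: weier_eqn_def)
    have "?tw / ?tw ^ 3 = (to_fract z ^ 3 + to_fract a4 * to_fract z * ?tw ^ 2 + to_fract a6 * ?tw ^ 3) / ?tw ^ 3"
      using e by simp
    also have "\<dots> = (to_fract z / ?tw) ^ 3 + to_fract a4 * (to_fract z / ?tw) + to_fract a6"
      using w by (simp add: add_divide_distrib power_divide power2_eq_square power3_eq_cube)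
    also have "?tw / ?tw ^ 3 = (- 1 / ?tw) ^ 2" using w by (simp add: power2_eq_square power3_eq_cube)
    finally show "on_curve (to_fract a4) (to_fract a6) (Affine (Fract z ?w) (Fract (- 1) ?w))"
      by (simp add: F)
  qed
  ultimately show ?thesis unfolding kernel_of_reduction_def by blast
qed

lemma pt_inj: assumes "z \<in> max_ideal" "z \<noteq> 0" "z' \<in> max_ideal" "z' \<noteq> 0"
  shows "pt a4 a6 z = pt a4 a6 z' \<longleftrightarrow> z = z'"
  using ec_t_pt assms by (metis to_fract_eq_iff)

lemma ec_add_pt:
  assumes z: "z1 \<in> max_ideal" "z1 \<noteq> 0" "z2 \<in> max_ideal" "z2 \<noteq> 0" "z1 \<noteq> z2" "z1 \<noteq> - z2"
    and lt: "l \<in> max_ideal" "t \<in> max_ideal"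
    and ar: "add_rel a4 a6 z1 (wv a4 a6 z1) z2 (wv a4 a6 z2) l t"
  shows "ec_add (to_fract a4) (pt a4 a6 z1) (pt a4 a6 z2) = pt a4 a6 t" "t \<noteq> 0"
proof -
  let ?w1 = "wv a4 a6 z1" and ?w2 = "wv a4 a6 z2" and ?f = "to_fract :: 'a \<Rightarrow> 'a fract"
  define w3 where "w3 = l * t - (?w1 - l * z1)"
  note e = wv_eqn[OF z(1)] wv_eqn[OF z(3)]
  note w = wv_nonzero[OF z(1,2)] wv_nonzero[OF z(3,4)]
  have D: "1 - a4 * z2 * (?w1 + ?w2) - a6 * (?w1 ^ 2 + ?w1 * ?w2 + ?w2 ^ 2) \<noteq> 0"
    by (intro add_denom_nonzero z wv_max_ideal)
  have M: "1 + a4 * l ^ 2 + a6 * l ^ 3 \<noteq> 0"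
  proof -
    have "- (a4 * l ^ 2 + a6 * l ^ 3) \<in> max_ideal" unfolding power2_eq_square power3_eq_cube
      by (intro max_ideal_uminus max_ideal_add max_ideal_mult' lt)
    from one_minus_max_ideal_nonzero[OF this] show ?thesis by (simp add: algebra_simps)
  qed
  have "z1 * ?w2 \<noteq> z2 * ?w1" using weier_same_x[OF e w] z by blast
  hence gen: "?f z1 * ?f ?w2 \<noteq> ?f z2 * ?f ?w1" by (simp flip: to_fract_mult)
  interpret f: comm_ring_hom ?f by (rule comm_ring_hom_to_fract)
  have D': "1 - ?f a4 * ?f z2 * (?f ?w1 + ?f ?w2) - ?f a6 * (?f ?w1 ^ 2 + ?f ?w1 * ?f ?w2 + ?f ?w2 ^ 2) \<noteq> 0"
  proof -
    have "?f (1 - a4 * z2 * (?w1 + ?w2) - a6 * (?w1 ^ 2 + ?w1 * ?w2 + ?w2 ^ 2)) \<noteq> 0" using D by (simp only: to_fract_eq_0_iff not_False_eq_True)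
    thus ?thesis by (simp only: f.hom_minus f.hom_add f.hom_mult f.hom_power f.hom_one not_False_eq_True)
  qed
  have M': "1 + ?f a4 * ?f l ^ 2 + ?f a6 * ?f l ^ 3 \<noteq> 0"
  proof -
    have "?f (1 + a4 * l ^ 2 + a6 * l ^ 3) \<noteq> 0" using M by (simp only: to_fract_eq_0_iff not_False_eq_True)
    thus ?thesis by (simp only: f.hom_minus f.hom_add f.hom_mult f.hom_power f.hom_one not_False_eq_True)
  qed
  have ws: "?f w3 = ?f l * ?f t - (?f ?w1 - ?f l * ?f z1)" by (simp add: w3_def)
  note * = ec_add_of_add_rel[OF weier_eqn_hom[OF comm_ring_hom_to_fract e(1)] weier_eqn_hom[OF comm_ring_hom_to_fract e(2)]
    add_rel_hom[OF comm_ring_hom_to_fract ar] D' M' _ _ disjI1[OF gen], folded ws]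
  have "weier_eqn a4 a6 t w3" unfolding w3_def
    by (rule add_rel_weier_eqn[OF e(1) ar add_rel_line[OF e ar D]])
  moreover have "w3 \<in> max_ideal" unfolding w3_def
    by (intro max_ideal_diff max_ideal_mult lt wv_max_ideal z)
  ultimately have w3: "w3 = wv a4 a6 t" using wv_unique lt by blast
  have w30: "w3 \<noteq> 0" using *(1) w by simp
  show "t \<noteq> 0"
  proof
    assume "t = 0"
    hence "weier_eqn a4 a6 t 0" by (simp add: weier_eqn_def)
    hence "w3 = 0" using wv_unique[OF lt(2) zero_in_max_ideal] w3 by simp
    thus False using w30 by simp
  qed
  show "ec_add (to_fract a4) (pt a4 a6 z1) (pt a4 a6 z2) = pt a4 a6 t"
    unfolding pt_def w3[symmetric] using *(2) w by simp
qed

lemma fev_weier_w_compose: "z \<in> max_ideal \<Longrightarrow> fps_nth u1 0 = 0 \<Longrightarrow> fev z (weier_w a4 a6 oo u1) = wv a4 a6 (fev z u1)"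
  by (simp add: fev_compose wv_def)

lemma ec_add_pt_fev:
  assumes z: "z \<in> max_ideal" and uv: "fps_nth u1 0 = 0" "fps_nth u2 0 = 0"
    and ne: "fev z u1 \<noteq> 0" "fev z u2 \<noteq> 0" "fev z u1 \<noteq> fev z u2" "fev z u1 \<noteq> - fev z u2"
  shows "ec_add (to_fract a4) (pt a4 a6 (fev z u1)) (pt a4 a6 (fev z u2)) = pt a4 a6 (fev z (formal_sum a4 a6 u1 u2))"
    "fev z (formal_sum a4 a6 u1 u2) \<noteq> 0"
proof -
  obtain l where l: "fps_nth l 0 = 0" "fps_add_rel a4 a6 u1 u2 l (formal_sum a4 a6 u1 u2)"
    using formal_sum_add_rel[OF uv] by blast
  have ar: "add_rel a4 a6 (fev z u1) (wv a4 a6 (fev z u1)) (fev z u2) (wv a4 a6 (fev z u2)) (fev z l)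
    (fev z (formal_sum a4 a6 u1 u2))"
    using add_rel_hom[OF comm_ring_hom_fev[OF z] l(2)] z uv by (simp add: fev_weier_w_compose)
  note m = fev_max_ideal[OF z uv(1)] fev_max_ideal[OF z uv(2)] fev_max_ideal[OF z l(1)]
    fev_max_ideal[OF z formal_sum_nth_0[OF uv]]
  show "ec_add (to_fract a4) (pt a4 a6 (fev z u1)) (pt a4 a6 (fev z u2)) = pt a4 a6 (fev z (formal_sum a4 a6 u1 u2))"
    "fev z (formal_sum a4 a6 u1 u2) \<noteq> 0"
    by (rule ec_add_pt[OF m(1) ne(1) m(2) ne(2-4) m(3,4) ar])+
qed

text \<open>The sigma identity with \<open>x = t / w\<close> and all denominators cleared, as a
  difference of series, so that the identity principle can be applied to it.\<close>

definition sigma_defect :: "'a fps \<Rightarrow> 'a fps \<Rightarrow> 'a fps \<Rightarrow> 'a fps" where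
  "sigma_defect s u1 u2 =
     (s oo formal_sum a4 a6 u1 u2) * (s oo formal_sum a4 a6 u1 (- u2)) * ((weier_w a4 a6 oo u1) * (weier_w a4 a6 oo u2))
     - (s oo u1) ^ 2 * (s oo u2) ^ 2 * (u2 * (weier_w a4 a6 oo u1) - u1 * (weier_w a4 a6 oo u2))"

lemma fev_lead_1_nonzero:
  assumes "fps_nth s 0 = 0" "fps_nth s 1 = 1" "z \<in> max_ideal" "z \<noteq> 0" shows "fev z s \<noteq> 0"
proof -
  interpret h: comm_ring_hom "fev z" by (rule comm_ring_hom_fev[OF assms(3)])
  obtain S where S: "s = fps_X * S" "fps_nth S 0 = 1"
    using fps_lead_1I[OF assms(1,2)] unfolding fps_lead_def by auto
  obtain r where "fev z S = 1 + z * r" using fev_nth_0[OF assms(3), of S] S by auto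
  hence "fev z S \<noteq> 0" using one_minus_max_ideal_nonzero[of "- (z * r)"] assms(3)
    by (simp add: max_ideal_mult max_ideal_uminus)
  thus ?thesis using S assms by (simp add: h.hom_mult)
qed

text \<open>Evaluation commutes with the formal sum and with composition, and none of the cleared
  denominators vanishes at these points.\<close>

lemma mazur_tate_pair:
  assumes s: "odd_with_lead_t s" and z: "z \<in> max_ideal" and uv: "fps_nth u1 0 = 0" "fps_nth u2 0 = 0"
    and ne: "fev z u1 \<noteq> 0" "fev z u2 \<noteq> 0" "fev z u1 \<noteq> fev z u2" "fev z u1 \<noteq> - fev z u2"
  defines "P \<equiv> pt a4 a6 (fev z u1)" and "Q \<equiv> pt a4 a6 (fev z u2)" and "S \<equiv> \<lambda>P. fps_eval v s (ec_t P)"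
  shows "S (ec_add (to_fract a4) P Q) * S (ec_add (to_fract a4) P (ec_neg Q)) / (S P ^ 2 * S Q ^ 2) = ec_x Q - ec_x P
    \<longleftrightarrow> fev z (sigma_defect s u1 u2) = 0"
proof -
  interpret h: comm_ring_hom "fev z" by (rule comm_ring_hom_fev[OF z])
  interpret f: comm_ring_hom "to_fract :: 'a \<Rightarrow> 'a fract" by (rule comm_ring_hom_to_fract)
  let ?f = "to_fract :: 'a \<Rightarrow> 'a fract"
  let ?p = "fev z u1" and ?q = "fev z u2"
  have vm: "fps_nth (- u2) 0 = 0" using uv by simp
  have nem: "fev z (- u2) \<noteq> 0" "fev z u1 \<noteq> fev z (- u2)" "fev z u1 \<noteq> - fev z (- u2)"
    using ne by (simp_all add: h.hom_uminus)
  note m = fev_max_ideal[OF z uv(1)] fev_max_ideal[OF z uv(2)]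
  have Spt: "S (pt a4 a6 (fev z g)) = ?f (fev z (s oo g))" if "fps_nth g 0 = 0" "fev z g \<noteq> 0" for g
    using that by (simp add: S_def ec_t_pt fev_max_ideal[OF z] fps_eval_eq_fev fev_compose[OF z])
  have sum: "ec_add (to_fract a4) P Q = pt a4 a6 (fev z (formal_sum a4 a6 u1 u2))" "fev z (formal_sum a4 a6 u1 u2) \<noteq> 0"
    unfolding P_def Q_def by (rule ec_add_pt_fev[OF z uv ne])+
  have "ec_neg Q = pt a4 a6 (fev z (- u2))" unfolding Q_def using m by (simp add: ec_neg_pt h.hom_uminus)
  hence diff: "ec_add (to_fract a4) P (ec_neg Q) = pt a4 a6 (fev z (formal_sum a4 a6 u1 (- u2)))"
    "fev z (formal_sum a4 a6 u1 (- u2)) \<noteq> 0"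
    unfolding P_def using ec_add_pt_fev[OF z uv(1) vm ne(1) nem] by simp_all
  let ?wp = "wv a4 a6 ?p" and ?wq = "wv a4 a6 ?q"
  have w: "?wp \<noteq> 0" "?wq \<noteq> 0" using wv_nonzero m ne by auto
  have x: "ec_x Q - ec_x P = ?f (?q * ?wp - ?p * ?wq) / ?f (?wp * ?wq)"
    unfolding P_def Q_def pt_def using w by (simp add: field_simps)
  have s01: "fps_nth s 0 = 0" "fps_nth s 1 = 1" using s by (auto simp: odd_with_lead_t_def)
  have sn: "fev z (s oo u1) \<noteq> 0" "fev z (s oo u2) \<noteq> 0"
    using fev_lead_1_nonzero[OF s01] m ne uv by (auto simp: fev_compose[OF z])
  have "S (ec_add (to_fract a4) P Q) * S (ec_add (to_fract a4) P (ec_neg Q)) / (S P ^ 2 * S Q ^ 2) = ec_x Q - ec_x P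
    \<longleftrightarrow> ?f (fev z (s oo formal_sum a4 a6 u1 u2) * fev z (s oo formal_sum a4 a6 u1 (- u2)))
      / ?f (fev z (s oo u1) ^ 2 * fev z (s oo u2) ^ 2) = ?f (?q * ?wp - ?p * ?wq) / ?f (?wp * ?wq)"
    unfolding x sum(1) diff(1) Spt[OF formal_sum_nth_0[OF uv] sum(2)] Spt[OF formal_sum_nth_0[OF uv(1) vm] diff(2)]
    unfolding P_def Q_def Spt[OF uv(1) ne(1)] Spt[OF uv(2) ne(2)] by (simp add: to_fract_power)
  also have "\<dots> \<longleftrightarrow> ?f (fev z (s oo formal_sum a4 a6 u1 u2) * fev z (s oo formal_sum a4 a6 u1 (- u2))) * ?f (?wp * ?wq)
     = ?f (?q * ?wp - ?p * ?wq) * ?f (fev z (s oo u1) ^ 2 * fev z (s oo u2) ^ 2)"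
    using w sn by (intro frac_eq_eq) simp_all
  also have "\<dots> \<longleftrightarrow> fev z (s oo formal_sum a4 a6 u1 u2) * fev z (s oo formal_sum a4 a6 u1 (- u2)) * (?wp * ?wq)
     = (?q * ?wp - ?p * ?wq) * (fev z (s oo u1) ^ 2 * fev z (s oo u2) ^ 2)"
    by (simp only: to_fract_mult[symmetric] to_fract_eq_iff)
  also have "\<dots> \<longleftrightarrow> fev z (sigma_defect s u1 u2) = 0"
    unfolding sigma_defect_def h.hom_minus h.hom_mult h.hom_power fev_weier_w_compose[OF z uv(1)] fev_weier_w_compose[OF z uv(2)]
    by (simp only: right_minus_eq mult.commute)
  finally show ?thesis .
qed

lemma is_mazur_tate_sigmaD:
  assumes "is_mazur_tate_sigma v a4 a6 s" and z: "z \<in> max_ideal" and uv: "fps_nth u1 0 = 0" "fps_nth u2 0 = 0"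
    and ne: "fev z u1 \<noteq> 0" "fev z u2 \<noteq> 0" "fev z u1 \<noteq> fev z u2" "fev z u1 \<noteq> - fev z u2"
  shows "fev z (sigma_defect s u1 u2) = 0"
proof -
  interpret h: comm_ring_hom "fev z" by (rule comm_ring_hom_fev[OF z])
  have s: "odd_with_lead_t s" using assms(1) by (simp add: is_mazur_tate_sigma_def)
  note m = fev_max_ideal[OF z uv(1)] fev_max_ideal[OF z uv(2)]
  let ?P = "pt a4 a6 (fev z u1)" and ?Q = "pt a4 a6 (fev z u2)"
  have "?P \<in> kernel_of_reduction a4 a6" "?Q \<in> kernel_of_reduction a4 a6"
    unfolding kernel_of_reduction_eq using m ne by auto
  moreover have "?P \<noteq> Origin" "?Q \<noteq> Origin" by (simp_all add: pt_def)
  moreover have "?P \<noteq> ?Q" "?P \<noteq> ec_neg ?Q"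
    using m ne by (simp_all add: ec_neg_pt pt_inj max_ideal_uminus)
  ultimately show ?thesis
    using assms(1) mazur_tate_pair[OF s z uv ne] unfolding is_mazur_tate_sigma_def Let_def by blast
qed

lemma is_mazur_tate_sigmaI:
  assumes s: "odd_with_lead_t s"
    and d: "\<And>\<alpha> \<beta>. \<alpha> \<noteq> 0 \<Longrightarrow> \<beta> \<noteq> 0 \<Longrightarrow> \<alpha> \<noteq> \<beta> \<Longrightarrow> \<alpha> \<noteq> - \<beta> \<Longrightarrow>
      sigma_defect s (fps_const \<alpha> * fps_X) (fps_const \<beta> * fps_X) = 0"
  shows "is_mazur_tate_sigma v a4 a6 s"
  unfolding is_mazur_tate_sigma_def Let_def
proof (intro conjI ballI impI)
  show "odd_with_lead_t s" by (rule s)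
  fix P Q assume PQ: "P \<in> kernel_of_reduction a4 a6" "Q \<in> kernel_of_reduction a4 a6"
    "P \<noteq> Origin" "Q \<noteq> Origin" "P \<noteq> Q" "P \<noteq> ec_neg Q"
  then obtain p q where P: "P = pt a4 a6 p" "p \<in> max_ideal" "p \<noteq> 0" and Q: "Q = pt a4 a6 q" "q \<in> max_ideal" "q \<noteq> 0"
    unfolding kernel_of_reduction_eq by auto
  obtain \<alpha> \<beta> where ab: "p = \<pi> * \<alpha>" "q = \<pi> * \<beta>"
    using P(2) Q(2) unfolding max_ideal_iff_pi by (auto elim!: dvdE)
  interpret h: comm_ring_hom "fev \<pi>" by (rule comm_ring_hom_fev[OF pi_in_max_ideal])
  let ?u = "fps_const \<alpha> * fps_X" and ?v = "fps_const \<beta> * fps_X"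
  have ev: "fev \<pi> ?u = p" "fev \<pi> ?v = q"
    using pi_in_max_ideal by (simp_all add: h.hom_mult ab mult.commute)
  have ne: "p \<noteq> q" "p \<noteq> - q" using PQ(5,6) unfolding P(1) Q(1) ec_neg_pt[OF Q(2)] by auto
  have "sigma_defect s ?u ?v = 0" using P Q ne by (intro d) (auto simp: ab)
  hence "fev \<pi> (sigma_defect s ?u ?v) = 0" by simp
  thus "fps_eval v s (ec_t (ec_add (to_fract a4) P Q)) * fps_eval v s (ec_t (ec_add (to_fract a4) P (ec_neg Q))) /
      ((fps_eval v s (ec_t P))\<^sup>2 * (fps_eval v s (ec_t Q))\<^sup>2) = ec_x Q - ec_x P"
    using mazur_tate_pair[OF s pi_in_max_ideal, of ?u ?v] P Q ne unfolding ev by simp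
qed

end

end

section \<open>The universal ring and its specializations\<close>

lemma Rep_zinv6_hom: "comm_ring_hom Rep_zinv6"
proof
  show "Rep_zinv6 (a + b) = Rep_zinv6 a + Rep_zinv6 b" "Rep_zinv6 (a * b) = Rep_zinv6 a * Rep_zinv6 b"
    "Rep_zinv6 1 = 1" "Rep_zinv6 0 = 0" for a b by (transfer; simp)+
qed

lemma prime_card_gt3: "prime CARD('p :: prime_card_gt3)" "CARD('p) > 3"
  using prime_card card_gt3 by auto

lemma not_prime_dvd_6: "\<not> int CARD('p :: prime_card_gt3) dvd 6 ^ n"
proof
  let ?p = "CARD('p)"
  note p = prime_card_gt3[where 'p = 'p]
  assume "int ?p dvd 6 ^ n"
  hence "int ?p dvd 6" using p(1) prime_dvd_power[of "int ?p"] by auto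
  hence "?p dvd 2 * 3" by presburger
  hence "?p dvd 2 \<or> ?p dvd 3" using p prime_dvd_mult_iff by blast
  thus False using p by (auto dest: dvd_imp_le)
qed

text \<open>Clearing powers of 6 reduces this to the integers, where \<open>p\<close> divides no
  power of 6.\<close>

lemma prime_elem_zinv6: "prime_elem (of_nat CARD('p :: prime_card_gt3) :: zinv6)"
proof -
  let ?p = "CARD('p)"
  note p = prime_card_gt3[where 'p = 'p]
  interpret r: comm_ring_hom Rep_zinv6 by (rule Rep_zinv6_hom)
  have ex: "\<exists>n z. Rep_zinv6 a * 6 ^ n = of_int z" for a
  proof -
    obtain n where "Rep_zinv6 a * 6 ^ n \<in> \<int>" using Rep_zinv6[of a] by auto
    thus ?thesis by (metis Ints_cases)
  qed
  have eqI: "a = b" if "Rep_zinv6 a = Rep_zinv6 b" for a b using that by (simp add: Rep_zinv6_inject)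
  have dvdI: "of_nat ?p dvd a" if h: "Rep_zinv6 a * 6 ^ n = of_int z" "int ?p dvd z" for a n z
  proof -
    obtain y where y: "z = int ?p * y" using h(2) by (elim dvdE)
    define c where "c = Abs_zinv6 (of_int y / 6 ^ n)"
    have c: "Rep_zinv6 c = of_int y / 6 ^ n" unfolding c_def
      by (rule Abs_zinv6_inverse) (auto intro!: exI[of _ n])
    have "Rep_zinv6 a = Rep_zinv6 (of_nat ?p * c)"
      using h(1) by (simp add: r.hom_mult r.hom_of_nat c y field_simps)
    thus ?thesis using eqI by (metis dvd_triv_left)
  qed
  show ?thesis
  proof (rule prime_elemI)
    show "of_nat ?p \<noteq> (0 :: zinv6)"
    proof
      assume "of_nat ?p = (0 :: zinv6)"
      hence "Rep_zinv6 (of_nat ?p) = 0" by simp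
      thus False using p by (simp add: r.hom_of_nat)
    qed
    show "\<not> of_nat ?p dvd (1 :: zinv6)"
    proof
      assume "of_nat ?p dvd (1 :: zinv6)"
      then obtain c :: zinv6 where "1 = of_nat ?p * c" by (elim dvdE)
      from arg_cong[OF this, of Rep_zinv6] have 1: "1 = of_nat ?p * Rep_zinv6 c"
        by (simp add: r.hom_mult r.hom_of_nat)
      obtain n z where z: "Rep_zinv6 c * 6 ^ n = of_int z" using ex by blast
      have "(of_int (int ?p * z) :: rat) = (of_nat ?p * Rep_zinv6 c) * 6 ^ n" by (simp flip: z)
      also have "\<dots> = of_int (6 ^ n)" by (simp flip: 1)
      finally have "of_int (6 ^ n) = (of_int (int ?p * z) :: rat)" by simp
      hence "6 ^ n = int ?p * z" by (simp only: of_int_eq_iff)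
      thus False using not_prime_dvd_6[where 'p = 'p, of n] by simp
    qed
    fix a b :: zinv6 assume "of_nat ?p dvd a * b"
    then obtain c where "a * b = of_nat ?p * c" by (elim dvdE)
    from arg_cong[OF this, of Rep_zinv6] have 1: "Rep_zinv6 a * Rep_zinv6 b = of_nat ?p * Rep_zinv6 c"
      by (simp add: r.hom_mult r.hom_of_nat)
    obtain n z where a: "Rep_zinv6 a * 6 ^ n = of_int z" using ex by blast
    obtain m y where b: "Rep_zinv6 b * 6 ^ m = of_int y" using ex by blast
    obtain k x where c: "Rep_zinv6 c * 6 ^ k = of_int x" using ex by blast
    have "(of_int (z * y * 6 ^ k) :: rat) = (Rep_zinv6 a * Rep_zinv6 b) * 6 ^ n * 6 ^ m * 6 ^ k"
      by (simp flip: a b)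
    also have "\<dots> = of_int (int ?p * (x * 6 ^ n * 6 ^ m))" unfolding 1 by (simp flip: c)
    finally have "z * y * 6 ^ k = int ?p * (x * 6 ^ n * 6 ^ m)" by (simp only: of_int_eq_iff)
    hence "int ?p dvd z * y * 6 ^ k" by simp
    hence "int ?p dvd z \<or> int ?p dvd y"
      using p(1) not_prime_dvd_6[where 'p = 'p, of k] by (auto simp: prime_dvd_mult_iff)
    thus "of_nat ?p dvd a \<or> of_nat ?p dvd b" using dvdI a b by blast
  qed
qed

lemma prime_elem_univ_R: "prime_elem (of_nat CARD('p :: prime_card_gt3) :: univ_R)"
  using prime_elem_zinv6[where 'p = 'p] by (simp add: of_nat_poly lift_prime_elem_poly)

lemma Rep_R_to_RH: "Rep_univ_RH (R_to_RH r :: ('p :: prime_card_gt3) univ_RH) = to_fract r"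
  unfolding R_to_RH_def by (rule Abs_univ_RH_inverse, rule CollectI, rule exI[of _ r], rule exI[of _ 0]) simp

lemma R_to_RH_hom: "comm_ring_hom (R_to_RH :: univ_R \<Rightarrow> ('p :: prime_card_gt3) univ_RH)"
proof
  show "(R_to_RH (a + b) :: 'p univ_RH) = R_to_RH a + R_to_RH b"
    "(R_to_RH (a * b) :: 'p univ_RH) = R_to_RH a * R_to_RH b"
    "(R_to_RH 0 :: 'p univ_RH) = 0" "(R_to_RH 1 :: 'p univ_RH) = 1" for a b
    by (simp_all flip: Rep_univ_RH_inject
      add: Rep_R_to_RH plus_univ_RH.rep_eq times_univ_RH.rep_eq zero_univ_RH.rep_eq one_univ_RH.rep_eq)
qed

lemma R_to_RH_inj: "(R_to_RH a :: ('p :: prime_card_gt3) univ_RH) = R_to_RH b \<Longrightarrow> a = b"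
  by (metis Rep_R_to_RH to_fract_eq_iff)

lemma RH_denominator:
  "\<exists>r n. (x :: ('p :: prime_card_gt3) univ_RH) * R_to_RH (hasse CARD('p)) ^ n = R_to_RH r"
proof -
  interpret R: comm_ring_hom "R_to_RH :: univ_R \<Rightarrow> 'p univ_RH" by (rule R_to_RH_hom)
  obtain r n where "Rep_univ_RH x = to_fract r / to_fract (hasse CARD('p)) ^ n"
    using Rep_univ_RH[of x] by auto
  hence "Rep_univ_RH (x * R_to_RH (hasse CARD('p) ^ n)) = Rep_univ_RH (R_to_RH r :: 'p univ_RH)"
    using hasse_nonzero[where 'p = 'p] by (simp add: times_univ_RH.rep_eq Rep_R_to_RH to_fract_power)
  thus ?thesis by (auto simp: Rep_univ_RH_inject R.hom_power)
qed

lemma hasse_unit_RH: "\<exists>i. R_to_RH (hasse CARD('p)) * i = (1 :: ('p :: prime_card_gt3) univ_RH)"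
proof
  have "Rep_univ_RH (Abs_univ_RH (1 / to_fract (hasse CARD('p))) :: 'p univ_RH) = 1 / to_fract (hasse CARD('p))"
    by (rule Abs_univ_RH_inverse) (auto intro!: exI[of _ 1])
  thus "R_to_RH (hasse CARD('p)) * Abs_univ_RH (1 / to_fract (hasse CARD('p))) = (1 :: 'p univ_RH)"
    using hasse_nonzero[where 'p = 'p]
    by (simp flip: Rep_univ_RH_inject add: Rep_R_to_RH times_univ_RH.rep_eq one_univ_RH.rep_eq)
qed

text \<open>Localisation keeps \<open>p\<close> prime because \<open>p\<close> divides no power of
  the Hasse invariant; otherwise \<open>p\<close> would become a unit and the completion would
  collapse.\<close>

lemma prime_elem_RH: "prime_elem (of_nat CARD('p) :: ('p :: prime_card_gt3) univ_RH)"
proof -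
  let ?p = "of_nat CARD('p)"
  let ?H = "hasse CARD('p)"
  interpret R: comm_ring_hom "R_to_RH :: univ_R \<Rightarrow> 'p univ_RH" by (rule R_to_RH_hom)
  obtain i where i: "R_to_RH ?H * i = (1 :: 'p univ_RH)" using hasse_unit_RH by blast
  have H: "\<not> ?p dvd ?H ^ n" for n by (rule hasse_power_not_dvd)
  have iff: "?p dvd x \<longleftrightarrow> ?p dvd r" if x: "(x :: 'p univ_RH) * R_to_RH ?H ^ n = R_to_RH r" for x n r
  proof
    assume "?p dvd r"
    then obtain s where "r = ?p * s" by (elim dvdE)
    hence "R_to_RH r = ?p * (R_to_RH s :: 'p univ_RH)" by (simp add: R.hom_mult R.hom_of_nat)
    hence "x * (R_to_RH ?H * i) ^ n = ?p * (R_to_RH s * i ^ n)"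
      using x by (simp add: power_mult_distrib mult.assoc[symmetric])
    thus "?p dvd x" by (simp add: i)
  next
    assume "?p dvd x"
    then obtain z where z: "x = ?p * z" by (elim dvdE)
    obtain t k where t: "z * R_to_RH ?H ^ k = R_to_RH t" using RH_denominator by blast
    have "R_to_RH (r * ?H ^ k) = x * R_to_RH ?H ^ n * R_to_RH ?H ^ k"
      by (simp add: x R.hom_mult R.hom_power)
    also have "\<dots> = ?p * R_to_RH ?H ^ n * (z * R_to_RH ?H ^ k)" by (simp add: z mult_ac)
    also have "\<dots> = R_to_RH (?p * (?H ^ n * t))" unfolding t by (simp add: R.hom_mult R.hom_power R.hom_of_nat mult_ac)
    finally have "r * ?H ^ k = ?p * (?H ^ n * t)" by (rule R_to_RH_inj)
    hence "?p dvd r * ?H ^ k" by simp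
    thus "?p dvd r" using prime_elem_univ_R[where 'p = 'p] H by (metis prime_elem_dvd_mult_iff)
  qed
  show ?thesis
  proof (rule prime_elemI)
    show "\<not> ?p dvd (1 :: 'p univ_RH)" by (rule not_p_dvd_one)
    show "?p \<noteq> (0 :: 'p univ_RH)"
    proof
      assume "?p = (0 :: 'p univ_RH)"
      hence "R_to_RH ?p = (R_to_RH 0 :: 'p univ_RH)" by (simp add: R.hom_of_nat)
      hence "?p = (0 :: univ_R)" by (rule R_to_RH_inj)
      thus False using prime_elem_univ_R[where 'p = 'p] by simp
    qed
    fix x y :: "'p univ_RH" assume xy: "?p dvd x * y"
    obtain r n where r: "x * R_to_RH ?H ^ n = R_to_RH r" using RH_denominator by blast
    obtain s m where s: "y * R_to_RH ?H ^ m = R_to_RH s" using RH_denominator by blast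
    have "(x * y) * R_to_RH ?H ^ (n + m) = R_to_RH (r * s)"
      unfolding R.hom_mult r[symmetric] s[symmetric] by (simp add: power_add mult_ac)
    hence "?p dvd r * s" using iff xy by blast
    hence "?p dvd r \<or> ?p dvd s" using prime_elem_univ_R[where 'p = 'p] by (metis prime_elem_dvd_mult_iff)
    thus "?p dvd x \<or> ?p dvd y" using iff[OF r] iff[OF s] by blast
  qed
qed

section \<open>The completion as a domain of characteristic 0\<close>

lemma compatible_family_mono:
  fixes s :: "nat \<Rightarrow> ('p :: prime_card_gt3) univ_RH"
  assumes "compatible_family s" shows "of_nat CARD('p) ^ n dvd s (n + k) - s n"
proof (induction k)
  case (Suc k)
  have "of_nat CARD('p) ^ (n + k) dvd s (Suc (n + k)) - s (n + k)"
    using assms unfolding compatible_family_def by blast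
  hence "of_nat CARD('p) ^ n dvd s (Suc (n + k)) - s (n + k)"
    by (rule dvd_trans[rotated]) (simp add: le_imp_power_dvd)
  from dvd_add[OF this Suc] show ?case by simp
qed simp

lemma Rhat_cases:
  obtains s :: "nat \<Rightarrow> ('p :: prime_card_gt3) univ_RH" where "compatible_family s" "z = abs_univ_Rhat s"
proof -
  have "same_limit (rep_univ_Rhat z) (rep_univ_Rhat z)" by (rule Quotient_rep_reflp[OF Quotient_univ_Rhat])
  moreover have "abs_univ_Rhat (rep_univ_Rhat z) = z" by (rule Quotient_abs_rep[OF Quotient_univ_Rhat])
  ultimately show ?thesis using that unfolding same_limit_def by metis
qed

lemma abs_Rhat_eq_iff:
  assumes "compatible_family s" "compatible_family s'"
  shows "abs_univ_Rhat s = abs_univ_Rhat s' \<longleftrightarrow> (\<forall>n. of_nat CARD('p :: prime_card_gt3) ^ n dvd s n - (s' n :: 'p univ_RH))"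
proof -
  have "same_limit s s" "same_limit s' s'" using assms by (simp_all add: same_limit_def)
  hence "abs_univ_Rhat s = abs_univ_Rhat s' \<longleftrightarrow> same_limit s s'"
    using Quotient_rel[OF Quotient_univ_Rhat] by metis
  thus ?thesis using assms by (simp add: same_limit_def)
qed

lemma compatible_const [simp]: "compatible_family (\<lambda>_. x)" by (simp add: compatible_family_def)

lemma compatible_add: "compatible_family s \<Longrightarrow> compatible_family t \<Longrightarrow> compatible_family (\<lambda>n. s n + t n)"
  and compatible_mult: "compatible_family s \<Longrightarrow> compatible_family t \<Longrightarrow> compatible_family (\<lambda>n. s n * t n)"
  by (auto simp: compatible_family_def intro!: dvd_diff_add dvd_diff_mult)

lemma abs_Rhat_add:
  "compatible_family s \<Longrightarrow> compatible_family t \<Longrightarrow> abs_univ_Rhat s + abs_univ_Rhat t = abs_univ_Rhat (\<lambda>n. s n + t n)"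
  by (rule plus_univ_Rhat.abs_eq) (simp_all add: eq_onp_def same_limit_def)

lemma abs_Rhat_mult:
  "compatible_family s \<Longrightarrow> compatible_family t \<Longrightarrow> abs_univ_Rhat s * abs_univ_Rhat t = abs_univ_Rhat (\<lambda>n. s n * t n)"
  by (rule times_univ_Rhat.abs_eq) (simp_all add: eq_onp_def same_limit_def)

lemma RH_to_Rhat_hom: "comm_ring_hom (RH_to_Rhat :: ('p :: prime_card_gt3) univ_RH \<Rightarrow> 'p univ_Rhat)"
  by unfold_locales
    (auto simp: RH_to_Rhat_def abs_Rhat_add abs_Rhat_mult zero_univ_Rhat_def one_univ_Rhat_def)

text \<open>The differences \<open>s (n + k) - s n\<close> are divisible by \<open>p ^ n\<close>,
  and the quotients again form a compatible family since \<open>p\<close> can be cancelled. So the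
  kernel of the projection to level \<open>n\<close> is generated by \<open>p ^ n\<close>.\<close>

lemma Rhat_approx:
  fixes s :: "nat \<Rightarrow> ('p :: prime_card_gt3) univ_RH"
  assumes s: "compatible_family s"
  shows "of_nat CARD('p) ^ n dvd abs_univ_Rhat s - RH_to_Rhat (s n)"
proof -
  let ?p = "of_nat CARD('p)"
  interpret h: comm_ring_hom "RH_to_Rhat :: 'p univ_RH \<Rightarrow> 'p univ_Rhat" by (rule RH_to_Rhat_hom)
  have p0: "(?p :: 'p univ_RH) \<noteq> 0" using prime_elem_RH[where 'p = 'p] by auto
  have "\<forall>k. \<exists>t. s (n + k) - s n = ?p ^ n * t"
    using compatible_family_mono[OF s] by (meson dvdE)
  then obtain t where t: "\<And>k. s (n + k) - s n = ?p ^ n * t k" by metis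
  have ct: "compatible_family t"
    unfolding compatible_family_def
  proof
    fix k
    have "?p ^ (n + k) dvd s (n + Suc k) - s (n + k)" using s unfolding compatible_family_def by simp
    also have "s (n + Suc k) - s (n + k) = ?p ^ n * (t (Suc k) - t k)"
      unfolding right_diff_distrib t[symmetric] by simp
    finally show "?p ^ k dvd t (Suc k) - t k" using p0 by (simp add: power_add)
  qed
  have "abs_univ_Rhat s = RH_to_Rhat (s n) + ?p ^ n * abs_univ_Rhat t"
  proof -
    have "(?p ^ n :: 'p univ_Rhat) = RH_to_Rhat (?p ^ n)" by (simp add: h.hom_power h.hom_of_nat)
    hence "RH_to_Rhat (s n) + ?p ^ n * abs_univ_Rhat t = abs_univ_Rhat (\<lambda>k. s n + ?p ^ n * t k)"
      unfolding RH_to_Rhat_def using ct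
      by (simp add: abs_Rhat_add abs_Rhat_mult compatible_mult[OF compatible_const])
    also have "\<dots> = abs_univ_Rhat (\<lambda>k. s (n + k))"
      by (rule arg_cong[of _ _ abs_univ_Rhat]) (simp add: t[symmetric] fun_eq_iff)
    also have "\<dots> = abs_univ_Rhat s"
    proof (subst abs_Rhat_eq_iff)
      show "compatible_family (\<lambda>k. s (n + k))"
        unfolding compatible_family_def
      proof
        fix k
        have "?p ^ (n + k) dvd s (Suc (n + k)) - s (n + k)" using s unfolding compatible_family_def by blast
        thus "?p ^ k dvd s (n + Suc k) - s (n + k)"
          by (simp add: dvd_trans[OF le_imp_power_dvd[of k "n + k"]])
      qed
      show "\<forall>k. ?p ^ k dvd s (n + k) - s k" using compatible_family_mono[OF s, of _ n] by (simp add: add.commute)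
    qed (rule s)
    finally show ?thesis by simp
  qed
  thus ?thesis by simp
qed

text \<open>Carries separatedness, cancellation of \<open>p\<close> and primality of
  \<open>p\<close> over from \<open>univ_RH\<close> to the completion.\<close>

lemma p_dvd_Rhat_iff:
  fixes s :: "nat \<Rightarrow> ('p :: prime_card_gt3) univ_RH"
  assumes s: "compatible_family s"
  shows "of_nat CARD('p) ^ n dvd abs_univ_Rhat s \<longleftrightarrow> of_nat CARD('p) ^ n dvd s n"
proof
  let ?p = "of_nat CARD('p)"
  interpret h: comm_ring_hom "RH_to_Rhat :: 'p univ_RH \<Rightarrow> 'p univ_Rhat" by (rule RH_to_Rhat_hom)
  assume "?p ^ n dvd s n"
  then obtain r where "s n = ?p ^ n * r" by (elim dvdE)
  hence "?p ^ n dvd RH_to_Rhat (s n)" by (simp add: h.hom_mult h.hom_power h.hom_of_nat)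
  from dvd_add[OF Rhat_approx[OF s, of n] this] show "?p ^ n dvd abs_univ_Rhat s" by simp
next
  let ?p = "of_nat CARD('p)"
  interpret h: comm_ring_hom "RH_to_Rhat :: 'p univ_RH \<Rightarrow> 'p univ_Rhat" by (rule RH_to_Rhat_hom)
  assume "?p ^ n dvd abs_univ_Rhat s"
  then obtain z where z: "abs_univ_Rhat s = ?p ^ n * z" by (elim dvdE)
  obtain t where t: "compatible_family t" "z = abs_univ_Rhat t" by (rule Rhat_cases)
  have "(?p ^ n :: 'p univ_Rhat) = RH_to_Rhat (?p ^ n)" by (simp add: h.hom_power h.hom_of_nat)
  hence "abs_univ_Rhat s = abs_univ_Rhat (\<lambda>k. ?p ^ n * t k)"
    using z t by (simp add: RH_to_Rhat_def abs_Rhat_mult)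
  hence "?p ^ n dvd s n - ?p ^ n * t n"
    using abs_Rhat_eq_iff[OF s compatible_mult[OF compatible_const t(1)]] by blast
  from dvd_add[OF this, of "?p ^ n * t n"] show "?p ^ n dvd s n" by simp
qed

lemma Rhat_separated:
  fixes z :: "('p :: prime_card_gt3) univ_Rhat"
  assumes "\<And>n. of_nat CARD('p) ^ n dvd z" shows "z = 0"
proof -
  obtain s where s: "compatible_family s" "z = abs_univ_Rhat s" by (rule Rhat_cases)
  have "of_nat CARD('p) ^ n dvd s n" for n using assms p_dvd_Rhat_iff[OF s(1)] s(2) by blast
  thus ?thesis unfolding s(2) zero_univ_Rhat_def using s(1) by (subst abs_Rhat_eq_iff) auto
qed

lemma Rhat_p_cancel:
  fixes z :: "('p :: prime_card_gt3) univ_Rhat"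
  assumes "of_nat CARD('p) * z = 0" shows "z = 0"
proof (rule Rhat_separated)
  fix n
  let ?p = "of_nat CARD('p)"
  interpret h: comm_ring_hom "RH_to_Rhat :: 'p univ_RH \<Rightarrow> 'p univ_Rhat" by (rule RH_to_Rhat_hom)
  have p0: "(?p :: 'p univ_RH) \<noteq> 0" using prime_elem_RH[where 'p = 'p] by auto
  obtain s where s: "compatible_family s" "z = abs_univ_Rhat s" by (rule Rhat_cases)
  have "(?p :: 'p univ_Rhat) = RH_to_Rhat ?p" by (simp add: h.hom_of_nat)
  hence "?p * z = abs_univ_Rhat (\<lambda>k. ?p * s k)" using s by (simp add: RH_to_Rhat_def abs_Rhat_mult)
  hence "abs_univ_Rhat (\<lambda>k. ?p * s k) = abs_univ_Rhat (\<lambda>_. 0)" using assms by (simp add: zero_univ_Rhat_def)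
  \<comment> \<open>One level above the goal, because cancelling \<open>p\<close> costs one
    power.\<close>
  hence "?p ^ Suc n dvd ?p * s (Suc n) - 0"
    using abs_Rhat_eq_iff[OF compatible_mult[OF compatible_const s(1)] compatible_const] by blast
  hence "?p ^ n dvd s (Suc n)" using p0 by simp
  moreover have "?p ^ n dvd s (Suc n) - s n" using s(1) unfolding compatible_family_def by blast
  ultimately have "?p ^ n dvd s (Suc n) - (s (Suc n) - s n)" by (rule dvd_diff)
  thus "?p ^ n dvd z" unfolding s(2) p_dvd_Rhat_iff[OF s(1)] by simp
qed

lemma Rhat_p_prime:
  fixes z w :: "('p :: prime_card_gt3) univ_Rhat"
  assumes "of_nat CARD('p) dvd z * w" shows "of_nat CARD('p) dvd z \<or> of_nat CARD('p) dvd w"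
proof -
  let ?p = "of_nat CARD('p)"
  obtain s where s: "compatible_family s" "z = abs_univ_Rhat s" by (rule Rhat_cases)
  obtain t where t: "compatible_family t" "w = abs_univ_Rhat t" by (rule Rhat_cases)
  \<comment> \<open>Level 1 is the ring modulo \<open>p\<close>; level 0 carries no
    information.\<close>
  have "?p ^ 1 dvd s 1 * t 1"
    using assms p_dvd_Rhat_iff[OF compatible_mult[OF s(1) t(1)], of 1] by (simp add: s t abs_Rhat_mult)
  hence "?p ^ 1 dvd s 1 \<or> ?p ^ 1 dvd t 1" using prime_elem_RH[where 'p = 'p] by (simp add: prime_elem_dvd_mult_iff)
  thus ?thesis using p_dvd_Rhat_iff[OF s(1), of 1] p_dvd_Rhat_iff[OF t(1), of 1] s t by simp
qed

lemma Rhat_decompose: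
  fixes z :: "('p :: prime_card_gt3) univ_Rhat"
  assumes "z \<noteq> 0" obtains a z' where "z = of_nat CARD('p) ^ a * z'" "\<not> of_nat CARD('p) dvd z'"
proof -
  let ?p = "of_nat CARD('p) :: 'p univ_Rhat"
  have "\<exists>n. \<not> ?p ^ n dvd z" using assms Rhat_separated by blast
  define n where "n = (LEAST n. \<not> ?p ^ n dvd z)"
  have n: "\<not> ?p ^ n dvd z" unfolding n_def by (rule LeastI_ex) fact
  then obtain a where a: "n = Suc a" by (cases n) auto
  have "?p ^ a dvd z" using not_less_Least[of a "\<lambda>n. \<not> ?p ^ n dvd z"] a unfolding n_def by auto
  then obtain z' where z': "z = ?p ^ a * z'" by (elim dvdE)
  moreover have "\<not> ?p dvd z'" using n unfolding a z' by (auto simp: mult_dvd_mono power_Suc2 simp del: power_Suc)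
  ultimately show ?thesis using that by blast
qed

lemma Rhat_p_power_cancel:
  fixes z :: "('p :: prime_card_gt3) univ_Rhat"
  shows "of_nat CARD('p) ^ n * z = 0 \<Longrightarrow> z = 0"
  by (induction n) (auto simp: mult.assoc dest: Rhat_p_cancel)

text \<open>A nonzero element is a power of \<open>p\<close> times an element not divisible by
  \<open>p\<close>. Since \<open>p\<close> is prime and can be cancelled, products of such elements
  are nonzero.\<close>

instance univ_Rhat :: (prime_card_gt3) idom
proof
  fix z w :: "'a univ_Rhat" assume "z \<noteq> 0" "w \<noteq> 0"
  let ?p = "of_nat CARD('a) :: 'a univ_Rhat"
  obtain a z' where z: "z = ?p ^ a * z'" "\<not> ?p dvd z'" using \<open>z \<noteq> 0\<close> by (rule Rhat_decompose)
  obtain b w' where w: "w = ?p ^ b * w'" "\<not> ?p dvd w'" using \<open>w \<noteq> 0\<close> by (rule Rhat_decompose)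
  show "z * w \<noteq> 0"
  proof
    assume "z * w = 0"
    hence "?p ^ (a + b) * (z' * w') = 0" by (simp add: z(1) w(1) power_add mult_ac)
    hence "z' * w' = 0" by (rule Rhat_p_power_cancel)
    hence "?p dvd z' * w'" by simp
    thus False using Rhat_p_prime z(2) w(2) by blast
  qed
qed

text \<open>Write \<open>n\<close> as a power of \<open>p\<close> times \<open>m\<close> prime to
  \<open>p\<close>. The power can be cancelled, and \<open>m = 0\<close> would make \<open>p\<close>
  divide 1 in \<open>univ_RH\<close> by Bezout.\<close>

instance univ_Rhat :: (prime_card_gt3) ring_char_0
proof
  have "of_nat n \<noteq> (0 :: 'a univ_Rhat)" if n: "n > 0" for n
  proof
    let ?p = "CARD('a)"
    note p = prime_card_gt3(1)[where 'p = 'a]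
    interpret h: comm_ring_hom "RH_to_Rhat :: 'a univ_RH \<Rightarrow> 'a univ_Rhat" by (rule RH_to_Rhat_hom)
    assume 0: "of_nat n = (0 :: 'a univ_Rhat)"
    obtain m where m: "n = ?p ^ multiplicity ?p n * m" "\<not> ?p dvd m"
      by (rule multiplicity_decompose'[of n ?p]) (use n p in auto)
    have "of_nat n = (of_nat ?p :: 'a univ_Rhat) ^ multiplicity ?p n * of_nat m"
      using arg_cong[OF m(1), of "of_nat :: nat \<Rightarrow> 'a univ_Rhat"] by (simp only: of_nat_mult of_nat_power)
    hence "of_nat m = (0 :: 'a univ_Rhat)" using 0 Rhat_p_power_cancel by metis
    hence "(of_nat ?p :: 'a univ_Rhat) ^ 1 dvd abs_univ_Rhat (\<lambda>_. of_nat m)"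
      by (simp flip: h.hom_of_nat add: RH_to_Rhat_def)
    hence d: "of_nat ?p dvd (of_nat m :: 'a univ_RH)" by (subst (asm) p_dvd_Rhat_iff) simp_all
    have "coprime (int ?p) (int m)" using m(2) p by (simp add: prime_imp_coprime)
    then obtain x y where "int ?p * x + int m * y = 1" using bezout_int[of "int ?p" "int m"] by (auto simp: mult.commute)
    hence "of_int (int ?p * x + int m * y) = (1 :: 'a univ_RH)" by simp
    hence "of_nat ?p * of_int x + of_nat m * of_int y = (1 :: 'a univ_RH)" by simp
    moreover have "of_nat ?p dvd of_nat ?p * of_int x + of_nat m * (of_int y :: 'a univ_RH)" using d by simp
    ultimately show False using not_p_dvd_one[where 'p = 'a] by simp
  qed
  note nz = this
  show "inj (of_nat :: nat \<Rightarrow> 'a univ_Rhat)"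
  proof (rule injI)
    fix m n assume eq: "of_nat m = (of_nat n :: 'a univ_Rhat)"
    have "a \<le> b \<Longrightarrow> of_nat a = (of_nat b :: 'a univ_Rhat) \<Longrightarrow> a = b" for a b
      using nz[of "b - a"] by (cases "a = b") (auto simp: of_nat_diff)
    thus "m = n" using eq by (metis nat_le_linear)
  qed
qed

lemma hom_dvd:
  assumes "comm_ring_hom h" "x dvd y" shows "h x dvd h y"
proof -
  interpret comm_ring_hom h by fact
  show ?thesis using assms(2) by (auto simp: dvd_def hom_mult)
qed

lemma RH_extension:
  fixes \<rho> :: "univ_R \<Rightarrow> 'a :: idom"
  assumes hom: "comm_ring_hom \<rho>" and unit: "\<rho> (hasse CARD('p :: prime_card_gt3)) dvd 1"
  shows "\<exists>!\<rho>H :: 'p univ_RH \<Rightarrow> 'a. comm_ring_hom \<rho>H \<and> (\<forall>r. \<rho>H (R_to_RH r) = \<rho> r)"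
proof -
  interpret \<rho>: comm_ring_hom \<rho> by fact
  interpret R: comm_ring_hom "R_to_RH :: univ_R \<Rightarrow> 'p univ_RH" by (rule R_to_RH_hom)
  let ?H = "hasse CARD('p)" let ?h = "R_to_RH ?H :: 'p univ_RH"
  obtain j where j: "\<rho> ?H * j = 1" using unit by (auto elim!: dvdE)
  have jn: "\<rho> ?H ^ n * j ^ n = 1" for n by (simp add: j flip: power_mult_distrib)
  \<comment> \<open>The value at a fraction \<open>r / H ^ n\<close> has to be
    \<open>\<rho> r * j ^ n\<close>; here it is seen not to depend on the fraction.\<close>
  have indep: "\<rho> r * j ^ n = \<rho> s * j ^ m" if "x * ?h ^ n = R_to_RH r" "x * ?h ^ m = R_to_RH s" for x r s n m
  proof -
    have "R_to_RH (r * ?H ^ m) = (R_to_RH (s * ?H ^ n) :: 'p univ_RH)"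
      unfolding R.hom_mult R.hom_power that[symmetric] by (simp add: mult_ac)
    hence "r * ?H ^ m = s * ?H ^ n" by (rule R_to_RH_inj)
    from arg_cong[OF this, of \<rho>] have "\<rho> r * \<rho> ?H ^ m = \<rho> s * \<rho> ?H ^ n" by (simp add: \<rho>.hom_mult \<rho>.hom_power)
    hence "(\<rho> r * \<rho> ?H ^ m) * (j ^ n * j ^ m) = (\<rho> s * \<rho> ?H ^ n) * (j ^ n * j ^ m)" by simp
    hence "\<rho> r * j ^ n * (\<rho> ?H ^ m * j ^ m) = \<rho> s * j ^ m * (\<rho> ?H ^ n * j ^ n)" by (simp only: mult_ac)
    thus ?thesis by (simp add: jn)
  qed
  define g :: "'p univ_RH \<Rightarrow> 'a" where
    "g x = (SOME a. \<exists>r n. x * ?h ^ n = R_to_RH r \<and> a = \<rho> r * j ^ n)" for x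
  have g: "g x = \<rho> r * j ^ n" if x: "x * ?h ^ n = R_to_RH r" for x r n
  proof -
    have "\<exists>a r n. x * ?h ^ n = R_to_RH r \<and> a = \<rho> r * j ^ n" using x by blast
    from someI_ex[OF this, folded g_def] obtain r' n' where
      "x * ?h ^ n' = R_to_RH r'" "g x = \<rho> r' * j ^ n'" by blast
    thus ?thesis using indep[OF _ x] by simp
  qed
  have "comm_ring_hom g"
  proof
    fix x y :: "'p univ_RH"
    obtain r n where r: "x * ?h ^ n = R_to_RH r" using RH_denominator by blast
    obtain s m where s: "y * ?h ^ m = R_to_RH s" using RH_denominator by blast
    have "(x + y) * ?h ^ (n + m) = R_to_RH (r * ?H ^ m + s * ?H ^ n)"
      unfolding R.hom_mult R.hom_power R.hom_add r[symmetric] s[symmetric] by (simp add: power_add algebra_simps)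
    from g[OF this] have "g (x + y) = (\<rho> r * \<rho> ?H ^ m + \<rho> s * \<rho> ?H ^ n) * (j ^ n * j ^ m)"
      by (simp add: \<rho>.hom_mult \<rho>.hom_add \<rho>.hom_power power_add)
    also have "\<dots> = \<rho> r * j ^ n * (\<rho> ?H ^ m * j ^ m) + \<rho> s * j ^ m * (\<rho> ?H ^ n * j ^ n)"
      by (simp add: algebra_simps)
    finally show "g (x + y) = g x + g y" by (simp add: jn g[OF r] g[OF s])
    have "(x * y) * ?h ^ (n + m) = R_to_RH (r * s)"
      unfolding R.hom_mult r[symmetric] s[symmetric] by (simp add: power_add mult_ac)
    from g[OF this] show "g (x * y) = g x * g y" by (simp add: g[OF r] g[OF s] \<rho>.hom_mult power_add mult_ac)
    show "g 1 = 1" "g 0 = 0" using g[of 1 0 1] g[of 0 0 0] by simp_all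
  qed
  moreover have "g (R_to_RH r) = \<rho> r" for r using g[of "R_to_RH r" 0 r] by simp
  moreover have "f = g" if f: "comm_ring_hom f" "\<forall>r. f (R_to_RH r) = \<rho> r" for f
  proof
    fix x
    interpret f: comm_ring_hom f by (rule f)
    obtain r n where r: "x * ?h ^ n = R_to_RH r" using RH_denominator by blast
    from arg_cong[OF r, of f] have "f x * \<rho> ?H ^ n = \<rho> r" using f(2) by (simp add: f.hom_mult f.hom_power)
    hence "f x * (\<rho> ?H ^ n * j ^ n) = \<rho> r * j ^ n" by (simp add: mult.assoc[symmetric])
    thus "f x = g x" by (simp add: jn g[OF r])
  qed
  ultimately show ?thesis by blast
qed

context cdvr
begin

text \<open>The extension sends a family to the \<open>p\<close>-adic limit of the images of its
  components. Uniqueness assumes no continuity: ring homomorphisms preserve divisibility by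
  \<open>p ^ n\<close>, so by \<open>Rhat_approx\<close> their values are determined modulo every
  \<open>p ^ n\<close>.\<close>

lemma Rhat_extension:
  fixes \<rho> :: "univ_R \<Rightarrow> 'a"
  assumes hom: "comm_ring_hom \<rho>" and unit: "\<rho> (hasse CARD('p :: prime_card_gt3)) dvd 1"
    and p: "of_nat CARD('p) \<in> (max_ideal :: 'a set)"
  shows "\<exists>!\<rho>hat :: 'p univ_Rhat \<Rightarrow> 'a. comm_ring_hom \<rho>hat \<and> (\<forall>r. \<rho>hat (R_to_Rhat r) = \<rho> r)"
proof -
  let ?p = "of_nat CARD('p) :: 'a" and ?P = "of_nat CARD('p) :: 'p univ_RH"
  obtain \<rho>H :: "'p univ_RH \<Rightarrow> 'a" where H: "comm_ring_hom \<rho>H" "\<And>r. \<rho>H (R_to_RH r) = \<rho> r"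
    and Huniq: "\<And>f. comm_ring_hom f \<Longrightarrow> (\<And>r. f (R_to_RH r) = \<rho> r) \<Longrightarrow> f = \<rho>H"
    using RH_extension[OF hom unit] by blast
  interpret H: comm_ring_hom \<rho>H by (rule H)
  interpret RH: comm_ring_hom "RH_to_Rhat :: 'p univ_RH \<Rightarrow> 'p univ_Rhat" by (rule RH_to_Rhat_hom)
  have Hdvd: "?p ^ n dvd \<rho>H x - \<rho>H y" if "?P ^ n dvd x - y" for n x y
    using hom_dvd[OF H(1) that] by (simp add: H.hom_power H.hom_of_nat H.hom_minus)
  have uniq: "a = b" if "\<And>n. ?p ^ n dvd a - c n" "\<And>n. ?p ^ n dvd b - c n" for a b and c :: "nat \<Rightarrow> 'a"
    using max_ideal_separated[OF p, of "a - b"] dvd_diff[OF that] by simp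
  have ex: "\<exists>l. \<forall>n. ?p ^ n dvd l - \<rho>H (s n)" if "compatible_family s" for s
    using that by (intro adic_limit[OF p] Hdvd) (simp add: compatible_family_def)
  define g where "g z = (THE l. \<forall>s. compatible_family s \<longrightarrow> z = abs_univ_Rhat s \<longrightarrow> (\<forall>n. ?p ^ n dvd l - \<rho>H (s n)))" for z
  have g: "?p ^ n dvd g z - \<rho>H (s n)" if s: "compatible_family s" "z = abs_univ_Rhat s" for z s n
  proof -
    obtain l where l: "\<And>n. ?p ^ n dvd l - \<rho>H (s n)" using ex[OF s(1)] by blast
    have "\<forall>t. compatible_family t \<longrightarrow> z = abs_univ_Rhat t \<longrightarrow> (\<forall>n. ?p ^ n dvd l - \<rho>H (t n))"
    proof (intro allI impI)
      fix t n assume t: "compatible_family t" "z = abs_univ_Rhat t"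
      have "?P ^ n dvd s n - t n" using s t abs_Rhat_eq_iff by metis
      from dvd_add[OF l[of n] Hdvd[OF this]] show "?p ^ n dvd l - \<rho>H (t n)" by simp
    qed
    hence "\<forall>t. compatible_family t \<longrightarrow> z = abs_univ_Rhat t \<longrightarrow> (\<forall>n. ?p ^ n dvd g z - \<rho>H (t n))"
      unfolding g_def
    proof (rule theI)
      fix k assume "\<forall>t. compatible_family t \<longrightarrow> z = abs_univ_Rhat t \<longrightarrow> (\<forall>n. ?p ^ n dvd k - \<rho>H (t n))"
      hence "?p ^ n dvd k - \<rho>H (s n)" for n using s by blast
      thus "k = l" by (rule uniq) (rule l)
    qed
    thus ?thesis using s by blast
  qed
  have "comm_ring_hom g"
  proof
    fix x y :: "'p univ_Rhat"
    obtain s where s: "compatible_family s" "x = abs_univ_Rhat s" by (rule Rhat_cases)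
    obtain t where t: "compatible_family t" "y = abs_univ_Rhat t" by (rule Rhat_cases)
    show "g (x + y) = g x + g y"
    proof (rule uniq)
      show "?p ^ n dvd g (x + y) - \<rho>H (s n + t n)" for n
        by (rule g[OF compatible_add[OF s(1) t(1)]]) (simp add: s t abs_Rhat_add)
      show "?p ^ n dvd g x + g y - \<rho>H (s n + t n)" for n
        unfolding H.hom_add by (intro dvd_diff_add g s t)
    qed
    show "g (x * y) = g x * g y"
    proof (rule uniq)
      show "?p ^ n dvd g (x * y) - \<rho>H (s n * t n)" for n
        by (rule g[OF compatible_mult[OF s(1) t(1)]]) (simp add: s t abs_Rhat_mult)
      show "?p ^ n dvd g x * g y - \<rho>H (s n * t n)" for n
        unfolding H.hom_mult by (intro dvd_diff_mult g s t)
    qed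
    show "g 1 = 1"
      by (rule uniq[where c = "\<lambda>_. \<rho>H 1"], rule g[of "\<lambda>_. 1"]) (simp_all add: one_univ_Rhat_def)
    show "g 0 = 0"
      by (rule uniq[where c = "\<lambda>_. \<rho>H 0"], rule g[of "\<lambda>_. 0"]) (simp_all add: zero_univ_Rhat_def)
  qed
  moreover have "g (R_to_Rhat r) = \<rho> r" for r
    by (rule uniq[where c = "\<lambda>_. \<rho>H (R_to_RH r)"], rule g[of "\<lambda>_. R_to_RH r"])
      (simp_all add: R_to_Rhat_def RH_to_Rhat_def H)
  moreover have "f = g" if f: "comm_ring_hom f" "\<forall>r. f (R_to_Rhat r) = \<rho> r" for f
  proof
    fix z :: "'p univ_Rhat"
    interpret f: comm_ring_hom f by (rule f)
    have "comm_ring_hom (\<lambda>x. f (RH_to_Rhat x))"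
      by unfold_locales (simp_all add: RH.hom_add RH.hom_mult f.hom_add f.hom_mult)
    hence fH: "(\<lambda>x. f (RH_to_Rhat x)) = \<rho>H" by (rule Huniq) (use f(2) in \<open>simp add: R_to_Rhat_def\<close>)
    obtain s where s: "compatible_family s" "z = abs_univ_Rhat s" by (rule Rhat_cases)
    have "?p ^ n dvd f z - \<rho>H (s n)" for n
      using hom_dvd[OF f(1) Rhat_approx[OF s(1), of n]] fH[THEN fun_cong, of "s n"] s(2)
      by (simp add: f.hom_power f.hom_of_nat f.hom_minus)
    thus "f z = g z" by (rule uniq) (rule g[OF s])
  qed
  ultimately show ?thesis by blast
qed

end

section \<open>From the Laurent series definitions to equations of power series\<close>

lemma fls_inv1_mult:
  assumes "fls_nth f (fls_subdegree f) = (1 :: 'a :: comm_ring_1)" shows "f * fls_inv1 f = 1"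
  unfolding fls_inv1_def by (rule fls_right_inverse) (simp add: assms)

lemma fls_inv1_mult_lead:
  assumes "fps_lead n (1 :: 'a :: comm_ring_1) f" shows "fps_to_fls f * fls_inv1 (fps_to_fls f) = 1"
proof (rule fls_inv1_mult)
  obtain F where F: "f = fps_X ^ n * F" "fps_nth F 0 = 1" using assms unfolding fps_lead_def by blast
  have "subdegree f = n" by (rule subdegreeI) (simp_all add: F fps_X_power_mult_nth)
  thus "fls_nth (fps_to_fls f) (fls_subdegree (fps_to_fls f)) = 1"
    by (simp add: fls_subdegree_fls_to_fps F fps_X_power_mult_nth)
qed

lemma fls_deriv_inverse_pair:
  assumes "f * g = (1 :: 'a :: idom fls)" shows "fls_deriv g = - fls_deriv f * g ^ 2"
proof -
  have "f * fls_deriv g + fls_deriv f * g = 0" using arg_cong[OF assms, of fls_deriv] by simp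
  hence "f * fls_deriv g = - (fls_deriv f * g)" by (simp only: eq_neg_iff_add_eq_0)
  hence "g * (f * fls_deriv g) = g * - (fls_deriv f * g)" by (simp only:)
  hence "(f * g) * fls_deriv g = - fls_deriv f * g ^ 2" by (simp add: mult_ac power2_eq_square)
  thus ?thesis using assms by simp
qed

text \<open>Obtained by differentiating the curve equation. With \<open>x = t / w\<close> and
  \<open>y = - 1 / w\<close> this is \<open>dx / dt = 2 y / J\<close> without denominators.\<close>

lemma weier_w_deriv_J:
  fixes a4 a6 :: "'a :: idom"
  shows "(fps_X * fps_deriv (weier_w a4 a6) - weier_w a4 a6) * weier_J a4 a6 = 2 * weier_w a4 a6"
proof -
  let ?w = "weier_w a4 a6" and ?a = "fps_const a4" and ?b = "fps_const a6"
  define d where "d = fps_deriv ?w"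
  have e: "?w = fps_X ^ 3 + ?a * fps_X * ?w ^ 2 + ?b * ?w ^ 3" using weier_w_eqn[of a4 a6] by (simp add: weier_eqn_def)
  have "d = fps_deriv (fps_X ^ 3 + ?a * fps_X * ?w ^ 2 + ?b * ?w ^ 3)" unfolding d_def using e by simp
  also have "\<dots> = 3 * fps_X ^ 2 + ?a * ?w ^ 2 + 2 * ?a * fps_X * ?w * d + 3 * ?b * ?w ^ 2 * d"
    by (simp add: fps_deriv_power d_def[symmetric] power2_eq_square power3_eq_cube algebra_simps)
  finally have d: "d = 3 * fps_X ^ 2 + ?a * ?w ^ 2 + 2 * ?a * fps_X * ?w * d + 3 * ?b * ?w ^ 2 * d" .
  have "(fps_X * d - ?w) * weier_J a4 a6 - 2 * ?w =
    fps_X * (d - (3 * fps_X ^ 2 + ?a * ?w ^ 2 + 2 * ?a * fps_X * ?w * d + 3 * ?b * ?w ^ 2 * d))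
    - 3 * (?w - (fps_X ^ 3 + ?a * fps_X * ?w ^ 2 + ?b * ?w ^ 3))"
    unfolding weier_J_def by Groebner_Basis.algebra
  also have "\<dots> = 0" using d e by simp
  finally show ?thesis by (simp add: d_def)
qed

context
  fixes a4 a6 :: "'a :: idom"
  assumes two: "(2 :: 'a) \<noteq> 0"
begin

text \<open>The defining description of \<open>weier_W\<close> has only one solution because
  \<open>2 * weier_y\<close> can be cancelled in a domain where 2 is nonzero.\<close>

lemma weier_W_eq: "weier_W a4 a6 = fps_to_fls (weier_omega a4 a6)"
proof -
  let ?w = "weier_w a4 a6" let ?f = "fps_to_fls :: 'a fps \<Rightarrow> 'a fls"
  define i where "i = fls_inv1 (?f ?w)"
  have "fps_lead 3 1 ?w" using fps_lead_weier_w[of fps_X 1 a4 a6] fps_lead_1I[of fps_X 1] by simp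
  hence wi: "?f ?w * i = 1" unfolding i_def by (rule fls_inv1_mult_lead)
  have i0: "i \<noteq> 0" using wi by auto
  have x: "weier_x a4 a6 = fls_X * i" and y: "weier_y a4 a6 = - i"
    by (simp_all add: weier_x_def weier_y_def i_def)
  have "fps_X * fps_deriv ?w - ?w = 2 * ?w * weier_omega a4 a6"
  proof -
    have "(fps_X * fps_deriv ?w - ?w) * (weier_J a4 a6 * weier_omega a4 a6) = 2 * ?w * weier_omega a4 a6"
      unfolding mult.assoc[symmetric] weier_w_deriv_J ..
    thus ?thesis by (simp add: weier_J_omega)
  qed
  from arg_cong[OF this, of ?f]
  have k: "fls_X * fls_deriv (?f ?w) - ?f ?w = 2 * ?f ?w * ?f (weier_omega a4 a6)"
    by (simp add: fls_times_fps_to_fls fls_deriv_fps_to_fls)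
  have "fls_deriv (weier_x a4 a6) = i + fls_X * fls_deriv i"
    unfolding x by (simp add: add.commute)
  also have "\<dots> = (?f ?w * i) * i - fls_X * fls_deriv (?f ?w) * i ^ 2"
    unfolding fls_deriv_inverse_pair[OF wi] by (simp add: wi)
  also have "\<dots> = - (fls_X * fls_deriv (?f ?w) - ?f ?w) * i ^ 2"
    by (simp add: algebra_simps power2_eq_square)
  also have "\<dots> = 2 * (- i) * ?f (weier_omega a4 a6) * (?f ?w * i)"
    unfolding k by (simp add: power2_eq_square mult_ac)
  finally have sol: "2 * weier_y a4 a6 * ?f (weier_omega a4 a6) = fls_deriv (weier_x a4 a6)"
    by (simp add: wi y)
  have two': "(2 :: 'a fls) \<noteq> 0" using two by (metis fls_const_numeral fls_const_nonzero)
  show ?thesis unfolding weier_W_def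
  proof (rule the_equality)
    show "2 * weier_y a4 a6 * ?f (weier_omega a4 a6) = fls_deriv (weier_x a4 a6)" by (rule sol)
    fix W assume "2 * weier_y a4 a6 * W = fls_deriv (weier_x a4 a6)"
    hence "2 * weier_y a4 a6 * W = 2 * weier_y a4 a6 * ?f (weier_omega a4 a6)" using sol by simp
    thus "W = ?f (weier_omega a4 a6)" using two' i0 y by simp
  qed
qed

lemma weier_D_eq: "weier_D a4 a6 h = fls_deriv h * fps_to_fls (weier_J a4 a6)"
proof -
  let ?o = "fps_to_fls (weier_omega a4 a6)"
  have "fps_lead 0 1 (weier_omega a4 a6)" by (simp add: fps_lead_def)
  hence 1: "?o * fls_inv1 ?o = 1" by (rule fls_inv1_mult_lead)
  have 2: "?o * fps_to_fls (weier_J a4 a6) = 1"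
    using weier_J_omega[of a4 a6] by (simp add: mult.commute flip: fls_times_fps_to_fls)
  have "?o * fls_inv1 ?o = ?o * fps_to_fls (weier_J a4 a6)" using 1 2 by simp
  moreover have "?o \<noteq> 0" using 1 by auto
  ultimately have "fls_inv1 ?o = fps_to_fls (weier_J a4 a6)" by simp
  thus ?thesis by (simp add: weier_D_def weier_W_eq)
qed

text \<open>Multiplying the defining equation by \<open>w * s ^ 2\<close> removes both Laurent
  inverses.\<close>

lemma sigma_ode:
  assumes s: "odd_with_lead_t s"
    and eq: "weier_D a4 a6 (weier_D a4 a6 (fps_to_fls s) * fls_inv1 (fps_to_fls s)) + weier_x a4 a6 = fls_const c"
    and q: "q = weier_J a4 a6 * fps_deriv s"
  shows "weier_J a4 a6 * weier_w a4 a6 * (fps_deriv q * s - q * fps_deriv s)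
      = (fps_const c * weier_w a4 a6 - fps_X) * s ^ 2"
proof -
  let ?w = "weier_w a4 a6" let ?f = "fps_to_fls :: 'a fps \<Rightarrow> 'a fls"
  define i where "i = fls_inv1 (?f ?w)"
  have "fps_lead 3 1 ?w" using fps_lead_weier_w[of fps_X 1 a4 a6] fps_lead_1I[of fps_X 1] by simp
  hence wi: "?f ?w * i = 1" unfolding i_def by (rule fls_inv1_mult_lead)
  define j where "j = fls_inv1 (?f s)"
  have "fps_lead 1 1 s" using s unfolding odd_with_lead_t_def by (intro fps_lead_1I) auto
  hence sj: "?f s * j = 1" unfolding j_def by (rule fls_inv1_mult_lead)
  have Ds: "weier_D a4 a6 (?f s) = ?f q"
    by (simp add: weier_D_eq q fls_deriv_fps_to_fls fls_times_fps_to_fls mult.commute)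
  have "fls_deriv (?f q * j) * ?f (weier_J a4 a6) + fls_X * i = fls_const c"
    using eq unfolding Ds j_def[symmetric] unfolding weier_D_eq weier_x_def i_def[symmetric] .
  hence "(?f q * (- fls_deriv (?f s) * j ^ 2) + fls_deriv (?f q) * j) * ?f (weier_J a4 a6) + fls_X * i = fls_const c"
    by (simp only: fls_deriv_mult fls_deriv_inverse_pair[OF sj])
  hence "?f ?w * ?f s ^ 2 * ((?f q * (- fls_deriv (?f s) * j ^ 2) + fls_deriv (?f q) * j) * ?f (weier_J a4 a6) + fls_X * i)
    = ?f ?w * ?f s ^ 2 * fls_const c" by (simp only:)
  moreover have "?f ?w * ?f s ^ 2 * ((?f q * (- fls_deriv (?f s) * j ^ 2) + fls_deriv (?f q) * j) * ?f (weier_J a4 a6) + fls_X * i)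
    = ?f ?w * ?f (weier_J a4 a6) * (?f q * (- fls_deriv (?f s)) * (?f s * j) ^ 2 + fls_deriv (?f q) * ?f s * (?f s * j))
      + fls_X * ?f s ^ 2 * (?f ?w * i)"
    by (simp add: algebra_simps power2_eq_square)
  ultimately have "?f ?w * ?f (weier_J a4 a6) * (?f q * (- fls_deriv (?f s)) + fls_deriv (?f q) * ?f s)
      + fls_X * ?f s ^ 2 = ?f ?w * ?f s ^ 2 * fls_const c"
    by (simp only: wi sj power_one mult_1_right)
  hence "?f (?w * weier_J a4 a6 * (q * (- fps_deriv s) + fps_deriv q * s) + fps_X * s ^ 2) = ?f (?w * s ^ 2 * fps_const c)"
    by (simp add: fls_times_fps_to_fls fls_deriv_fps_to_fls fps_to_fls_power)
  hence "?w * weier_J a4 a6 * (q * (- fps_deriv s) + fps_deriv q * s) + fps_X * s ^ 2 = ?w * s ^ 2 * fps_const c"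
    by (simp only: fps_to_fls_eq_iff)
  thus ?thesis by (simp add: algebra_simps)
qed

end

section \<open>Multiplication in the formal group\<close>

text \<open>Starting from \<open>fps_X\<close> keeps the recursion away from sums with the zero
  series, which the lemmas on the invariant differential exclude.\<close>

fun formal_multiple :: "'a :: comm_ring_1 \<Rightarrow> 'a \<Rightarrow> nat \<Rightarrow> 'a fps" where
  "formal_multiple a4 a6 0 = 0"
| "formal_multiple a4 a6 (Suc 0) = fps_X"
| "formal_multiple a4 a6 (Suc (Suc n)) = formal_sum a4 a6 fps_X (formal_multiple a4 a6 (Suc n))"

lemma formal_multiple_nth_0 [simp]: "fps_nth (formal_multiple a4 (a6 :: 'a :: idom) n) 0 = 0"
  by (induction a4 a6 n rule: formal_multiple.induct) (auto simp: formal_sum_nth_0)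

lemma formal_multiple_nth_1: "fps_nth (formal_multiple a4 (a6 :: 'a :: idom) n) 1 = of_nat n"
proof (induction a4 a6 n rule: formal_multiple.induct)
  case (3 a4 a6 n)
  show ?case unfolding formal_multiple.simps
    by (subst formal_sum_nth_1) (use 3 in \<open>auto\<close>)
qed auto

lemma fps_map_coeffs_formal_multiple:
  fixes h :: "'a :: idom \<Rightarrow> 'b :: idom"
  assumes "comm_ring_hom h"
  shows "fps_map_coeffs h (formal_multiple a4 a6 n) = formal_multiple (h a4) (h a6) n"
proof -
  interpret comm_ring_hom "fps_map_coeffs h" by (rule comm_ring_hom_fps_map_coeffs[OF assms])
  show ?thesis
    by (induction a4 a6 n rule: formal_multiple.induct)
      (simp_all add: fps_map_coeffs_formal_sum[OF assms] fps_map_coeffs_X[OF assms])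
qed

lemma fps_map_to_fract_inj: "fps_map_coeffs to_fract f = fps_map_coeffs to_fract g \<Longrightarrow> f = g"
  by (simp add: fps_eq_iff)

context
  fixes a4 a6 :: "'a :: {idom, ring_char_0}"
begin

lemma formal_sum_invariant_diff':
  assumes uv: "fps_nth u 0 = 0" "fps_nth v 0 = 0" "u \<noteq> 0" "v \<noteq> 0" "u \<noteq> - v"
  shows "(weier_omega a4 a6 oo formal_sum a4 a6 u v) * fps_deriv (formal_sum a4 a6 u v)
    = (weier_omega a4 a6 oo u) * fps_deriv u + (weier_omega a4 a6 oo v) * fps_deriv v"
proof (rule fps_map_to_fract_inj)
  let ?f = "to_fract :: 'a \<Rightarrow> 'a fract" let ?h = "fps_map_coeffs ?f"
  note hf = comm_ring_hom_to_fract[where 'a = 'a]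
  interpret h: comm_ring_hom ?h by (rule comm_ring_hom_fps_map_coeffs[OF hf])
  have "?h u \<noteq> ?h 0" "?h v \<noteq> ?h 0" "?h u \<noteq> ?h (- v)" using uv(3-5) fps_map_to_fract_inj by blast+
  hence "?h u \<noteq> 0" "?h v \<noteq> 0" "?h u \<noteq> - ?h v" by (simp_all add: h.hom_uminus)
  from formal_sum_invariant_diff[OF _ _ this, of "?f a4" "?f a6"] uv(1,2)
  show "?h ((weier_omega a4 a6 oo formal_sum a4 a6 u v) * fps_deriv (formal_sum a4 a6 u v))
    = ?h ((weier_omega a4 a6 oo u) * fps_deriv u + (weier_omega a4 a6 oo v) * fps_deriv v)"
    by (simp add: h.hom_mult h.hom_add fps_map_coeffs_compose[OF hf] fps_map_coeffs_weier_omega[OF hf]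
      fps_map_coeffs_deriv[OF hf] fps_map_coeffs_formal_sum[OF hf])
qed

text \<open>The formal logarithm \<open>\<integral> \<omega>\<close> is invertible under composition, so a point of the formal group is
  determined by the pullback of the invariant differential.\<close>

lemma invariant_diff_inj:
  assumes "fps_nth g 0 = 0" "fps_nth h 0 = 0"
    and "(weier_omega a4 a6 oo g) * fps_deriv g = (weier_omega a4 a6 oo h) * fps_deriv h"
  shows "g = h"
proof (rule fps_map_to_fract_inj)
  let ?f = "to_fract :: 'a \<Rightarrow> 'a fract" let ?m = "fps_map_coeffs ?f"
  note hf = comm_ring_hom_to_fract[where 'a = 'a]
  interpret m: comm_ring_hom ?m by (rule comm_ring_hom_fps_map_coeffs[OF hf])
  define W where "W = weier_omega (?f a4) (?f a6)"
  define L where "L = fps_integral0 W"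
  have L: "fps_nth L 0 = 0" "fps_nth L 1 \<noteq> 0" "fps_deriv L = W"
    using fps_deriv_fps_integral[of W 0] by (simp_all add: L_def W_def fps_integral_def)
  have g0: "fps_nth (?m g) 0 = 0" "fps_nth (?m h) 0 = 0" using assms by simp_all
  have "(W oo ?m g) * fps_deriv (?m g) = (W oo ?m h) * fps_deriv (?m h)"
    using arg_cong[OF assms(3), of ?m] unfolding W_def
    by (simp add: m.hom_mult fps_map_coeffs_compose[OF hf] fps_map_coeffs_weier_omega[OF hf] fps_map_coeffs_deriv[OF hf])
  hence "fps_deriv (L oo ?m g) = fps_deriv (L oo ?m h)"
    unfolding fps_compose_deriv[OF g0(1)] fps_compose_deriv[OF g0(2)] L(3) .
  hence eq: "L oo ?m g = L oo ?m h"
    using L(1) by (simp add: fps_deriv_eq_iff)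
  have "?m g = (fps_inv L oo L) oo ?m g" using L assms(1,2) by (simp add: fps_inv)
  also have "\<dots> = fps_inv L oo (L oo ?m g)" using L assms(1,2) by (simp add: fps_compose_assoc)
  also have "\<dots> = fps_inv L oo (L oo ?m h)" by (simp only: eq)
  also have "\<dots> = (fps_inv L oo L) oo ?m h" using L assms(1,2) by (simp add: fps_compose_assoc)
  also have "\<dots> = ?m h" using L assms(1,2) by (simp add: fps_inv)
  finally show "?m g = ?m h" .
qed

lemma formal_multiple_nonzero: assumes "n > 0" shows "formal_multiple a4 a6 n \<noteq> 0"
proof
  assume "formal_multiple a4 a6 n = 0"
  hence "of_nat n = (0 :: 'a)" using formal_multiple_nth_1[of a4 a6 n] by simp
  thus False using assms by simp
qed

lemma formal_multiple_neq: assumes "m \<noteq> n" shows "formal_multiple a4 a6 m \<noteq> formal_multiple a4 a6 n"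
proof
  assume "formal_multiple a4 a6 m = formal_multiple a4 a6 n"
  hence "of_nat m = (of_nat n :: 'a)" by (metis formal_multiple_nth_1)
  thus False using assms by simp
qed

lemma formal_multiple_neq_uminus:
  assumes "m > 0" shows "formal_multiple a4 a6 m \<noteq> - formal_multiple a4 a6 n"
proof
  assume "formal_multiple a4 a6 m = - formal_multiple a4 a6 n"
  hence "of_nat m = - (of_nat n :: 'a)" by (metis formal_multiple_nth_1 fps_neg_nth)
  hence "of_nat (m + n) = (0 :: 'a)" by (simp add: eq_neg_iff_add_eq_0)
  thus False using assms by (simp only: of_nat_eq_0_iff)
qed

text \<open>Induction with the additivity of \<open>\<omega>\<close>. The factor \<open>n\<close>
  gives access to the coefficients of \<open>[p]\<close> modulo \<open>p\<close>.\<close>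

lemma formal_multiple_invariant_diff:
  assumes "n > 0"
  shows "(weier_omega a4 a6 oo formal_multiple a4 a6 n) * fps_deriv (formal_multiple a4 a6 n)
    = of_nat n * weier_omega a4 a6"
  using assms
proof (induction n rule: nat_induct_non_zero)
  case 1 show ?case by simp
next
  case (Suc n)
  then obtain k where k: "n = Suc k" by (cases n) auto
  have "(fps_X :: 'a fps) \<noteq> - formal_multiple a4 a6 n"
    using formal_multiple_neq_uminus[of 1 n] by simp
  thus ?case unfolding k formal_multiple.simps
    using Suc formal_multiple_nonzero[OF Suc(1)] unfolding k
    by (subst formal_sum_invariant_diff') (auto simp: algebra_simps)
qed

text \<open>Takes the place of associativity: both sides pull \<open>\<omega>\<close> back to
  \<open>(n + m) \<omega>\<close>, and \<open>invariant_diff_inj\<close> identifies them.\<close>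

lemma formal_sum_multiples_char_0:
  assumes "m > 0" "n > 0"
  shows "formal_sum a4 a6 (formal_multiple a4 a6 n) (formal_multiple a4 a6 m) = formal_multiple a4 a6 (n + m)"
proof (rule invariant_diff_inj)
  show "(weier_omega a4 a6 oo formal_sum a4 a6 (formal_multiple a4 a6 n) (formal_multiple a4 a6 m)) *
    fps_deriv (formal_sum a4 a6 (formal_multiple a4 a6 n) (formal_multiple a4 a6 m)) =
    (weier_omega a4 a6 oo formal_multiple a4 a6 (n + m)) * fps_deriv (formal_multiple a4 a6 (n + m))"
    using assms formal_multiple_nonzero formal_multiple_neq_uminus
    by (subst formal_sum_invariant_diff') (auto simp: formal_multiple_invariant_diff distrib_right)
qed (auto simp: formal_sum_nth_0)

lemma formal_diff_multiples_char_0: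
  assumes "m > 0" "m < n"
  shows "formal_sum a4 a6 (formal_multiple a4 a6 n) (- formal_multiple a4 a6 m) = formal_multiple a4 a6 (n - m)"
proof (rule invariant_diff_inj)
  show "(weier_omega a4 a6 oo formal_sum a4 a6 (formal_multiple a4 a6 n) (- formal_multiple a4 a6 m)) *
    fps_deriv (formal_sum a4 a6 (formal_multiple a4 a6 n) (- formal_multiple a4 a6 m)) =
    (weier_omega a4 a6 oo formal_multiple a4 a6 (n - m)) * fps_deriv (formal_multiple a4 a6 (n - m))"
    using assms formal_multiple_nonzero formal_multiple_neq[of n m]
    by (subst formal_sum_invariant_diff')
      (auto simp: formal_multiple_invariant_diff weier_omega_compose_uminus left_diff_distrib of_nat_diff)
qed (auto simp: formal_sum_nth_0)

end

definition poly_eval_hom :: "('a \<Rightarrow> 'b :: comm_ring_1) \<Rightarrow> 'b \<Rightarrow> 'a :: comm_ring_1 poly \<Rightarrow> 'b" where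
  "poly_eval_hom h b r = poly (map_poly h r) b"

lemma comm_ring_hom_poly_eval:
  assumes "comm_ring_hom h" shows "comm_ring_hom (poly_eval_hom h b)"
proof -
  interpret comm_ring_hom h by fact
  interpret m: map_poly_comm_ring_hom h ..
  show ?thesis by unfold_locales (simp_all add: poly_eval_hom_def m.hom_add m.hom_mult)
qed

lemma poly_eval_hom_const: assumes "comm_ring_hom h" shows "poly_eval_hom h b [:c:] = h c"
proof -
  interpret comm_ring_hom h by fact
  show ?thesis by (cases "c = 0") (simp_all add: poly_eval_hom_def map_poly_pCons)
qed

lemma poly_eval_hom_X: assumes "comm_ring_hom h" shows "poly_eval_hom h b [:0, 1:] = b"
proof -
  interpret comm_ring_hom h by fact
  show ?thesis by (simp add: poly_eval_hom_def map_poly_pCons)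
qed

abbreviation (input) "U4 \<equiv> [:[:0, 1 :: int:]:]"
abbreviation (input) "U6 \<equiv> [:0, 1 :: int poly:]"

text \<open>By this map, identities and congruences proved over \<open>Z[A4, A6]\<close> in
  characteristic 0 hold for given coefficients in a domain of any characteristic.\<close>

lemma int_poly_poly_hom_exists:
  "\<exists>h :: int poly poly \<Rightarrow> 'a :: comm_ring_1. comm_ring_hom h \<and> h U4 = a4 \<and> h U6 = a6"
proof -
  have i: "comm_ring_hom (of_int :: int \<Rightarrow> 'a)" by unfold_locales auto
  have j: "comm_ring_hom (poly_eval_hom (of_int :: int \<Rightarrow> 'a) a4)" by (rule comm_ring_hom_poly_eval[OF i])
  show ?thesis
    by (intro exI[of _ "poly_eval_hom (poly_eval_hom of_int a4) a6"] conjI comm_ring_hom_poly_eval[OF j])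
      (simp_all only: poly_eval_hom_const[OF j] poly_eval_hom_X[OF i] poly_eval_hom_X[OF j])
qed

lemma formal_sum_multiples:
  fixes a4 a6 :: "'a :: idom"
  assumes "m > 0" "n > 0"
  shows "formal_sum a4 a6 (formal_multiple a4 a6 n) (formal_multiple a4 a6 m) = formal_multiple a4 a6 (n + m)"
proof -
  obtain h :: "int poly poly \<Rightarrow> 'a" where h: "comm_ring_hom h" "h U4 = a4" "h U6 = a6"
    using int_poly_poly_hom_exists by blast
  show ?thesis
    using arg_cong[OF formal_sum_multiples_char_0[OF assms, of U4 U6], of "fps_map_coeffs h"]
    by (simp only: fps_map_coeffs_formal_sum[OF h(1)] formal_multiple_nth_0 fps_map_coeffs_formal_multiple[OF h(1)] h(2,3))
qed

lemma formal_diff_multiples: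
  fixes a4 a6 :: "'a :: idom"
  assumes "m > 0" "m < n"
  shows "formal_sum a4 a6 (formal_multiple a4 a6 n) (- formal_multiple a4 a6 m) = formal_multiple a4 a6 (n - m)"
proof -
  obtain h :: "int poly poly \<Rightarrow> 'a" where h: "comm_ring_hom h" "h U4 = a4" "h U6 = a6"
    using int_poly_poly_hom_exists by blast
  interpret m: comm_ring_hom "fps_map_coeffs h" by (rule comm_ring_hom_fps_map_coeffs[OF h(1)])
  have "fps_nth (- formal_multiple U4 U6 m) 0 = 0" by simp
  thus ?thesis
    using arg_cong[OF formal_diff_multiples_char_0[OF assms, of U4 U6], of "fps_map_coeffs h"]
    by (simp only: fps_map_coeffs_formal_sum[OF h(1)] formal_multiple_nth_0 fps_map_coeffs_formal_multiple[OF h(1)] h(2,3) m.hom_uminus)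
qed

text \<open>Repeated \<open>ec_add\<close> follows the formal multiples until an intermediate
  multiple is the negative of the generic point, where the sum would be \<open>Origin\<close>;
  \<open>ne\<close> excludes this.\<close>

lemma formal_mult_eq:
  fixes a4 a6 :: "'a :: idom"
  assumes two: "(2 :: 'a) \<noteq> 0" and n: "n > 0"
    and ne: "\<And>j. 0 < j \<Longrightarrow> j < n \<Longrightarrow> formal_multiple a4 a6 j \<noteq> - fps_X"
  shows "ec_mult (fls_const (to_fract a4)) n
       (Affine (weier_x (to_fract a4) (to_fract a6)) (weier_y (to_fract a4) (to_fract a6)))
     = weier_point (to_fract a4) (to_fract a6) (formal_multiple (to_fract a4) (to_fract a6) n)"
    and "formal_multiple (to_fract a4) (to_fract a6) n \<noteq> 0"
proof -
  let ?f = "to_fract :: 'a \<Rightarrow> 'a fract"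
  note hf = comm_ring_hom_to_fract[where 'a = 'a]
  interpret m: comm_ring_hom "fps_map_coeffs ?f" by (rule comm_ring_hom_fps_map_coeffs[OF hf])
  let ?g = "formal_multiple (?f a4) (?f a6)" and ?w = "weier_w (?f a4) (?f a6)"
  have "fps_lead 3 1 ?w" using fps_lead_weier_w[of fps_X 1 "?f a4" "?f a6"] fps_lead_1I[of fps_X 1] by simp
  from fls_inv1_mult_lead[OF this] have "fls_inv1 (fps_to_fls ?w) = inverse (fps_to_fls ?w)"
    by (metis inverse_unique)
  hence P: "Affine (weier_x (?f a4) (?f a6)) (weier_y (?f a4) (?f a6)) = weier_point (?f a4) (?f a6) fps_X"
    by (simp add: weier_x_def weier_y_def divide_inverse)
  have two': "(2 :: 'a fract) \<noteq> 0" using two by (metis to_fract_eq_0_iff to_fract_add to_fract_1 one_add_one)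
  have ne': "?g j \<noteq> - fps_X" if "0 < j" "j < n" for j
  proof
    assume "?g j = - fps_X"
    hence "fps_map_coeffs ?f (formal_multiple a4 a6 j) = fps_map_coeffs ?f (- fps_X)"
      by (simp add: fps_map_coeffs_formal_multiple[OF hf] m.hom_uminus fps_map_coeffs_X[OF hf])
    hence "formal_multiple a4 a6 j = - fps_X" by (rule fps_map_to_fract_inj)
    thus False using ne that by blast
  qed
  have "k \<le> n \<Longrightarrow> ec_mult (fls_const (?f a4)) k (weier_point (?f a4) (?f a6) fps_X) = weier_point (?f a4) (?f a6) (?g k) \<and> ?g k \<noteq> 0"
    if "k > 0" for k
    using that
  proof (induction k rule: nat_induct_non_zero)
    case 1 show ?case by simp
  next
    case (Suc k)
    then obtain i where i: "k = Suc i" by (cases k) auto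
    have ih: "ec_mult (fls_const (?f a4)) k (weier_point (?f a4) (?f a6) fps_X) = weier_point (?f a4) (?f a6) (?g k)"
      "?g k \<noteq> 0" using Suc by auto
    have x: "fps_X \<noteq> - ?g k" using ne'[of k] Suc by (metis Suc_le_lessD add.inverse_inverse)
    have g: "?g (Suc k) = formal_sum (?f a4) (?f a6) fps_X (?g k)" by (simp add: i)
    show ?case
      unfolding g ec_mult.simps ih(1)
      using ec_add_weier_point(1)[OF _ _ _ ih(2) x two', of "?f a4" "?f a6"] formal_sum_nonzero[OF _ _ _ ih(2) x two', of "?f a4" "?f a6"]
      by simp
  qed
  from this[OF n order_refl] show
    "ec_mult (fls_const (?f a4)) n (Affine (weier_x (?f a4) (?f a6)) (weier_y (?f a4) (?f a6))) = weier_point (?f a4) (?f a6) (?g n)"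
    "?g n \<noteq> 0" unfolding P by blast+
qed

section \<open>The Hasse invariant\<close>

definition hasse_coeff :: "nat \<Rightarrow> 'a :: comm_ring_1 \<Rightarrow> 'a \<Rightarrow> 'a" where
  "hasse_coeff p a4 a6 = coeff ([:a6, a4, 0, 1:] ^ ((p - 1) div 2)) (p - 1)"

lemma hasse_eq: "hasse p = hasse_coeff p A4 A6" by (simp add: hasse_def hasse_coeff_def)

lemma hasse_coeff_hom:
  assumes "comm_ring_hom h" shows "h (hasse_coeff p a4 a6) = hasse_coeff p (h a4) (h a6)"
proof -
  interpret comm_ring_hom h by fact
  interpret m: map_poly_comm_ring_hom h ..
  have "map_poly h [:a6, a4, 0, 1:] = [:h a6, h a4, 0, 1:]"
    by (intro poly_eqI) (simp add: coeff_map_poly coeff_pCons split: nat.split)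
  hence "map_poly h ([:a6, a4, 0, 1:] ^ n) = [:h a6, h a4, 0, 1:] ^ n" for n
    by (simp only: m.hom_power)
  thus ?thesis unfolding hasse_coeff_def by (metis coeff_map_poly hom_zero)
qed

lemma of_nat_eq_0_imp_dvd:
  assumes "prime p" "of_nat p = (0 :: 'a :: comm_ring_1)" "of_nat n = (0 :: 'a)" shows "p dvd n"
proof (rule ccontr)
  assume "\<not> p dvd n"
  hence "coprime (int p) (int n)" using assms(1) by (simp add: prime_imp_coprime)
  then obtain x y where "int p * x + int n * y = 1" using bezout_int[of "int p" "int n"] by (auto simp: mult.commute)
  hence "of_int (int p * x + int n * y) = (1 :: 'a)" by simp
  thus False using assms(2,3) by simp
qed

text \<open>Since \<open>y\<^sup>2 = f(x)\<close>, the differential is \<open>y\<^sup>-\<^sup>p f(x)\<^bsup>(p-1)/2\<^esup> dx / 2\<close>. In characteristic \<open>p\<close> the factor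
  \<open>y\<^sup>-\<^sup>p\<close> is a constant for the derivation, and \<open>x\<^sup>j dx\<close> is exact unless \<open>j = p - 1\<close>; exact forms do not
  contribute to the coefficient of \<open>t\<^bsup>p-1\<^esup>\<close>.\<close>

lemma omega_coeff_char_p:
  fixes a4 a6 :: "'k :: field"
  assumes p: "prime p" "p > 3" and char: "of_nat p = (0 :: 'k)"
  shows "fps_nth (weier_omega a4 a6) (p - 1) = hasse_coeff p a4 a6"
proof -
  define m where "m = (p - 1) div 2"
  have "odd p" using p prime_odd_nat by auto
  hence pm: "p - 1 = 2 * m" "p = Suc (2 * m)" unfolding m_def by (auto elim: oddE)
  let ?w = "fps_to_fls (weier_w a4 a6)" let ?o = "fps_to_fls (weier_omega a4 a6)"
  define x where "x = fls_X / ?w"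
  define y where "y = - 1 / ?w"
  have w0: "?w \<noteq> 0" using weier_w_compose_nonzero[of fps_X a4 a6] by simp
  have curve: "y ^ 2 = x ^ 3 + fls_const a4 * x + fls_const a6"
    using weier_point_on_curve[of fps_X a4 a6] by (simp add: x_def y_def)
  have dx: "fls_deriv x = 2 * y * ?o"
    using fls_weier_deriv(1)[of fps_X a4 a6] by (simp add: x_def y_def)
  define f where "f = [:a6, a4, 0, 1:] ^ m"
  interpret c: comm_ring_hom "fls_const :: 'k \<Rightarrow> 'k fls" by unfold_locales (auto simp: fls_plus_const)
  interpret mc: map_poly_comm_ring_hom "fls_const :: 'k \<Rightarrow> 'k fls" ..
  have "y ^ (p - 1) = (y ^ 2) ^ m" unfolding pm(1) power_mult ..
  also have "y ^ 2 = poly (map_poly fls_const [:a6, a4, 0, 1:]) x"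
    unfolding curve by (simp add: map_poly_pCons power3_eq_cube algebra_simps)
  also have "\<dots> ^ m = poly (map_poly fls_const f) x" unfolding f_def by (simp add: mc.hom_power poly_power)
  also have "\<dots> = (\<Sum>j\<le>3 * m. fls_const (coeff f j) * x ^ j)"
  proof -
    have "degree f \<le> 3 * m" unfolding f_def
      by (rule order_trans[OF degree_power_le]) (simp add: mult.commute)
    hence "degree (map_poly fls_const f) \<le> 3 * m" by (meson degree_map_poly_le order_trans)
    moreover have le: "i \<le> degree (map_poly fls_const f)" if "coeff f i \<noteq> 0" for i
      using that by (intro le_degree) simp
    ultimately show ?thesis by (subst poly_altdef, subst sum.mono_neutral_left[of "{..3 * m}" "{..degree (map_poly fls_const f)}"])
      (auto simp: coeff_eq_0 dest: le)
  qed
  finally have yp: "y ^ (p - 1) = (\<Sum>j\<le>3 * m. fls_const (coeff f j) * x ^ j)" .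
  have wy: "?w * y = - 1" using w0 by (simp add: y_def)
  \<comment> \<open>As \<open>w * y = - 1\<close> and \<open>p - 1\<close> is even, this factor is
    1; inserting it creates the \<open>p\<close>-th power of \<open>w\<close>.\<close>
  have "?w ^ (p - 1) * y ^ (p - 1) = (?w * y) ^ (p - 1)" by (simp add: power_mult_distrib)
  also have "\<dots> = 1" unfolding wy pm(1) by simp
  finally have wyp: "?w ^ (p - 1) * y ^ (p - 1) = 1" .
  have wp: "?w ^ p = ?w * ?w ^ (p - 1)" using pm(2) by (metis power_Suc diff_Suc_1)
  have wdx: "?w * fls_deriv x = - (2 * ?o)"
  proof -
    have "?w * fls_deriv x = 2 * (?w * y) * ?o" unfolding dx by (simp only: mult_ac)
    thus ?thesis unfolding wy by simp
  qed
  have "2 * ?o = - (?w * fls_deriv x) * (?w ^ (p - 1) * y ^ (p - 1))"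
    unfolding wyp wdx by simp
  also have "\<dots> = - (?w ^ p * fls_deriv x * y ^ (p - 1))" unfolding wp by (simp only: mult_ac mult_minus_left mult_minus_right)
  also have "\<dots> = - (\<Sum>j\<le>3 * m. fls_const (coeff f j) * (?w ^ p * x ^ j * fls_deriv x))"
    unfolding yp sum_distrib_left by (simp only: mult_ac)
  finally have eq: "2 * ?o = - (\<Sum>j\<le>3 * m. fls_const (coeff f j) * (?w ^ p * x ^ j * fls_deriv x))" .
  have charL: "of_nat p = (0 :: 'k fls)" using char c.hom_of_nat[of p] by simp
  \<comment> \<open>The coefficient of \<open>t ^ (p - 1)\<close> in a derivative is a multiple of
    \<open>p\<close>. For \<open>j \<le> 3 * m\<close> one has \<open>j + 1 < 2 * p\<close>, so
    \<open>j + 1\<close> is invertible unless \<open>j = p - 1\<close>.\<close>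
  have exact: "fls_nth (?w ^ p * x ^ j * fls_deriv x) (int p - 1) = 0" if j: "j \<le> 3 * m" "j \<noteq> p - 1" for j
  proof -
    have "fls_deriv (?w ^ p) = 0" by (simp add: fls_deriv_power charL)
    hence "fls_deriv (?w ^ p * x ^ Suc j) = ?w ^ p * (of_nat (Suc j) * x ^ j * fls_deriv x)"
      unfolding fls_deriv_mult fls_deriv_power by simp
    also have "\<dots> = fls_const (of_nat (Suc j)) * (?w ^ p * x ^ j * fls_deriv x)"
      by (simp only: c.hom_of_nat mult_ac)
    finally have "fls_nth (fls_deriv (?w ^ p * x ^ Suc j)) (int p - 1)
      = of_nat (Suc j) * fls_nth (?w ^ p * x ^ j * fls_deriv x) (int p - 1)" by (simp del: of_nat_Suc)
    moreover have "fls_nth (fls_deriv (?w ^ p * x ^ Suc j)) (int p - 1) = 0"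
      unfolding fls_deriv_nth using char by simp
    moreover have "of_nat (Suc j) \<noteq> (0 :: 'k)"
    proof
      assume "of_nat (Suc j) = (0 :: 'k)"
      hence "p dvd Suc j" using of_nat_eq_0_imp_dvd[OF p(1) char] by blast
      then obtain k where k: "Suc j = p * k" by (elim dvdE)
      have "Suc j < p * 2" using j pm p by simp
      hence "k < 2" unfolding k by simp
      moreover have "k \<noteq> 0" using k by (intro notI) simp
      ultimately have "k = 1" by simp
      thus False using k j by simp
    qed
    ultimately show ?thesis by (metis mult_eq_0_iff)
  qed
  \<comment> \<open>For \<open>j = p - 1\<close> all but one factor of \<open>w ^ p\<close> cancels
    against \<open>x = t / w\<close>; what remains is \<open>t ^ (p - 1) * (- 2 \<omega>)\<close>,
    and \<open>\<omega>\<close> has constant term 1.\<close>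
  have main: "fls_nth (?w ^ p * x ^ (p - 1) * fls_deriv x) (int p - 1) = - 2"
  proof -
    have "?w ^ p * x ^ (p - 1) * fls_deriv x = fls_X ^ (p - 1) * (?w * fls_deriv x)"
      unfolding wp x_def power_divide using w0 by simp
    also have "?w * fls_deriv x = - 2 * ?o" using wdx by simp
    also have "fls_X ^ (p - 1) * (- 2 * ?o) = fps_to_fls (fps_X ^ (p - 1) * (- 2 * weier_omega a4 a6))"
      by (simp add: fls_times_fps_to_fls fps_to_fls_power)
    finally have "fls_nth (?w ^ p * x ^ (p - 1) * fls_deriv x) (int p - 1)
      = fls_nth (fps_to_fls (fps_X ^ (p - 1) * (- 2 * weier_omega a4 a6))) (int (p - 1))"
      using p by (simp add: of_nat_diff)
    thus ?thesis unfolding fps_to_fls_nth by (simp only: fps_X_power_mult_nth) simp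
  qed
  have "2 * fps_nth (weier_omega a4 a6) (p - 1) = fls_nth (2 * ?o) (int p - 1)"
  proof -
    have e: "2 * ?o = fps_to_fls (2 * weier_omega a4 a6)" "int p - 1 = int (p - 1)"
      using p by (simp_all add: fls_times_fps_to_fls of_nat_diff)
    show ?thesis unfolding e fps_to_fls_nth mult_2 by simp
  qed
  also have "\<dots> = - (\<Sum>j\<le>3 * m. coeff f j * fls_nth (?w ^ p * x ^ j * fls_deriv x) (int p - 1))"
    unfolding eq by (simp add: fls_nth_sum)
  also have "(\<Sum>j\<le>3 * m. coeff f j * fls_nth (?w ^ p * x ^ j * fls_deriv x) (int p - 1))
    = (\<Sum>j\<in>{p - 1}. coeff f j * fls_nth (?w ^ p * x ^ j * fls_deriv x) (int p - 1))"
  proof (rule sum.mono_neutral_right)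
    show "{p - 1} \<subseteq> {..3 * m}" using pm(1) by simp
  qed (use exact in auto)
  finally have "2 * fps_nth (weier_omega a4 a6) (p - 1) = 2 * coeff f (p - 1)" by (simp add: main[unfolded One_nat_def])
  moreover have "(2 :: 'k) \<noteq> 0"
  proof
    assume "(2 :: 'k) = 0"
    hence "of_nat 2 = (0 :: 'k)" by simp
    hence "p dvd 2" using of_nat_eq_0_imp_dvd[OF p(1) char] by blast
    thus False using p by (auto dest: dvd_imp_le)
  qed
  ultimately show ?thesis by (simp add: hasse_coeff_def f_def m_def)
qed

definition reduce :: "int poly poly \<Rightarrow> 'p :: prime_card_gt3 mod_ring poly poly" where
  "reduce = map_poly (map_poly of_int)"

lemma reduce_hom: "comm_ring_hom (reduce :: int poly poly \<Rightarrow> 'p :: prime_card_gt3 mod_ring poly poly)"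
proof -
  have i: "comm_ring_hom (of_int :: int \<Rightarrow> 'p mod_ring)" by unfold_locales auto
  interpret i: comm_ring_hom "of_int :: int \<Rightarrow> 'p mod_ring" by (rule i)
  interpret j: map_poly_comm_ring_hom "of_int :: int \<Rightarrow> 'p mod_ring" ..
  interpret k: map_poly_comm_ring_hom "map_poly (of_int :: int \<Rightarrow> 'p mod_ring)" ..
  show ?thesis unfolding reduce_def by unfold_locales
qed

lemma reduce_eq_0_iff:
  "reduce r = (0 :: 'p :: prime_card_gt3 mod_ring poly poly) \<longleftrightarrow> of_nat CARD('p) dvd r"
proof -
  have "reduce r = (0 :: 'p mod_ring poly poly) \<longleftrightarrow> (\<forall>i j. of_int (coeff (coeff r i) j) = (0 :: 'p mod_ring))"
    by (simp add: reduce_def poly_eq_iff coeff_map_poly)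
  also have "\<dots> \<longleftrightarrow> (\<forall>i j. int CARD('p) dvd coeff (coeff r i) j)"
    by (simp add: of_int_eq_0_iff_char_dvd)
  also have "\<dots> \<longleftrightarrow> [:[:int CARD('p):]:] dvd r" by (simp add: const_poly_dvd_iff)
  also have "[:[:int CARD('p):]:] = of_nat CARD('p)" by (simp add: of_nat_poly)
  finally show ?thesis .
qed

text \<open>The field case applied to the fraction field of \<open>F_p[A4, A6]\<close>; the kernel
  of reduction from \<open>Z[A4, A6]\<close> is generated by \<open>p\<close>.\<close>

lemma omega_coeff_cong_hasse:
  "of_nat CARD('p :: prime_card_gt3) dvd
     fps_nth (weier_omega U4 U6) (CARD('p) - 1) - hasse_coeff CARD('p) U4 U6"
proof -
  let ?r = "reduce :: int poly poly \<Rightarrow> 'p mod_ring poly poly"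
  let ?h = "\<lambda>x. to_fract (?r x)"
  interpret r: comm_ring_hom ?r by (rule reduce_hom)
  interpret f: comm_ring_hom "to_fract :: 'p mod_ring poly poly \<Rightarrow> _" by (rule comm_ring_hom_to_fract)
  have h: "comm_ring_hom ?h" by unfold_locales (simp_all add: r.hom_add r.hom_mult)
  interpret h: comm_ring_hom ?h by (rule h)
  have "?r (of_nat CARD('p)) = 0" unfolding reduce_eq_0_iff by simp
  hence "of_nat CARD('p) = (0 :: 'p mod_ring poly poly fract)" using h.hom_of_nat[of "CARD('p)"] by simp
  note omega_coeff_char_p[OF prime_card_gt3[where 'p = 'p] this, of "?h U4" "?h U6"]
  moreover have "fps_nth (weier_omega (?h U4) (?h U6)) n = ?h (fps_nth (weier_omega U4 U6) n)" for n
    unfolding fps_map_coeffs_weier_omega[OF h, symmetric] by simp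
  ultimately have "?h (fps_nth (weier_omega U4 U6) (CARD('p) - 1)) = ?h (hasse_coeff CARD('p) U4 U6)"
    by (simp only: hasse_coeff_hom[OF h])
  hence "?r (fps_nth (weier_omega U4 U6) (CARD('p) - 1) - hasse_coeff CARD('p) U4 U6) = 0"
    by (simp only: to_fract_eq_iff r.hom_minus right_minus_eq)
  thus ?thesis by (simp only: reduce_eq_0_iff)
qed

text \<open>Modulo \<open>p\<close> the pullback of \<open>\<omega>\<close> under \<open>[p]\<close>
  is 0, while \<open>\<omega>\<close> composed with \<open>[p]\<close> has constant term 1. So
  \<open>[p]\<close> has derivative 0, and only exponents divisible by \<open>p\<close>
  survive.\<close>

lemma formal_multiple_p_coeff_dvd:
  assumes "n < CARD('p :: prime_card_gt3)"
  shows "of_nat CARD('p) dvd fps_nth (formal_multiple U4 U6 CARD('p)) n"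
proof (cases n)
  case (Suc k)
  let ?r = "reduce :: int poly poly \<Rightarrow> 'p mod_ring poly poly" let ?p = "CARD('p)"
  let ?g = "formal_multiple (?r U4) (?r U6) ?p" and ?o = "weier_omega (?r U4) (?r U6)"
  note p = prime_card_gt3[where 'p = 'p]
  note hr = reduce_hom[where 'p = 'p]
  interpret r: comm_ring_hom ?r by (rule hr)
  interpret m: comm_ring_hom "fps_map_coeffs ?r" by (rule comm_ring_hom_fps_map_coeffs[OF hr])
  have "?r (of_nat ?p) = 0" unfolding reduce_eq_0_iff by simp
  hence char: "of_nat ?p = (0 :: 'p mod_ring poly poly)" using r.hom_of_nat[of "?p"] by simp
  have "of_nat ?p = fps_const (of_nat ?p :: 'p mod_ring poly poly)" by (rule fps_of_nat[symmetric])
  hence char': "of_nat ?p = (0 :: 'p mod_ring poly poly fps)" by (simp add: char)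
  have "(weier_omega U4 U6 oo formal_multiple U4 U6 ?p) * fps_deriv (formal_multiple U4 U6 ?p) = of_nat ?p * weier_omega U4 U6"
    by (rule formal_multiple_invariant_diff) (use p in simp)
  from arg_cong[OF this, of "fps_map_coeffs ?r"] have "(?o oo ?g) * fps_deriv ?g = of_nat ?p * ?o"
    by (simp only: m.hom_mult fps_map_coeffs_compose[OF hr] fps_map_coeffs_weier_omega[OF hr]
      fps_map_coeffs_formal_multiple[OF hr] fps_map_coeffs_deriv[OF hr] m.hom_of_nat)
  hence "(?o oo ?g) * fps_deriv ?g = 0" by (simp only: char' mult_zero_left)
  moreover have "fps_nth (?o oo ?g) 0 = 1" by simp
  hence "?o oo ?g \<noteq> 0" by (metis fps_zero_nth zero_neq_one)
  ultimately have "fps_deriv ?g = 0" by simp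
  hence "fps_nth (fps_deriv ?g) k = 0" by simp
  hence "of_nat n * fps_nth ?g n = 0" by (simp add: Suc)
  moreover have "of_nat n \<noteq> (0 :: 'p mod_ring poly poly)"
  proof
    assume "of_nat n = (0 :: 'p mod_ring poly poly)"
    hence "?p dvd n" using of_nat_eq_0_imp_dvd[OF p(1) char] by blast
    thus False using assms Suc by (auto dest: dvd_imp_le)
  qed
  ultimately have "fps_nth ?g n = 0" by simp
  hence "?r (fps_nth (formal_multiple U4 U6 ?p) n) = 0"
    unfolding fps_map_coeffs_formal_multiple[OF hr, symmetric] by simp
  thus ?thesis by (simp only: reduce_eq_0_iff)
qed simp

text \<open>Coefficients of \<open>t ^ (p - 1)\<close> in \<open>[p]^* \<omega> = p \<omega>\<close>
  are compared modulo \<open>p ^ 2\<close> and then divided by \<open>p\<close>. On the left, the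
  derivative of \<open>[p]\<close> contributes \<open>p\<close> times its coefficient in degree
  \<open>p\<close>; everything else is divisible by \<open>p ^ 2\<close> or by
  \<open>t ^ p\<close>.\<close>

lemma formal_multiple_p_lead_cong:
  "of_nat CARD('p :: prime_card_gt3) dvd
     fps_nth (formal_multiple U4 U6 CARD('p)) CARD('p) - fps_nth (weier_omega U4 U6) (CARD('p) - 1)"
proof -
  let ?p = "CARD('p)"
  define P where "P = (of_nat ?p :: int poly poly fps)"
  define g where "g = formal_multiple U4 U6 ?p"
  define W where "W = weier_omega U4 U6"
  obtain k where k: "?p = Suc k" using prime_card_gt3(2)[where 'p = 'p] by (cases "CARD('p)") auto
  have P: "P = fps_const (of_nat ?p)" unfolding P_def by (rule fps_of_nat[symmetric])
  have "\<forall>i. \<exists>c. i < ?p \<longrightarrow> fps_nth g i = of_nat ?p * c"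
    unfolding g_def using formal_multiple_p_coeff_dvd[where 'p = 'p] by (meson dvdE)
  then obtain \<gamma> where \<gamma>: "\<And>i. i < ?p \<Longrightarrow> fps_nth g i = of_nat ?p * \<gamma> i" by metis
  define G where "G = Abs_fps (\<lambda>i. if i < ?p then \<gamma> i else 0)"
  define r where "r = fps_shift ?p g"
  have g: "g = P * G + fps_X ^ ?p * r"
    by (rule fps_ext) (simp add: P G_def r_def \<gamma> fps_X_power_mult_nth)
  have "of_nat ?p * \<gamma> 0 = 0" using \<gamma>[of 0] k by (simp add: g_def)
  moreover have p0: "(of_nat ?p :: int poly poly) \<noteq> 0" by (simp only: of_nat_eq_0_iff k)
  ultimately have "\<gamma> 0 = 0" by (metis mult_eq_0_iff)
  hence "fps_nth G 0 = 0" using k by (simp add: G_def)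
  then obtain G' where G': "G = fps_X * G'" using fps_X_dvd_iff by (metis dvdE)
  have dP: "fps_deriv P = 0" by (simp add: P)
  define s where "s = of_nat ?p * r + fps_X * fps_deriv r"
  have dg: "fps_deriv g = P * fps_deriv G + fps_X ^ k * s"
  proof -
    have d: "fps_deriv (fps_X ^ ?p :: int poly poly fps) = of_nat ?p * fps_X ^ k"
      unfolding fps_deriv_power by (simp add: k fps_of_nat del: of_nat_Suc)
    have X: "(fps_X ^ ?p :: int poly poly fps) = fps_X ^ k * fps_X" unfolding k by (rule power_Suc2)
    have "fps_deriv g = P * fps_deriv G + (fps_X ^ ?p * fps_deriv r + fps_deriv (fps_X ^ ?p) * r)"
      unfolding g by (simp add: dP)
    thus ?thesis unfolding d unfolding X s_def by (simp only: distrib_left mult_ac add_ac)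
  qed
  \<comment> \<open>In the cross term, the factor \<open>fps_X\<close> of \<open>G\<close> makes up
    for the degree lost in differentiating \<open>fps_X ^ ?p\<close>.\<close>
  have gdg: "g * fps_deriv g = P ^ 2 * (G * fps_deriv G) + fps_X ^ ?p * (P * G' * s + r * fps_deriv g)"
  proof -
    have "g * fps_deriv g = (P * G) * fps_deriv g + fps_X ^ ?p * (r * fps_deriv g)"
      by (subst (1) g) (simp add: algebra_simps)
    also have "(P * G) * fps_deriv g = P ^ 2 * (G * fps_deriv G) + (P * (fps_X * G')) * (fps_X ^ k * s)"
      unfolding dg G'[symmetric] by (simp add: algebra_simps power2_eq_square)
    finally show ?thesis by (simp add: k algebra_simps)
  qed
  have "fps_nth (W - 1) 0 = 0" by (simp add: W_def)
  then obtain T where "W - 1 = fps_X * T" using fps_X_dvd_iff by (metis dvdE)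
  hence T: "W = 1 + fps_X * T" by (simp add: algebra_simps)
  have g0: "fps_nth g 0 = 0" by (simp add: g_def)
  have Wg: "W oo g = 1 + g * (T oo g)"
    by (subst T) (simp add: fps_compose_add_distrib fps_compose_mult_distrib g0)
  have "(W oo g) * fps_deriv g = P * W"
    unfolding W_def g_def P_def by (rule formal_multiple_invariant_diff) (simp add: k)
  hence eq: "fps_deriv g + (T oo g) * (g * fps_deriv g) = P * W" unfolding Wg by (simp add: algebra_simps)
  define A where "A = (T oo g) * (G * fps_deriv G)"
  define B where "B = (T oo g) * (P * G' * s + r * fps_deriv g)"
  have "fps_deriv g + P ^ 2 * A + fps_X ^ ?p * B = P * W"
    using eq unfolding gdg A_def B_def by (simp add: algebra_simps)
  note coeff_k = arg_cong[OF this, of "\<lambda>f. fps_nth f k"]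
  have "of_nat ?p * fps_nth g ?p + of_nat ?p ^ 2 * fps_nth A k = of_nat ?p * fps_nth W k"
  proof -
    have P2: "P ^ 2 = fps_const (of_nat ?p ^ 2)" unfolding P by (rule fps_const_power)
    have "fps_nth (fps_deriv g) k = of_nat ?p * fps_nth g ?p" by (simp add: k)
    moreover have "fps_nth (fps_X ^ ?p * B) k = 0" unfolding fps_X_power_mult_nth by (simp add: k)
    ultimately show ?thesis using coeff_k unfolding P2 unfolding P fps_add_nth fps_mult_left_const_nth by simp
  qed
  hence "of_nat ?p * (fps_nth g ?p - fps_nth W k) = of_nat ?p * (of_nat ?p * (- fps_nth A k))"
    by (simp add: algebra_simps power2_eq_square eq_neg_iff_add_eq_0)
  hence "fps_nth g ?p - fps_nth W k = of_nat ?p * (- fps_nth A k)"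
    using p0 by (metis mult_left_cancel)
  thus ?thesis unfolding g_def W_def by (metis dvd_triv_left k diff_Suc_1)
qed

lemma formal_multiple_p_cong_hasse:
  fixes a4 a6 :: "'a :: idom"
  shows "of_nat CARD('p :: prime_card_gt3) dvd
      fps_nth (formal_multiple a4 a6 CARD('p)) CARD('p) - hasse_coeff CARD('p) a4 a6"
    and "n < CARD('p) \<Longrightarrow> of_nat CARD('p) dvd fps_nth (formal_multiple a4 a6 CARD('p)) n"
proof -
  obtain h :: "int poly poly \<Rightarrow> 'a" where h: "comm_ring_hom h" "h U4 = a4" "h U6 = a6"
    using int_poly_poly_hom_exists by blast
  interpret h: comm_ring_hom h by (rule h)
  have g: "h (fps_nth (formal_multiple U4 U6 m) n) = fps_nth (formal_multiple a4 a6 m) n" for m n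
    unfolding h(2,3)[symmetric] fps_map_coeffs_formal_multiple[OF h(1), symmetric] by simp
  show "of_nat CARD('p) dvd fps_nth (formal_multiple a4 a6 CARD('p)) CARD('p) - hasse_coeff CARD('p) a4 a6"
    using hom_dvd[OF h(1) dvd_add[OF formal_multiple_p_lead_cong[where 'p = 'p] omega_coeff_cong_hasse[where 'p = 'p]]]
    by (simp add: h.hom_minus g hasse_coeff_hom[OF h(1)] h h.hom_of_nat)
  show "n < CARD('p) \<Longrightarrow> of_nat CARD('p) dvd fps_nth (formal_multiple a4 a6 CARD('p)) n"
    using hom_dvd[OF h(1) formal_multiple_p_coeff_dvd[where 'p = 'p, of n]] by (simp add: g h.hom_of_nat)
qed

section \<open>Frobenius congruences, and the Hasse invariant under ordinary reduction\<close>

lemma diff_dvd_power_diff: "(a - b :: 'a :: comm_ring_1) dvd a ^ n - b ^ n"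
  unfolding power_diff_sumr2 by simp

lemma prime_dvd_add_power:
  fixes a b :: "'a :: comm_ring_1"
  assumes p: "prime p" shows "of_nat p dvd (a + b) ^ p - (a ^ p + b ^ p)"
proof -
  obtain q where q: "p = Suc q" using p by (cases p) auto
  have q0: "q \<noteq> 0" using prime_gt_1_nat[OF p] q by simp
  have "(a + b) ^ p = (\<Sum>k\<le>p. of_nat (p choose k) * a ^ k * b ^ (p - k))" by (rule binomial_ring)
  also have "{..p} = insert 0 (insert p {1..q})" using q by auto
  also have "(\<Sum>k\<in>insert 0 (insert p {1..q}). of_nat (p choose k) * a ^ k * b ^ (p - k))
    = b ^ p + (a ^ p + (\<Sum>k\<in>{1..q}. of_nat (p choose k) * a ^ k * b ^ (p - k)))"
    using q q0 by (subst sum.insert, simp, simp, subst sum.insert) auto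
  finally have "(a + b) ^ p - (a ^ p + b ^ p) = (\<Sum>k\<in>{1..q}. of_nat (p choose k) * a ^ k * b ^ (p - k))"
    by (simp add: algebra_simps)
  also have "of_nat p dvd \<dots>"
  proof (rule dvd_sum)
    fix k assume "k \<in> {1..q}"
    hence "p dvd p choose k" using p q by (intro dvd_choose_prime) auto
    hence "of_nat p dvd (of_nat (p choose k) :: 'a)" by (auto elim!: dvdE)
    thus "of_nat p dvd of_nat (p choose k) * a ^ k * b ^ (p - k)" by simp
  qed
  finally show ?thesis .
qed

text \<open>The Frobenius congruence applied twice, for the exponent \<open>p ^ 2\<close> in the
  equation of the quotient of two sigma functions.\<close>

lemma prime_dvd_one_add_power_square:
  fixes F :: "'a :: comm_ring_1"
  assumes p: "prime p" shows "of_nat p dvd (1 + F) ^ (p * p) - (1 + F ^ (p * p))"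
proof -
  have "of_nat p dvd (1 + F) ^ p - (1 + F ^ p)" using prime_dvd_add_power[OF p, of 1 F] by simp
  hence "of_nat p dvd ((1 + F) ^ p) ^ p - (1 + F ^ p) ^ p" using diff_dvd_power_diff dvd_trans by blast
  moreover have "of_nat p dvd (1 + F ^ p) ^ p - (1 + (F ^ p) ^ p)" using prime_dvd_add_power[OF p, of 1 "F ^ p"] by simp
  ultimately have "of_nat p dvd (((1 + F) ^ p) ^ p - (1 + F ^ p) ^ p) + ((1 + F ^ p) ^ p - (1 + (F ^ p) ^ p))" by (rule dvd_add)
  thus ?thesis by (simp only: add_diff_eq diff_add_cancel power_mult)
qed

lemma fps_const_dvd_iff: "fps_const (c :: 'a :: comm_ring_1) dvd f \<longleftrightarrow> (\<forall>n. c dvd fps_nth f n)"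
proof
  assume "\<forall>n. c dvd fps_nth f n"
  then obtain g where "\<And>n. fps_nth f n = c * g n" unfolding dvd_def by metis
  hence "f = fps_const c * Abs_fps g" by (simp add: fps_eq_iff)
  thus "fps_const c dvd f" by simp
qed (auto elim!: dvdE)

lemma hasse_coeff_cong:
  fixes a4 a6 :: "'a :: idom"
  assumes "d dvd a4 - b4" "d dvd a6 - b6" shows "d dvd hasse_coeff p a4 a6 - hasse_coeff p b4 b6"
proof -
  let ?f = "[:a6, a4, 0, 1:]" and ?g = "[:b6, b4, 0, 1:]"
  have "[:d:] dvd ?f - ?g" using assms by (simp add: const_poly_dvd_iff coeff_pCons split: nat.split)
  hence "[:d:] dvd ?f ^ n - ?g ^ n" for n using diff_dvd_power_diff dvd_trans by blast
  hence "d dvd coeff (?f ^ n - ?g ^ n) k" for n k by (simp only: const_poly_dvd_iff)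
  thus ?thesis by (simp add: hasse_coeff_def)
qed

text \<open>Under the scaling \<open>x\<close> to \<open>e x\<close> the cubic
  \<open>(x - e)^2 (x + 2 e)\<close> becomes \<open>e ^ 3\<close> times the one for
  \<open>e = 1\<close>. Comparing coefficients of degree \<open>p - 1\<close> reduces to the cubic
  in \<open>int_nodal_hasse\<close>.\<close>

lemma hasse_coeff_nodal:
  fixes e :: "'a :: idom"
  assumes "odd p" "e \<noteq> 0"
  shows "hasse_coeff p (- 3 * e ^ 2) (2 * e ^ 3) = e ^ ((p - 1) div 2) * hasse_coeff p (- 3) 2"
proof -
  define m where "m = (p - 1) div 2"
  have pm: "p - 1 = 2 * m" using assms(1) unfolding m_def by (auto elim: oddE)
  let ?f = "[:2 * e ^ 3, - 3 * e ^ 2, 0, 1:]" and ?g = "[:2, - 3, 0, 1 :: 'a:]"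
  have 1: "pcompose ?f [:0, e:] = smult (e ^ 3) ?g" by (simp add: pcompose_pCons power2_eq_square power3_eq_cube)
  have 2: "pcompose (?f ^ n) [:0, e:] = smult ((e ^ 3) ^ n) (?g ^ n)" for n
  proof (induction n)
    case (Suc n)
    show ?case unfolding power_Suc pcompose_mult 1 Suc by (simp only: mult_smult_left mult_smult_right smult_smult mult.commute[of "e ^ 3"])
  qed (simp add: pcompose_1)
  have "e ^ (2 * m) * coeff (?f ^ m) (2 * m) = coeff (pcompose (?f ^ m) [:0, e:]) (2 * m)"
    by (simp only: coeff_pcompose_linear)
  also have "\<dots> = (e ^ 3) ^ m * coeff (?g ^ m) (2 * m)" unfolding 2 by simp
  also have "\<dots> = e ^ (2 * m) * (e ^ m * coeff (?g ^ m) (2 * m))"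
    by (simp add: power_mult[symmetric] mult.assoc[symmetric] power_add[symmetric])
  finally show ?thesis unfolding hasse_coeff_def pm unfolding m_def[symmetric] using assms(2) by simp
qed

lemma odd_card_gt3: "odd CARD('p :: prime_card_gt3)"
  using prime_card_gt3[where 'p = 'p] prime_odd_nat by auto

context cdvr
begin

lemma of_int_in_max_ideal:
  assumes "prime p" "of_nat p \<in> (max_ideal :: 'a set)" "of_int k \<in> (max_ideal :: 'a set)" shows "int p dvd k"
proof (rule ccontr)
  assume "\<not> int p dvd k"
  hence "coprime (int p) k" using assms(1) by (simp add: prime_imp_coprime)
  then obtain x y where "int p * x + k * y = 1" using bezout_int[of "int p" k] by (auto simp: mult.commute)
  hence "of_int (int p * x + k * y) = (1 :: 'a)" by simp
  hence "of_nat p * of_int x + of_int k * of_int y = (1 :: 'a)" by simp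
  moreover have "of_nat p * of_int x + of_int k * of_int y \<in> (max_ideal :: 'a set)"
    by (intro max_ideal_add max_ideal_mult assms)
  ultimately show False using one_notin_max_ideal by simp
qed

lemma of_nat_notin_max_ideal:
  assumes "prime p" "of_nat p \<in> (max_ideal :: 'a set)" "0 < k" "k < p" shows "of_nat k \<notin> (max_ideal :: 'a set)"
  using of_int_in_max_ideal[OF assms(1,2), of "int k"] nat_dvd_not_less[OF assms(3,4)] by auto

lemma max_ideal_power_iff: "n > 0 \<Longrightarrow> (x :: 'a) ^ n \<in> max_ideal \<Longrightarrow> x \<in> max_ideal"
proof (induction n)
  case (Suc n)
  thus ?case using max_ideal_prime[of x "x ^ n"] by (cases "n = 0") auto
qed simp

context
  fixes a4 a6 :: 'a
  assumes p_max: "of_nat CARD('p :: prime_card_gt3) \<in> (max_ideal :: 'a set)"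
begin

lemma small_notin_max_ideal: "0 < k \<Longrightarrow> k < CARD('p) \<Longrightarrow> of_nat k \<notin> (max_ideal :: 'a set)"
  using of_nat_notin_max_ideal[OF prime_card_gt3(1)[where 'p = 'p] p_max] .

lemma two_three: "2 \<notin> (max_ideal :: 'a set)" "3 \<notin> (max_ideal :: 'a set)"
  using small_notin_max_ideal[of 2] small_notin_max_ideal[of 3] prime_card_gt3[where 'p = 'p] by auto

lemma two_nonzero: "(2 :: 'a) \<noteq> 0" using two_three zero_in_max_ideal by metis

lemma p_dvd_in_max_ideal: "of_nat CARD('p) dvd x \<Longrightarrow> (x :: 'a) \<in> max_ideal"
  using p_max unfolding max_ideal_iff_pi by (rule dvd_trans)

text \<open>Over the residue field a cubic with discriminant 0 and \<open>a4 \<noteq> 0\<close> has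
  a double root \<open>e\<close> and equals \<open>(x - e)^2 (x + 2 e)\<close>; its Hasse invariant
  is a power of \<open>e\<close> times an integer prime to \<open>p\<close>.\<close>

lemma hasse_multiplicative:
  assumes "multiplicative_reduction a4 a6" shows "hasse_coeff CARD('p) a4 a6 \<notin> max_ideal"
proof
  assume H: "hasse_coeff CARD('p) a4 a6 \<in> max_ideal"
  have n4: "(4 :: 'a) \<notin> max_ideal" using max_ideal_prime[of 2 2] two_three by auto
  have n16: "(16 :: 'a) \<notin> max_ideal" using max_ideal_prime[of 4 4] n4 by auto
  have "- 48 * a4 \<notin> max_ideal" using assms by (simp add: multiplicative_reduction_def ec_c4_def)
  hence a4: "a4 \<notin> max_ideal" using max_ideal_mult' by blast
  have "- 16 * (4 * a4 ^ 3 + 27 * a6 ^ 2) \<in> max_ideal" using assms by (simp add: multiplicative_reduction_def ec_disc_def)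
  from max_ideal_uminus[OF this] have "16 * (4 * a4 ^ 3 + 27 * a6 ^ 2) \<in> max_ideal" by (simp add: algebra_simps)
  hence disc: "4 * a4 ^ 3 + 27 * a6 ^ 2 \<in> max_ideal" using max_ideal_prime n16 by blast
  have "2 * a4 \<notin> max_ideal" using max_ideal_prime two_three a4 by blast
  hence "2 * a4 dvd 1" by (simp only: max_ideal_def mem_Collect_eq not_not)
  then obtain b where "1 = 2 * a4 * b" by (rule dvdE)
  hence b: "2 * a4 * b = 1" by simp
  \<comment> \<open>\<open>- 3 a6 / (2 a4)\<close>, modulo the maximal ideal the common root of
    \<open>x^3 + a4 x + a6\<close> and its derivative.\<close>
  define e where "e = - 3 * a6 * b"
  have a4n: "a4 ^ n \<notin> max_ideal" for n
    using max_ideal_power_iff[of n a4] a4 one_notin_max_ideal by (cases n) auto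
  have 1: "4 * a4 ^ 2 * (a4 - (- 3 * e ^ 2)) = 4 * a4 ^ 3 + 27 * a6 ^ 2"
    using b unfolding e_def by Groebner_Basis.algebra
  have d4: "a4 - (- 3 * e ^ 2) \<in> max_ideal"
    using max_ideal_prime[of "4 * a4 ^ 2"] max_ideal_prime[of 4 "a4 ^ 2"] n4 a4n disc 1 by metis
  have 2: "2 * (4 * a4 ^ 3) * (a6 - 2 * e ^ 3) = 2 * a6 * (4 * a4 ^ 3 + 27 * a6 ^ 2)"
    using b unfolding e_def by Groebner_Basis.algebra
  have d6: "a6 - 2 * e ^ 3 \<in> max_ideal"
    using max_ideal_prime[of "2 * (4 * a4 ^ 3)"] max_ideal_prime[of 2 "4 * a4 ^ 3"] max_ideal_prime[of 4 "a4 ^ 3"]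
      n4 a4n two_three max_ideal_mult'[OF disc, of "2 * a6"] 2 by metis
  have e: "e \<notin> max_ideal"
  proof
    assume "e \<in> max_ideal"
    hence "- 3 * e ^ 2 \<in> max_ideal" unfolding power2_eq_square by (intro max_ideal_mult')
    from max_ideal_add[OF d4 this] show False using a4 by simp
  qed
  have e0: "e \<noteq> 0" using e zero_in_max_ideal by auto
  have "\<pi> dvd hasse_coeff CARD('p) a4 a6 - hasse_coeff CARD('p) (- 3 * e ^ 2) (2 * e ^ 3)"
    using d4 d6 unfolding max_ideal_iff_pi by (rule hasse_coeff_cong)
  hence "hasse_coeff CARD('p) (- 3 * e ^ 2) (2 * e ^ 3) \<in> max_ideal"
    using max_ideal_diff[OF H] unfolding max_ideal_iff_pi[symmetric] by fastforce
  hence "e ^ ((CARD('p) - 1) div 2) * hasse_coeff CARD('p) (- 3) 2 \<in> max_ideal" unfolding hasse_coeff_nodal[OF odd_card_gt3[where 'p = 'p] e0] .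
  moreover have "e ^ n \<notin> max_ideal" for n
    using max_ideal_power_iff[of n e] e one_notin_max_ideal by (cases n) auto
  ultimately have "hasse_coeff CARD('p) (- 3) 2 \<in> (max_ideal :: 'a set)" using max_ideal_prime by blast
  moreover have "comm_ring_hom (of_int :: int \<Rightarrow> 'a)" by unfold_locales auto
  from hasse_coeff_hom[OF this, of "CARD('p)" "- 3" 2] have "hasse_coeff CARD('p) (- 3) 2 = (of_int (hasse_coeff CARD('p) (- 3) 2) :: 'a)" by simp
  ultimately have "int CARD('p) dvd hasse_coeff CARD('p) (- 3) 2" using of_int_in_max_ideal[OF prime_card_gt3(1)[where 'p = 'p] p_max] by simp
  thus False using int_nodal_hasse[where 'p = 'p] by (simp add: hasse_coeff_def)
qed

text \<open>Height one is defined by repeated \<open>ec_add\<close>, which has to be matched with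
  \<open>formal_multiple\<close>. Linear coefficients show that \<open>[j] = - t\<close> with
  \<open>0 < j < p\<close> can only occur for \<open>j = p - 1\<close>. Then the \<open>p\<close>-th
  multiple would be \<open>Origin\<close> with parameter 0, contradicting the unit coefficient in
  degree \<open>p\<close>.\<close>

lemma formal_multiple_lead_height_one:
  assumes "reduced_height_one CARD('p) a4 a6" shows "fps_nth (formal_multiple a4 a6 CARD('p)) CARD('p) \<notin> max_ideal"
proof -
  let ?f = "to_fract :: 'a \<Rightarrow> 'a fract" let ?G = "formal_multiple (?f a4) (?f a6)"
  let ?P = "Affine (weier_x (?f a4) (?f a6)) (weier_y (?f a4) (?f a6))"
  note hf = comm_ring_hom_to_fract[where 'a = 'a]
  interpret m: comm_ring_hom "fps_map_coeffs ?f" by (rule comm_ring_hom_fps_map_coeffs[OF hf])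
  have small: "formal_multiple a4 a6 j \<noteq> - fps_X" if j: "0 < j" "j < CARD('p) - 1" for j
  proof
    assume "formal_multiple a4 a6 j = - fps_X"
    hence "of_nat j = - (1 :: 'a)" using formal_multiple_nth_1[of a4 a6 j] by simp
    hence "of_nat (Suc j) = (0 :: 'a)" by simp
    moreover have "Suc j < CARD('p)" using j by linarith
    ultimately show False using small_notin_max_ideal[of "Suc j"] zero_in_max_ideal by (metis zero_less_Suc)
  qed
  have lead: "fls_nth (formal_mult CARD('p) a4 a6) (int CARD('p)) \<in> ?f ` (- max_ideal)"
    using assms by (simp add: reduced_height_one_def)
  have ne: "formal_multiple a4 a6 (CARD('p) - 1) \<noteq> - fps_X"
  proof
    assume eq: "formal_multiple a4 a6 (CARD('p) - 1) = - fps_X"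
    have "?G (CARD('p) - 1) = - fps_X"
      using arg_cong[OF eq, of "fps_map_coeffs ?f"]
      by (simp add: fps_map_coeffs_formal_multiple[OF hf] m.hom_uminus fps_map_coeffs_X[OF hf])
    moreover have "ec_mult (fls_const (?f a4)) (CARD('p) - 1) ?P = weier_point (?f a4) (?f a6) (?G (CARD('p) - 1))"
      using small prime_card_gt3[where 'p = 'p] by (intro formal_mult_eq two_nonzero) auto
    ultimately have mult: "ec_mult (fls_const (?f a4)) (CARD('p) - 1) ?P = weier_point (?f a4) (?f a6) (- fps_X)" by simp
    have "ec_mult (fls_const (?f a4)) 1 ?P = weier_point (?f a4) (?f a6) (?G 1)"
      by (intro formal_mult_eq two_nonzero) auto
    hence P: "?P = weier_point (?f a4) (?f a6) fps_X" by simp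
    have "CARD('p) = Suc (CARD('p) - 1)" using prime_card_gt3[where 'p = 'p] by simp
    hence "ec_mult (fls_const (?f a4)) CARD('p) ?P = ec_add (fls_const (?f a4)) ?P (ec_mult (fls_const (?f a4)) (CARD('p) - 1) ?P)"
      by (metis ec_mult.simps(2))
    also have "\<dots> = Origin" unfolding mult unfolding P by (simp add: weier_w_compose_uminus)
    finally have "formal_mult CARD('p) a4 a6 = 0" by (simp add: formal_mult_def)
    hence "0 \<in> ?f ` (- max_ideal)" using lead by simp
    thus False using zero_in_max_ideal by auto
  qed
  have "formal_multiple a4 a6 j \<noteq> - fps_X" if "0 < j" "j < CARD('p)" for j
    using small[of j] ne that by (cases "j = CARD('p) - 1") auto
  hence G: "ec_mult (fls_const (?f a4)) CARD('p) ?P = weier_point (?f a4) (?f a6) (?G CARD('p))" "?G CARD('p) \<noteq> 0"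
    using formal_mult_eq[OF two_nonzero, of "CARD('p)" a4 a6] prime_card_gt3[where 'p = 'p] by auto
  have "formal_mult CARD('p) a4 a6 = fps_to_fls (?G CARD('p))"
    using weier_w_compose_nonzero[OF _ G(2), of "?f a4" "?f a6"] by (simp add: formal_mult_def G(1))
  hence "fls_nth (formal_mult CARD('p) a4 a6) (int CARD('p)) = ?f (fps_nth (formal_multiple a4 a6 CARD('p)) CARD('p))"
    unfolding fps_map_coeffs_formal_multiple[OF hf, symmetric] by simp
  thus ?thesis using lead by auto
qed

lemma lead_iff_hasse:
  "fps_nth (formal_multiple a4 a6 CARD('p)) CARD('p) \<notin> max_ideal \<longleftrightarrow> hasse_coeff CARD('p) a4 a6 \<notin> max_ideal"
proof -
  have d: "fps_nth (formal_multiple a4 a6 CARD('p)) CARD('p) - hasse_coeff CARD('p) a4 a6 \<in> max_ideal"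
    by (rule p_dvd_in_max_ideal[OF formal_multiple_p_cong_hasse(1)])
  show ?thesis using max_ideal_diff[OF _ d, of "fps_nth (formal_multiple a4 a6 CARD('p)) CARD('p)"] max_ideal_add[OF d, of "hasse_coeff CARD('p) a4 a6"] by auto
qed

lemma hasse_ordinary:
  assumes "ordinary_reduction CARD('p) a4 a6" shows "hasse_coeff CARD('p) a4 a6 \<notin> max_ideal"
  using assms hasse_multiplicative formal_multiple_lead_height_one lead_iff_hasse
  unfolding ordinary_reduction_def good_ordinary_reduction_def by blast

end

end

section \<open>Uniqueness and existence of the sigma function\<close>

context cdvr
begin

context
  fixes a4 a6 :: 'a
  assumes p_max: "of_nat CARD('p :: prime_card_gt3) \<in> (max_ideal :: 'a set)"
    and lead: "fps_nth (formal_multiple a4 a6 CARD('p)) CARD('p) \<notin> max_ideal"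
begin

private abbreviation "g n \<equiv> formal_multiple a4 a6 n"

text \<open>The linear coefficient settles \<open>n < p\<close>; for \<open>n = p\<close> it may be
  0, and the unit coefficient in degree \<open>p\<close> is used instead.\<close>

lemma multiple_nonzero: assumes "0 < n" "n \<le> CARD('p)" shows "g n \<noteq> 0"
proof
  assume 0: "g n = 0"
  show False
  proof (cases "n = CARD('p)")
    case True thus False using 0 lead zero_in_max_ideal by simp
  next
    case False
    have "of_nat n = (0 :: 'a)" using 0 formal_multiple_nth_1[of a4 a6 n] by simp
    thus False using small_notin_max_ideal[OF p_max, of n] False assms zero_in_max_ideal by simp
  qed
qed

lemma multiple_neq: assumes "m < n" "n \<le> CARD('p)" "0 < m" shows "g n \<noteq> g m"
proof
  assume "g n = g m"
  hence "of_nat n = (of_nat m :: 'a)" by (metis formal_multiple_nth_1)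
  hence "of_nat (n - m) = (0 :: 'a)" using assms by (simp add: of_nat_diff)
  moreover have "n - m < CARD('p)" using assms by arith
  ultimately show False using small_notin_max_ideal[OF p_max, of "n - m"] assms zero_in_max_ideal by simp
qed

text \<open>Linear coefficients cannot exclude this when \<open>n + m = p\<close> is 0 in the ring.
  The group law can: equality would give \<open>[n + m] = 0\<close>.\<close>

lemma multiple_neq_uminus: assumes "0 < m" "0 < n" "n + m \<le> CARD('p)" shows "g n \<noteq> - g m"
proof
  assume eq: "g n = - g m"
  have "formal_sum a4 a6 (g n) (- g n) = 0"
    by (rule formal_sum_opposite) (use multiple_nonzero[of n] two_nonzero[OF p_max] assms in auto)
  hence "g (n + m) = 0" using formal_sum_multiples[OF assms(1,2), of a4 a6] eq by simp
  thus False using multiple_nonzero[of "n + m"] assms by simp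
qed

text \<open>The relation is given only at points where the two multiples are nonzero and neither
  equal nor opposite. The factor \<open>N\<close> vanishes at the excluded points, so the identity
  principle applies to the product, and \<open>N\<close> is nonzero as a series.\<close>

lemma sigma_defect_multiples:
  assumes s: "is_mazur_tate_sigma v a4 a6 s" and nm: "0 < m" "m < n" "n + m \<le> CARD('p)"
  shows "(s oo g (n + m)) * (s oo g (n - m)) * ((weier_w a4 a6 oo g n) * (weier_w a4 a6 oo g m))
     = (s oo g n) ^ 2 * (s oo g m) ^ 2 * (g m * (weier_w a4 a6 oo g n) - g n * (weier_w a4 a6 oo g m))"
proof -
  let ?N = "g n * g m * (g n - g m) * (g n + g m)" and ?d = "sigma_defect a4 a6 s (g n) (g m)"
  have "?N * ?d = 0"
  proof (rule fev_identity_principle)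
    fix z :: 'a assume z: "z \<in> max_ideal"
    interpret h: comm_ring_hom "fev z" by (rule comm_ring_hom_fev[OF z])
    let ?a = "fev z (g n)" and ?b = "fev z (g m)"
    have "fev z ?N = ?a * ?b * (?a - ?b) * (?a + ?b)" by (simp add: h.hom_mult h.hom_minus h.hom_add)
    moreover have "fev z ?d = 0" if "?a * ?b * (?a - ?b) * (?a + ?b) \<noteq> 0"
      using that by (intro is_mazur_tate_sigmaD[OF s z]) (auto simp: eq_neg_iff_add_eq_0)
    ultimately show "fev z (?N * ?d) = 0" unfolding h.hom_mult by (metis mult_eq_0_iff)
  qed
  moreover have "g n + g m \<noteq> 0" using multiple_neq_uminus[of m n] nm by (auto simp: eq_neg_iff_add_eq_0)
  hence "?N \<noteq> 0" using multiple_nonzero[of n] multiple_nonzero[of m] multiple_neq[of m n] nm by simp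
  ultimately have "?d = 0" by simp
  thus ?thesis
    unfolding sigma_defect_def using formal_sum_multiples[of m n a4 a6] formal_diff_multiples[of m n a4 a6] nm by simp
qed

text \<open>The relations for \<open>s1\<close> and \<open>s2\<close> are divided by each other; the
  factor coming from the curve is common to both and nonzero.\<close>

lemma sigma_quotient_multiples:
  assumes s1: "is_mazur_tate_sigma v a4 a6 s1" and s2: "is_mazur_tate_sigma v a4 a6 s2"
    and f: "s1 = f * s2" and nm: "0 < m" "m < n" "n + m \<le> CARD('p)"
  shows "(f oo g (n + m)) * (f oo g (n - m)) = (f oo g n) ^ 2 * (f oo g m) ^ 2"
proof -
  let ?R = "(s2 oo g n) ^ 2 * (s2 oo g m) ^ 2 * (g m * (weier_w a4 a6 oo g n) - g n * (weier_w a4 a6 oo g m))"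
  have comp: "s1 oo g k = (f oo g k) * (s2 oo g k)" for k unfolding f by (simp add: fps_compose_mult_distrib)
  have s2': "fps_nth s2 1 = 1" using s2 by (simp add: is_mazur_tate_sigma_def odd_with_lead_t_def)
  hence "s2 oo g k \<noteq> 0" if "0 < k" "k \<le> CARD('p)" for k
    using multiple_nonzero[OF that] by (subst fps_compose_eq_0_iff) auto
  moreover have "g n * (weier_w a4 a6 oo g m) \<noteq> g m * (weier_w a4 a6 oo g n)"
    using weier_same_x[OF weier_w_compose_eqn weier_w_compose_eqn, of "g n" "g m" a4 a6]
      weier_w_compose_nonzero[of "g n" a4 a6] weier_w_compose_nonzero[of "g m" a4 a6]
      multiple_nonzero[of n] multiple_nonzero[of m] multiple_neq[of m n] multiple_neq_uminus[of m n] nm by auto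
  ultimately have R: "?R \<noteq> 0" using nm by auto
  have "(f oo g (n + m)) * (f oo g (n - m)) * ?R = (s1 oo g (n + m)) * (s1 oo g (n - m)) * ((weier_w a4 a6 oo g n) * (weier_w a4 a6 oo g m))"
    unfolding comp sigma_defect_multiples[OF s2 nm, symmetric] by (simp only: mult_ac)
  also have "\<dots> = (f oo g n) ^ 2 * (f oo g m) ^ 2 * ?R"
    unfolding sigma_defect_multiples[OF s1 nm] unfolding comp power_mult_distrib by (simp only: mult_ac)
  finally show ?thesis using R mult_right_cancel by blast
qed

text \<open>The relation for \<open>n = m\<close> is not available, so \<open>f([2]t) = f(t)\<^sup>4\<close> is extracted from the pairs \<open>(2,1)\<close>, \<open>(3,1)\<close>,
  \<open>(3,2)\<close> and \<open>(4,1)\<close>, which determine it up to sign.\<close>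

lemma sigma_quotient_p:
  assumes s1: "is_mazur_tate_sigma v a4 a6 s1" and s2: "is_mazur_tate_sigma v a4 a6 s2"
    and f: "s1 = f * s2" "fps_nth f 0 = 1"
  shows "f oo g CARD('p) = f ^ (CARD('p) * CARD('p))"
proof -
  note E = sigma_quotient_multiples[OF s1 s2 f(1)]
  define F where "F n = f oo g n" for n
  have F0: "fps_nth (F n) 0 = 1" for n by (simp add: F_def f)
  have Fn0: "F n \<noteq> 0" for n using F0[of n] by (metis fps_zero_nth zero_neq_one)
  have F1: "F 1 = f" by (simp add: F_def)
  have f0: "f \<noteq> 0" using Fn0[of 1] F1 by simp
  \<comment> \<open>The pairs \<open>(3, 2)\<close> and \<open>(4, 1)\<close> involve
    \<open>[5]\<close>, and relations are available only up to \<open>[p]\<close>.\<close>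
  have p5: "CARD('p) \<ge> 5"
  proof -
    have "CARD('p) \<noteq> 4" using odd_card_gt3[where 'p = 'p] by auto
    thus ?thesis using prime_card_gt3(2)[where 'p = 'p] by linarith
  qed
  have e21: "F 3 * F 1 = F 2 ^ 2 * F 1 ^ 2" using E[of 1 2] p5 by (simp add: F_def)
  have e31: "F 4 * F 2 = F 3 ^ 2 * F 1 ^ 2" using E[of 1 3] p5 by (simp add: F_def)
  have e32: "F 5 * F 1 = F 3 ^ 2 * F 2 ^ 2" using E[of 2 3] p5 by (simp add: F_def)
  have e41: "F 5 * F 3 = F 4 ^ 2 * F 1 ^ 2" using E[of 1 4] p5 by (simp add: F_def)
  have "F 1 * F 3 = F 1 * (F 2 ^ 2 * F 1)" using e21 by (simp add: mult_ac power2_eq_square)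
  hence f3: "F 3 = F 2 ^ 2 * F 1" using Fn0[of 1] by simp
  have "F 2 * F 4 = F 2 * (F 2 ^ 3 * F 1 ^ 4)" using e31 unfolding f3 by Groebner_Basis.algebra
  hence f4: "F 4 = F 2 ^ 3 * F 1 ^ 4" using Fn0[of 2] by simp
  have "F 1 * F 5 = F 1 * (F 2 ^ 6 * F 1)" using e32 unfolding f3 by Groebner_Basis.algebra
  hence f5: "F 5 = F 2 ^ 6 * F 1" using Fn0[of 1] by simp
  have "(F 2 ^ 6 * F 1 ^ 2) * ((F 2 - F 1 ^ 4) * (F 2 + F 1 ^ 4)) = 0"
    using e41 unfolding f3 f4 f5 by Groebner_Basis.algebra
  \<comment> \<open>Constant terms decide the sign: both summands start with 1, and 2 is
    nonzero.\<close>
  moreover have "fps_nth (F 2 + F 1 ^ 4) 0 = 2" using F0 by (simp add: fps_nth_power_0)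
  hence "F 2 + F 1 ^ 4 \<noteq> 0" using two_nonzero[OF p_max] by (metis fps_zero_nth)
  ultimately have "F 2 - F 1 ^ 4 = 0" using Fn0[of 1] Fn0[of 2] by (simp only: mult_eq_0_iff power_eq_0_iff) auto
  hence f2: "F 2 = f ^ 4" unfolding F1 by simp
  \<comment> \<open>The pair \<open>(n + 1, 1)\<close> expresses the multiple \<open>n + 2\<close>
    through the two preceding ones, hence two consecutive values are carried along.\<close>
  have "n + 1 \<le> CARD('p) \<Longrightarrow> F n = f ^ (n * n) \<and> F (Suc n) = f ^ (Suc n * Suc n)" if "0 < n" for n
    using that
  proof (induction n rule: nat_induct_non_zero)
    case 1
    have two: "Suc 1 = (2 :: nat)" by simp
    show ?case unfolding two using f2 F1 by simp
  next
    case (Suc n)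
    have ih: "F n = f ^ (n * n)" "F (Suc n) = f ^ (Suc n * Suc n)" using Suc by auto
    have "F (Suc n + 1) * F (Suc n - 1) = F (Suc n) ^ 2 * F 1 ^ 2"
      unfolding F_def by (rule E) (use Suc in auto)
    hence "f ^ (n * n) * F (Suc (Suc n)) = (f ^ (Suc n * Suc n)) ^ 2 * f ^ 2"
      unfolding F1 by (simp add: ih mult.commute)
    also have "\<dots> = f ^ (Suc n * Suc n * 2 + 2)" by (simp only: power_mult power_add)
    also have "Suc n * Suc n * 2 + 2 = n * n + Suc (Suc n) * Suc (Suc n)" by simp
    finally have "f ^ (n * n) * F (Suc (Suc n)) = f ^ (n * n) * f ^ (Suc (Suc n) * Suc (Suc n))"
      by (simp only: power_add)
    hence "F (Suc (Suc n)) = f ^ (Suc (Suc n) * Suc (Suc n))" using f0 by simp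
    thus ?case using ih by simp
  qed
  from this[of "CARD('p) - 1"] have "F (Suc (CARD('p) - 1)) = f ^ (Suc (CARD('p) - 1) * Suc (CARD('p) - 1))" using p5 by simp
  moreover have "Suc (CARD('p) - 1) = CARD('p)" using p5 by simp
  ultimately show ?thesis by (simp add: F_def)
qed

section \<open>Composition with \<open>[p]\<close> modulo the uniformizer\<close>

lemma multiple_p_decompose:
  obtains G1 G2 where "g CARD('p) = fps_const \<pi> * G1 + fps_X ^ CARD('p) * G2" "fps_nth G2 0 \<notin> max_ideal"
proof -
  have "fps_const \<pi> dvd g CARD('p) - fps_X ^ CARD('p) * fps_shift CARD('p) (g CARD('p))"
    unfolding fps_const_dvd_iff
  proof
    fix n show "\<pi> dvd fps_nth (g CARD('p) - fps_X ^ CARD('p) * fps_shift CARD('p) (g CARD('p))) n"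
      using p_dvd_in_max_ideal[OF p_max formal_multiple_p_cong_hasse(2)[where 'p = 'p, of n a4 a6]]
      unfolding fps_sub_nth fps_X_power_mult_nth by (auto simp: max_ideal_iff_pi)
  qed
  then obtain G1 where "g CARD('p) - fps_X ^ CARD('p) * fps_shift CARD('p) (g CARD('p)) = fps_const \<pi> * G1" by (elim dvdE)
  hence "g CARD('p) = fps_const \<pi> * G1 + fps_X ^ CARD('p) * fps_shift CARD('p) (g CARD('p))" by (simp add: algebra_simps)
  thus ?thesis by (rule that) (simp add: lead)
qed

text \<open>\<open>N\<close> is the order of the reduction of \<open>E\<close>; this form expresses
  it without passing to the residue field.\<close>

lemma pi_power_dvd_decompose:
  fixes E :: "'a fps"
  assumes "\<not> fps_const \<pi> dvd E"
  obtains N E1 E2 where "E = fps_const \<pi> * E1 + fps_X ^ N * E2" "fps_nth E2 0 \<notin> max_ideal"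
proof -
  have ex: "\<exists>n. \<not> \<pi> dvd fps_nth E n" using assms by (simp add: fps_const_dvd_iff)
  define N where "N = (LEAST n. \<not> \<pi> dvd fps_nth E n)"
  have N: "\<not> \<pi> dvd fps_nth E N" unfolding N_def by (rule LeastI_ex[OF ex])
  have less: "\<pi> dvd fps_nth E n" if "n < N" for n using not_less_Least that unfolding N_def by blast
  have "fps_const \<pi> dvd E - fps_X ^ N * fps_shift N E"
    unfolding fps_const_dvd_iff fps_sub_nth fps_X_power_mult_nth using less by auto
  then obtain E1 where "E - fps_X ^ N * fps_shift N E = fps_const \<pi> * E1" by (elim dvdE)
  hence "E = fps_const \<pi> * E1 + fps_X ^ N * fps_shift N E" by (simp add: algebra_simps)
  thus ?thesis by (rule that) (use N in \<open>simp add: max_ideal_iff_pi\<close>)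
qed

lemma power_mod_pi:
  fixes A B :: "'a fps" shows "fps_const \<pi> dvd (fps_const \<pi> * A + B) ^ n - B ^ n"
  using diff_dvd_power_diff[of "fps_const \<pi> * A + B" B n] by (metis add_diff_cancel_right' dvd_mult_left)

text \<open>Modulo \<open>\<pi>\<close> both \<open>E\<close> and \<open>[p]\<close> are a power of
  \<open>fps_X\<close> times a unit, so composition turns the order \<open>N\<close> into
  \<open>p * N\<close>.\<close>

lemma compose_multiple_p_mod_pi:
  assumes E: "E = fps_const \<pi> * E1 + fps_X ^ N * E2" "fps_nth E2 0 \<notin> max_ideal"
  obtains Z where "fps_const \<pi> dvd (E oo g CARD('p)) - fps_X ^ (CARD('p) * N) * Z" "fps_nth Z 0 \<notin> max_ideal"
proof -
  obtain G1 G2 where G: "g CARD('p) = fps_const \<pi> * G1 + fps_X ^ CARD('p) * G2" "fps_nth G2 0 \<notin> max_ideal"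
    by (rule multiple_p_decompose)
  have "fps_const \<pi> dvd g CARD('p) ^ N - (fps_X ^ CARD('p) * G2) ^ N" unfolding G(1) by (rule power_mod_pi)
  hence "fps_const \<pi> dvd fps_const \<pi> * (E1 oo g CARD('p)) + (g CARD('p) ^ N - (fps_X ^ CARD('p) * G2) ^ N) * (E2 oo g CARD('p))" by simp
  also have "fps_const \<pi> * (E1 oo g CARD('p)) + (g CARD('p) ^ N - (fps_X ^ CARD('p) * G2) ^ N) * (E2 oo g CARD('p))
    = (E oo g CARD('p)) - fps_X ^ (CARD('p) * N) * (G2 ^ N * (E2 oo g CARD('p)))"
  proof -
    have 1: "E oo g CARD('p) = fps_const \<pi> * (E1 oo g CARD('p)) + g CARD('p) ^ N * (E2 oo g CARD('p))"
      unfolding E(1) by (simp add: fps_compose_add_distrib fps_compose_mult_distrib flip: fps_compose_power)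
    have 2: "(fps_X ^ CARD('p) * G2) ^ N = fps_X ^ (CARD('p) * N) * G2 ^ N" by (simp only: power_mult_distrib power_mult)
    show ?thesis unfolding 1 2 by (simp only: left_diff_distrib mult.assoc add_diff_eq)
  qed
  finally have "fps_const \<pi> dvd (E oo g CARD('p)) - fps_X ^ (CARD('p) * N) * (G2 ^ N * (E2 oo g CARD('p)))" .
  moreover have "fps_nth G2 0 ^ N \<notin> max_ideal"
    using max_ideal_power_iff[of N "fps_nth G2 0"] G(2) one_notin_max_ideal by (cases N) auto
  hence "fps_nth (G2 ^ N * (E2 oo g CARD('p))) 0 \<notin> max_ideal"
    using E(2) max_ideal_prime by (auto simp: fps_nth_power_0)
  ultimately show ?thesis by (rule that)
qed

text \<open>A series that is nonzero modulo \<open>\<pi>\<close> has a finite order there, and its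
  composite with \<open>[p]\<close> has \<open>p\<close> times that order.\<close>

lemma pi_dvd_compose_multiple_p:
  assumes "fps_const \<pi> dvd E oo g CARD('p)" shows "fps_const \<pi> dvd E"
proof (rule ccontr)
  assume "\<not> fps_const \<pi> dvd E"
  then obtain N E1 E2 where E: "E = fps_const \<pi> * E1 + fps_X ^ N * E2" "fps_nth E2 0 \<notin> max_ideal"
    by (rule pi_power_dvd_decompose)
  obtain Z where Z: "fps_const \<pi> dvd (E oo g CARD('p)) - fps_X ^ (CARD('p) * N) * Z" "fps_nth Z 0 \<notin> max_ideal"
    by (rule compose_multiple_p_mod_pi[OF E])
  have "fps_const \<pi> dvd (E oo g CARD('p)) - ((E oo g CARD('p)) - fps_X ^ (CARD('p) * N) * Z)" by (rule dvd_diff[OF assms Z(1)])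
  hence "fps_const \<pi> dvd fps_X ^ (CARD('p) * N) * Z" by simp
  hence "\<pi> dvd fps_nth (fps_X ^ (CARD('p) * N) * Z) (CARD('p) * N)" unfolding fps_const_dvd_iff by blast
  thus False using Z(2) by (simp only: fps_X_power_mult_nth) (simp add: max_ideal_iff_pi)
qed

text \<open>Modulo \<open>\<pi>\<close> the series \<open>[p](t)\<close> has order exactly \<open>p\<close>, whereas \<open>f\<^bsup>p\<^sup>2\<^esup> - 1\<close> has order \<open>p\<^sup>2\<close> times
  that of \<open>f - 1\<close>; this forces \<open>f = 1\<close> modulo \<open>\<pi>\<close>, and then modulo every power of \<open>\<pi>\<close>.\<close>

lemma multiplier_eq_1:
  assumes f0: "fps_nth f 0 = 1" and fp: "f oo g CARD('p) = f ^ (CARD('p) * CARD('p))" shows "f = 1"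
proof -
  define F where "F = f - 1"
  have f: "f = 1 + F" by (simp add: F_def)
  have F0: "fps_nth F 0 = 0" by (simp add: F_def f0)
  have Fg: "F oo g CARD('p) = (1 + F) ^ (CARD('p) * CARD('p)) - 1"
    using fp unfolding F_def by (simp add: fps_compose_sub_distrib)
  have pi_p: "fps_const \<pi> dvd of_nat CARD('p)"
    using p_max by (auto simp: max_ideal_iff_pi fps_const_dvd_iff simp flip: fps_of_nat)
  have base: "fps_const \<pi> dvd F"
  proof (rule ccontr)
    assume "\<not> fps_const \<pi> dvd F"
    then obtain N F1 F2 where F: "F = fps_const \<pi> * F1 + fps_X ^ N * F2" "fps_nth F2 0 \<notin> max_ideal"
      by (rule pi_power_dvd_decompose)
    \<comment> \<open>Makes the inequality between the orders \<open>p * N\<close> and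
      \<open>p ^ 2 * N\<close> strict.\<close>
    have N: "N \<noteq> 0"
    proof
      assume "N = 0"
      hence "0 = \<pi> * fps_nth F1 0 + fps_nth F2 0" using arg_cong[OF F(1), of "\<lambda>h. fps_nth h 0"] F0 by simp
      hence "fps_nth F2 0 = \<pi> * (- fps_nth F1 0)" by (simp add: eq_neg_iff_add_eq_0 add.commute)
      thus False using F(2) by (simp add: max_ideal_iff_pi)
    qed
    obtain Z where Z: "fps_const \<pi> dvd (F oo g CARD('p)) - fps_X ^ (CARD('p) * N) * Z" "fps_nth Z 0 \<notin> max_ideal"
      by (rule compose_multiple_p_mod_pi[OF F])
    have "of_nat CARD('p) dvd (1 + F) ^ (CARD('p) * CARD('p)) - (1 + F ^ (CARD('p) * CARD('p)))"
      by (rule prime_dvd_one_add_power_square[OF prime_card_gt3(1)[where 'p = 'p]])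
    hence 1: "fps_const \<pi> dvd (F oo g CARD('p)) - F ^ (CARD('p) * CARD('p))"
      unfolding Fg using dvd_trans[OF pi_p] by (simp add: algebra_simps)
    have 2: "fps_const \<pi> dvd F ^ (CARD('p) * CARD('p)) - (fps_X ^ N * F2) ^ (CARD('p) * CARD('p))" unfolding F(1) by (rule power_mod_pi)
    have "fps_const \<pi> dvd ((F oo g CARD('p)) - F ^ (CARD('p) * CARD('p))) + (F ^ (CARD('p) * CARD('p)) - (fps_X ^ N * F2) ^ (CARD('p) * CARD('p))) - ((F oo g CARD('p)) - fps_X ^ (CARD('p) * N) * Z)"
      by (rule dvd_diff[OF dvd_add[OF 1 2] Z(1)])
    hence "fps_const \<pi> dvd fps_X ^ (CARD('p) * N) * Z - (fps_X ^ N * F2) ^ (CARD('p) * CARD('p))" by simp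
    hence "\<pi> dvd fps_nth (fps_X ^ (CARD('p) * N) * Z - (fps_X ^ N * F2) ^ (CARD('p) * CARD('p))) (CARD('p) * N)"
      unfolding fps_const_dvd_iff by blast
    moreover have "fps_nth ((fps_X ^ N * F2) ^ (CARD('p) * CARD('p))) (CARD('p) * N) = 0"
    proof -
      have "(fps_X ^ N * F2) ^ (CARD('p) * CARD('p)) = fps_X ^ (N * (CARD('p) * CARD('p))) * F2 ^ (CARD('p) * CARD('p))" by (simp add: power_mult_distrib power_mult)
      moreover have "CARD('p) * N < N * (CARD('p) * CARD('p))" using N prime_card_gt3(2)[where 'p = 'p] by simp
      ultimately show ?thesis by (simp only: fps_X_power_mult_nth if_True)
    qed
    ultimately have "\<pi> dvd fps_nth Z 0" by (simp only: fps_sub_nth fps_X_power_mult_nth) simp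
    thus False using Z(2) by (simp add: max_ideal_iff_pi)
  qed
  \<comment> \<open>If \<open>F = \<pi>^(k+1) E\<close>, then \<open>F\<close> composed with
    \<open>[p]\<close> is \<open>p^2 F\<close> plus terms containing \<open>F^2\<close>, all
    divisible by \<open>\<pi>^(k+2)\<close>. So \<open>\<pi>\<close> divides the composite of
    \<open>E\<close> with \<open>[p]\<close>, and hence \<open>E\<close>.\<close>
  have "fps_const (\<pi> ^ Suc k) dvd F" for k
  proof (induction k)
    case 0 show ?case using base by simp
  next
    case (Suc k)
    let ?c = "fps_const (\<pi> ^ Suc k)"
    obtain E where E: "F = ?c * E" using Suc by (elim dvdE)
    have c0: "?c \<noteq> 0" using pi_nonzero by (simp add: fps_const_eq_0_iff)
    have "(1 + F) ^ (CARD('p) * CARD('p)) = (\<Sum>i\<le>CARD('p) * CARD('p). of_nat (CARD('p) * CARD('p) choose i) * F ^ i * 1 ^ (CARD('p) * CARD('p) - i))"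
      unfolding binomial_ring[symmetric] by (simp add: add.commute)
    also have "\<dots> = (\<Sum>i\<le>CARD('p) * CARD('p). of_nat (CARD('p) * CARD('p) choose i) * F ^ i)" by simp
    also have "{..CARD('p) * CARD('p)} = insert 0 (insert 1 {2..CARD('p) * CARD('p)})"
      using prime_card_gt3(2)[where 'p = 'p] by (auto simp: numeral_2_eq_2 not_less_eq_eq Suc_le_eq)
    also have "(\<Sum>i\<in>insert 0 (insert 1 {2..CARD('p) * CARD('p)}). of_nat (CARD('p) * CARD('p) choose i) * F ^ i)
      = 1 + (of_nat (CARD('p) * CARD('p)) * F + (\<Sum>i\<in>{2..CARD('p) * CARD('p)}. of_nat (CARD('p) * CARD('p) choose i) * F ^ i))"
      by simp
    finally have "F oo g CARD('p) = of_nat CARD('p) * (of_nat CARD('p) * F) + (\<Sum>i\<in>{2..CARD('p) * CARD('p)}. of_nat (CARD('p) * CARD('p) choose i) * F ^ i)"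
      unfolding Fg by (simp add: mult.assoc)
    also have "fps_const \<pi> * ?c dvd \<dots>"
    proof (intro dvd_add dvd_sum)
      show "fps_const \<pi> * ?c dvd of_nat CARD('p) * (of_nat CARD('p) * F)"
        by (intro mult_dvd_mono pi_p dvd_mult) (simp add: E)
      fix i assume "i \<in> {2..CARD('p) * CARD('p)}"
      hence "F ^ 2 dvd F ^ i" by (intro le_imp_power_dvd) auto
      moreover have "fps_const \<pi> * ?c dvd F * F" using mult_dvd_mono[OF base, of ?c F] E by simp
      ultimately show "fps_const \<pi> * ?c dvd of_nat (CARD('p) * CARD('p) choose i) * F ^ i"
        by (metis dvd_mult dvd_trans power2_eq_square)
    qed
    finally have "fps_const \<pi> * ?c dvd F oo g CARD('p)" .
    moreover have "F oo g CARD('p) = (E oo g CARD('p)) * ?c" by (subst E) (simp add: fps_compose_mult_distrib mult.commute)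
    ultimately have "fps_const \<pi> * ?c dvd (E oo g CARD('p)) * ?c" by (simp only:)
    hence "fps_const \<pi> dvd E oo g CARD('p)" using c0 by (simp only: dvd_mult_cancel_right simp_thms)
    hence "fps_const \<pi> dvd E" by (rule pi_dvd_compose_multiple_p)
    hence "fps_const \<pi> * ?c dvd E * ?c" by (intro mult_dvd_mono dvd_refl)
    moreover have "E * ?c = F" by (simp only: E mult.commute)
    ultimately show ?case by simp
  qed
  hence d: "\<pi> ^ Suc k dvd fps_nth F n" for k n unfolding fps_const_dvd_iff by blast
  have "fps_nth F n = 0" for n
  proof (rule max_ideal_separated[OF pi_in_max_ideal])
    fix k show "\<pi> ^ k dvd fps_nth F n" using d[of k n] by (metis dvd_mult_right power_Suc)
  qed
  hence "F = 0" by (simp add: fps_eq_iff)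
  thus ?thesis using f by simp
qed

lemma mazur_tate_sigma_unique:
  assumes s1: "is_mazur_tate_sigma v a4 a6 s1" and s2: "is_mazur_tate_sigma v a4 a6 s2"
  shows "s1 = s2"
proof -
  have "\<exists>S. s = fps_X * S \<and> fps_nth S 0 = 1" if "is_mazur_tate_sigma v a4 a6 s" for s
    using that fps_lead_1I[of s 1] by (auto simp: is_mazur_tate_sigma_def odd_with_lead_t_def fps_lead_def)
  then obtain S1 S2 where S: "s1 = fps_X * S1" "fps_nth S1 0 = 1" "s2 = fps_X * S2" "fps_nth S2 0 = 1"
    using s1 s2 by metis
  obtain I where I: "S2 * I = 1" "fps_nth I 0 = 1" using fps_unit_inverse_exists[OF S(4)] by blast
  define f where "f = S1 * I"
  have f0: "fps_nth f 0 = 1" by (simp add: f_def S I)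
  have "f * s2 = fps_X * S1 * (S2 * I)" by (simp add: f_def S mult_ac)
  hence f: "s1 = f * s2" using I S by simp
  have "f = 1" by (rule multiplier_eq_1[OF f0 sigma_quotient_p[OF s1 s2 f f0]])
  thus ?thesis using f by simp
qed

end

lemma specialized_sigma_is_mazur_tate:
  fixes \<sigma> :: "'p :: prime_card_gt3 univ_Rhat fps"
  assumes \<sigma>: "is_universal_sigma \<sigma>" and hom: "comm_ring_hom \<rho>"
    and a: "\<rho> (R_to_Rhat A4) = a4" "\<rho> (R_to_Rhat A6) = a6"
  shows "is_mazur_tate_sigma v a4 a6 (fps_map_coeffs \<rho> \<sigma>)"
proof (rule is_mazur_tate_sigmaI)
  let ?A4 = "R_to_Rhat A4 :: 'p univ_Rhat" and ?A6 = "R_to_Rhat A6 :: 'p univ_Rhat"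
  have odd: "odd_with_lead_t \<sigma>" using \<sigma> by (simp add: is_universal_sigma_def)
  have odd_map: "odd_with_lead_t (fps_map_coeffs h \<sigma>)" if h: "comm_ring_hom h" for h
  proof -
    interpret h: comm_ring_hom h by (rule h)
    interpret m: comm_ring_hom "fps_map_coeffs h" by (rule comm_ring_hom_fps_map_coeffs[OF h])
    have "fps_map_coeffs h (\<sigma> oo (- fps_X)) = fps_map_coeffs h (- \<sigma>)" using odd by (simp add: odd_with_lead_t_def)
    thus ?thesis using odd
      by (simp add: odd_with_lead_t_def fps_map_coeffs_compose[OF h] m.hom_uminus fps_map_coeffs_X[OF h])
  qed
  show "odd_with_lead_t (fps_map_coeffs \<rho> \<sigma>)" by (rule odd_map[OF hom])
  obtain c where c: "weier_D ?A4 ?A6 (weier_D ?A4 ?A6 (fps_to_fls \<sigma>) * fls_inv1 (fps_to_fls \<sigma>)) + weier_x ?A4 ?A6 = fls_const c"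
    using \<sigma> by (auto simp: is_universal_sigma_def Let_def)
  define q where "q = weier_J ?A4 ?A6 * fps_deriv \<sigma>"
  have ode: "weier_J ?A4 ?A6 * weier_w ?A4 ?A6 * (fps_deriv q * \<sigma> - q * fps_deriv \<sigma>)
      = (fps_const c * weier_w ?A4 ?A6 - fps_X) * \<sigma> ^ 2"
    by (rule sigma_ode[OF _ odd c q_def]) simp
  \<comment> \<open>Constants in the ring with two indeterminates; the inner indeterminate serves as
    \<open>\<alpha>\<close>, the outer as \<open>\<beta>\<close>. The evaluation
    \<open>\<epsilon>\<close> below sends them to the given elements of \<open>A\<close> and
    restricts to \<open>\<rho>\<close> on constants.\<close>
  define \<iota> :: "'p univ_Rhat \<Rightarrow> 'p univ_Rhat poly poly" where "\<iota> x = [:[:x:]:]" for x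
  have \<iota>: "comm_ring_hom \<iota>" by unfold_locales (simp_all add: \<iota>_def one_pCons)
  interpret m: comm_ring_hom "fps_map_coeffs \<iota>" by (rule comm_ring_hom_fps_map_coeffs[OF \<iota>])
  note maps = m.hom_mult m.hom_minus m.hom_power fps_map_coeffs_weier_w[OF \<iota>]
    fps_map_coeffs_weier_J[OF \<iota>] fps_map_coeffs_deriv[OF \<iota>] fps_map_coeffs_X[OF \<iota>] fps_map_coeffs_const[OF \<iota>]
  let ?\<sigma> = "fps_map_coeffs \<iota> \<sigma>" and ?q = "fps_map_coeffs \<iota> q"
  let ?\<alpha> = "[:[:0, 1:]:] :: 'p univ_Rhat poly poly" and ?\<beta> = "[:0, 1:] :: 'p univ_Rhat poly poly"
  let ?u = "fps_const ?\<alpha> * fps_X" and ?v = "fps_const ?\<beta> * fps_X"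
  have univ: "(?\<sigma> oo formal_sum (\<iota> ?A4) (\<iota> ?A6) ?u ?v) * (?\<sigma> oo formal_sum (\<iota> ?A4) (\<iota> ?A6) ?u (- ?v))
      * ((weier_w (\<iota> ?A4) (\<iota> ?A6) oo ?u) * (weier_w (\<iota> ?A4) (\<iota> ?A6) oo ?v))
    = (?\<sigma> oo ?u) ^ 2 * (?\<sigma> oo ?v) ^ 2 * (?v * (weier_w (\<iota> ?A4) (\<iota> ?A6) oo ?u) - ?u * (weier_w (\<iota> ?A4) (\<iota> ?A6) oo ?v))"
  proof (rule sigma_identity[OF odd_map[OF \<iota>]])
    show "?q = weier_J (\<iota> ?A4) (\<iota> ?A6) * fps_deriv ?\<sigma>" unfolding q_def by (simp only: maps)
    show "weier_J (\<iota> ?A4) (\<iota> ?A6) * weier_w (\<iota> ?A4) (\<iota> ?A6) * (fps_deriv ?q * ?\<sigma> - ?q * fps_deriv ?\<sigma>)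
      = (fps_const (\<iota> c) * weier_w (\<iota> ?A4) (\<iota> ?A6) - fps_X) * ?\<sigma> ^ 2"
      using arg_cong[OF ode, of "fps_map_coeffs \<iota>"] by (simp only: maps)
  qed simp_all
  fix \<alpha> \<beta> :: 'a
  define \<epsilon> where "\<epsilon> = poly_eval_hom (poly_eval_hom \<rho> \<alpha>) \<beta>"
  have h1: "comm_ring_hom (poly_eval_hom \<rho> \<alpha>)" by (rule comm_ring_hom_poly_eval[OF hom])
  have \<epsilon>: "comm_ring_hom \<epsilon>" unfolding \<epsilon>_def by (rule comm_ring_hom_poly_eval[OF h1])
  have \<epsilon>\<iota>: "\<epsilon> (\<iota> x) = \<rho> x" for x
    unfolding \<epsilon>_def \<iota>_def by (simp only: poly_eval_hom_const[OF h1] poly_eval_hom_const[OF hom])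
  have \<epsilon>\<alpha>: "\<epsilon> ?\<alpha> = \<alpha>" unfolding \<epsilon>_def by (simp only: poly_eval_hom_const[OF h1] poly_eval_hom_X[OF hom])
  have \<epsilon>\<beta>: "\<epsilon> ?\<beta> = \<beta>" unfolding \<epsilon>_def by (simp only: poly_eval_hom_X[OF h1])
  interpret e: comm_ring_hom "fps_map_coeffs \<epsilon>" by (rule comm_ring_hom_fps_map_coeffs[OF \<epsilon>])
  have s: "fps_map_coeffs \<epsilon> ?\<sigma> = fps_map_coeffs \<rho> \<sigma>" by (simp add: fps_eq_iff \<epsilon>\<iota>)
  have u0: "fps_nth ?u 0 = 0" "fps_nth ?v 0 = 0" "fps_nth (- ?v) 0 = 0" by simp_all
  note emaps = e.hom_mult e.hom_minus e.hom_power e.hom_uminus fps_map_coeffs_compose[OF \<epsilon>] fps_map_coeffs_weier_w[OF \<epsilon>]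
    fps_map_coeffs_formal_sum[OF \<epsilon> u0(1,2)] fps_map_coeffs_formal_sum[OF \<epsilon> u0(1,3)]
    fps_map_coeffs_X[OF \<epsilon>] fps_map_coeffs_const[OF \<epsilon>] s \<epsilon>\<iota> \<epsilon>\<alpha> \<epsilon>\<beta> a
  show "sigma_defect a4 a6 (fps_map_coeffs \<rho> \<sigma>) (fps_const \<alpha> * fps_X) (fps_const \<beta> * fps_X) = 0"
    unfolding sigma_defect_def using arg_cong[OF univ, of "fps_map_coeffs \<epsilon>"] by (simp only: emaps right_minus_eq)
qed

end

theorem theorem14:
  fixes v :: "'a :: idom fract \<Rightarrow> int"
    and a4 a6 :: 'a
    and \<rho> :: "univ_R \<Rightarrow> 'a"
    and \<sigma> :: "'p :: prime_card_gt3 univ_Rhat fps"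
  assumes "complete_dvr v"
    and "of_nat CARD('p) \<in> (max_ideal :: 'a set)"
    and "ec_disc a4 a6 \<noteq> 0"
    and "ordinary_reduction CARD('p) a4 a6"
    and "comm_ring_hom \<rho>" "\<rho> A4 = a4" "\<rho> A6 = a6"
    and "is_universal_sigma \<sigma>"
  shows "\<rho> (hasse CARD('p)) dvd 1 \<and>
    (\<exists>!\<rho>H :: 'p univ_RH \<Rightarrow> 'a. comm_ring_hom \<rho>H \<and> (\<forall>r. \<rho>H (R_to_RH r) = \<rho> r)) \<and>
    (\<exists>!\<rho>hat :: 'p univ_Rhat \<Rightarrow> 'a. comm_ring_hom \<rho>hat \<and> (\<forall>r. \<rho>hat (R_to_Rhat r) = \<rho> r)) \<and>
    (\<exists>!s. is_mazur_tate_sigma v a4 a6 s) \<and>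
    (\<forall>\<rho>hat :: 'p univ_Rhat \<Rightarrow> 'a. comm_ring_hom \<rho>hat \<and> (\<forall>r. \<rho>hat (R_to_Rhat r) = \<rho> r) \<longrightarrow>
       fps_map_coeffs \<rho>hat \<sigma> = mazur_tate_sigma v a4 a6)"
proof -
  interpret cdvr v by unfold_locales (rule assms)
  have H: "hasse_coeff CARD('p) a4 a6 \<notin> max_ideal" by (rule hasse_ordinary[OF assms(2,4)])
  have "\<rho> (hasse CARD('p)) = hasse_coeff CARD('p) a4 a6"
    by (simp add: hasse_eq hasse_coeff_hom[OF assms(5)] assms(6,7))
  hence unit: "\<rho> (hasse CARD('p)) dvd 1" using H by (simp add: max_ideal_def)
  note RH = RH_extension[OF assms(5) unit]
  note Rhat = Rhat_extension[OF assms(5) unit assms(2)]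
  have lead: "fps_nth (formal_multiple a4 a6 CARD('p)) CARD('p) \<notin> max_ideal"
    using lead_iff_hasse[OF assms(2)] H by blast
  have sigma: "is_mazur_tate_sigma v a4 a6 (fps_map_coeffs \<rho>hat \<sigma>)"
    if "comm_ring_hom \<rho>hat" "\<forall>r. \<rho>hat (R_to_Rhat r) = \<rho> r" for \<rho>hat :: "'p univ_Rhat \<Rightarrow> 'a"
    by (rule specialized_sigma_is_mazur_tate[OF assms(8) that(1)]) (simp_all add: that(2) assms)
  note uniq = mazur_tate_sigma_unique[OF assms(2) lead]
  \<comment> \<open>Existence comes from the extension of \<open>\<rho>\<close> to the completion,
    applied to the coefficients of \<open>\<sigma>\<close>.\<close>
  have ex1: "\<exists>!s. is_mazur_tate_sigma v a4 a6 s" using Rhat sigma uniq by blast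
  have "fps_map_coeffs \<rho>hat \<sigma> = mazur_tate_sigma v a4 a6"
    if "comm_ring_hom \<rho>hat" "\<forall>r. \<rho>hat (R_to_Rhat r) = \<rho> r" for \<rho>hat :: "'p univ_Rhat \<Rightarrow> 'a"
    unfolding mazur_tate_sigma_def by (rule the1_equality[OF ex1 sigma[OF that], symmetric])
  thus ?thesis using unit RH Rhat ex1 by blast
qed

end
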